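(* Assume that, for some $T<\infty$, the following hold. (1) $|q|_\infty<\infty$, and for all $0\le t\le T$, $g_t$ is positive and $|g_t|_\infty<\infty$. (2) $|\omega_t|_\infty<\infty$ for all $0\le t\le T$, and $|\vartheta_t|_\infty<\infty$, $|p_t|_\infty<\infty$ for all $1\le t\le T$. (3) For all $0\le t\le T-1$, $|\vartheta_{t|T}/\gamma_{t+1}|_\infty<\infty$ and $|r_{t|T}|_\infty<\infty$; for all $0\le t\le T$, $|\check\omega_{t|T}|_\infty<\infty$; and for all $1\le t\le T-1$, $|\tilde\vartheta_{t|T}\odot\gamma_{t+1}^{-1}|_\infty<\infty$, $|q\odot\gamma_{t+1}^{-1}|_\infty<\infty$, $|\tilde\omega_{t|T}|_\infty<\infty$ and $|\tilde r_{t|T}|_\infty<\infty$. Then, for all $0\le s<t\le T$, there exist constants $0<B_{s,t|T},C_{s,t|T}<\infty$ such that for all $N\ge 1$, all $\epsilon>0$ and all bounded measurable $h:\mathsf X\times\mathsf X\to\mathbb R$, $$\mathbb P\left(\left|\sum_{i,j=1}^N\frac{\omega_s^i}{\Omega_s}\frac{\check\omega_{t|T}^j}{\check\Omega_{t|T}}\,h(\xi_s^i,\check\xi_{t|T}^j)-\phi_{\chi,s}\otimes\psi_{\gamma,t|T}[h]\right|>\epsilon\right)\le B_{s,t|T}\,e^{-C_{s,t|T}N\epsilon^2/\mathrm{osc}^2(h)}.$$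
   Context: **Model.** $(\mathsf X,\mathcal X)$ is a measurable space with countably generated $\sigma$-field, $\lambda$ a ($\sigma$-finite) measure on it; $dx$ stands for $\lambda(dx)$. $Q$ is a Markov kernel on $\mathsf X$ with $Q(x,dx')=q(x,x')\,dx'$. $g_0,\dots,g_T$ are positive measurable functions on $\mathsf X$, $\chi$ a probability on $\mathsf X$. $|\cdot|_\infty$ is the supremum norm, $\mathrm{osc}(h)=\sup_{z,z'}|h(z)-h(z')|$ (when $\mathrm{osc}(h)=0$ the exponential bound is read as $0$), and $(f\odot g)(x,x')=f(x,x')g(x')$ for $f:\mathsf X^2\to\mathbb R$, $g:\mathsf X\to\mathbb R$. $\mu[h]$ denotes $\int h\,d\mu$. The filtering distribution is $$\phi_{\chi,s}[h]=\frac{\int\chi(dx_0)g_0(x_0)\prod_{u=1}^sQ(x_{u-1},dx_u)g_u(x_u)\,h(x_s)}{\int\chi(dx_0)g_0(x_0)\prod_{u=1}^sQ(x_{u-1},dx_u)g_u(x_u)}.$$ $\gamma_0,\dots,\gamma_T$ are positive measurable functions with $\int\gamma_t(x_t)dx_t\left[\prod_{u=t+1}^Tg_{u-1}(x_{u-1})Q(x_{u-1},dx_u)\right]g_T(x_T)<\infty$ for all $0\le t\le T$, and the backward information filter is $$\psi_{\gamma,t|T}[h]=\frac{\int\gamma_t(x_t)dx_t\left[\prod_{u=t+1}^Tg_{u-1}(x_{u-1})Q(x_{u-1},dx_u)\right]g_T(x_T)h(x_t)}{\int\gamma_t(x_t)dx_t\left[\prod_{u=t+1}^Tg_{u-1}(x_{u-1})Q(x_{u-1},dx_u)\right]g_T(x_T)}.$$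 **Forward filter.** $\rho_0$ is a probability with $\chi\ll\rho_0$; for $1\le t\le T$, $\vartheta_t\ge0$ is a measurable function on $\mathsf X$ and $p_t(x,\cdot)$ a Markov transition density w.r.t. $\lambda$. Set $$\omega_0(x)=\frac{d\chi}{d\rho_0}(x)g_0(x),\qquad \omega_t(x,x')=\frac{q(x,x')g_t(x')}{\vartheta_t(x)p_t(x,x')}\ (t\ge1).$$ $\xi_0^1,\dots,\xi_0^N$ are i.i.d. from $\rho_0$, $\omega_0^\ell=\omega_0(\xi_0^\ell)$. For $s\ge1$, conditionally on the past, the pairs $(I_s^\ell,\xi_s^\ell)$, $1\le \ell\le N$, are i.i.d. on $\{1,\dots,N\}\times\mathsf X$ with density proportional to $(i,x)\mapsto\omega_{s-1}^i\vartheta_s(\xi_{s-1}^i)p_s(\xi_{s-1}^i,x)$, and $\omega_s^\ell=\omega_s(\xi_{s-1}^{I_s^\ell},\xi_s^\ell)$. $\Omega_s=\sum_\ell\omega_s^\ell$. **Backward filter.** $\check\rho_T$ is a probability density on $\mathsf X$; for $0\le t\le T-1$, $\vartheta_{t|T}\ge0$ is a measurable function on $\mathsf X$ and $r_{t|T}(x',\cdot)$ a Markov transition density. Set $$\check\omega_{T|T}(x)=\frac{g_T(x)\gamma_T(x)}{\check\rho_T(x)},\qquad\check\omega_{t|T}(x,x')=\frac{\gamma_t(x)g_t(x)q(x,x')}{\vartheta_{t|T}(x')r_{t|T}(x',x)}\ (t<T).$$ $\check\xi_{T|T}^1,\dots,\check\xi_{T|T}^N$ are i.i.d. from $\check\rho_T$,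 $\check\omega_{T|T}^i=\check\omega_{T|T}(\check\xi_{T|T}^i)$. For $t=T-1,\dots,0$, conditionally on the previously generated backward particles, the pairs $(\check I_t^i,\check\xi_{t|T}^i)$, $1\le i\le N$, are i.i.d. with density proportional to $(j,x)\mapsto\check\omega_{t+1|T}^j\,\vartheta_{t|T}(\check\xi_{t+1|T}^j)\,\gamma_{t+1}^{-1}(\check\xi_{t+1|T}^j)\,r_{t|T}(\check\xi_{t+1|T}^j,x)$, and $\check\omega_{t|T}^i=\check\omega_{t|T}(\check\xi_{t|T}^i,\check\xi_{t+1|T}^{\check I_t^i})$. $\check\Omega_{t|T}=\sum_i\check\omega_{t|T}^i$. The forward and backward particle systems are independent. **Smoothing proposals (used only in the assumptions).** For $1\le t\le T-1$, $\tilde\vartheta_{t|T}\ge0$ is a measurable function on $\mathsf X^2$, $\tilde r_{t|T}(x,x';\cdot)$ is a probability density for each $(x,x')$, and $$\tilde\omega_{t|T}(x,x';x'')=\frac{q(x,x'')q(x'',x')g_t(x'')}{\tilde\vartheta_{t|T}(x,x')\tilde r_{t|T}(x,x';x'')}.$$ **Conventions.** In weight functions, $0/0=0$ and $c/0=\infty$ for $c>0$. All sums of weights and normalizing constants appearing in denominators are assumed almost surely positive, so that all estimators and sampling distributions are well defined. *)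

theory Defs
  imports "HOL-Probability.Probability"
begin

definition sup_norm :: "'b set \<Rightarrow> ('b \<Rightarrow> real) \<Rightarrow> ennreal" where
  "sup_norm A f = (SUP z\<in>A. ennreal \<bar>f z\<bar>)"

text \<open>A real supremum: meaningful only for bounded \<open>h\<close> on a nonempty set.\<close>

definition osc :: "'b set \<Rightarrow> ('b \<Rightarrow> real) \<Rightarrow> real" where
  "osc A h = (SUP (z, z')\<in>A \<times> A. \<bar>h z - h z'\<bar>)"

definition odot :: "('a \<Rightarrow> 'a \<Rightarrow> real) \<Rightarrow> ('a \<Rightarrow> real) \<Rightarrow> 'a \<times> 'a \<Rightarrow> real" where
  "odot f g = (\<lambda>(x, x'). f x x' * g x')"

definition countably_generated :: "'a measure \<Rightarrow> bool" where
  "countably_generated M \<longleftrightarrow>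
     (\<exists>C. countable C \<and> C \<subseteq> Pow (space M) \<and> sets M = sigma_sets (space M) C)"

definition prob_density :: "'a measure \<Rightarrow> ('a \<Rightarrow> real) \<Rightarrow> bool" where
  "prob_density lam f \<longleftrightarrow> f \<in> borel_measurable lam \<and> (\<forall>x\<in>space lam. 0 \<le> f x) \<and>
     (\<integral>\<^sup>+x. ennreal (f x) \<partial>lam) = 1"

definition transition_density :: "'a measure \<Rightarrow> ('a \<Rightarrow> 'a \<Rightarrow> real) \<Rightarrow> bool" where
  "transition_density lam k \<longleftrightarrow>
     (\<lambda>(x, x'). k x x') \<in> borel_measurable (lam \<Otimes>\<^sub>M lam) \<and>
     (\<forall>x\<in>space lam. prob_density lam (k x))"

definition kernel :: "'a measure \<Rightarrow> ('a \<Rightarrow> 'a \<Rightarrow> real) \<Rightarrow> 'a \<Rightarrow> 'a measure" where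
  "kernel lam q x = density lam (\<lambda>x'. ennreal (q x x'))"

definition prob_normalize :: "'b measure \<Rightarrow> 'b measure" where
  "prob_normalize M = scale_measure (1 / emeasure M (space M)) M"

text \<open>The law of the last coordinate under
  \<open>chi(dx\<^sub>0) g\<^sub>0(x\<^sub>0) \<Prod>\<^sub>u Q(x\<^sub>u\<^sub>-\<^sub>1, dx\<^sub>u) g\<^sub>u(x\<^sub>u)\<close>, before normalization.\<close>

primrec forward_measure ::
  "'a measure \<Rightarrow> ('a \<Rightarrow> 'a \<Rightarrow> real) \<Rightarrow> (nat \<Rightarrow> 'a \<Rightarrow> real) \<Rightarrow> 'a measure \<Rightarrow> nat \<Rightarrow> 'a measure" where
  "forward_measure lam q g chi 0 = density chi (\<lambda>x. ennreal (g 0 x))"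
| "forward_measure lam q g chi (Suc s) =
     density (forward_measure lam q g chi s \<bind> kernel lam q) (\<lambda>x. ennreal (g (Suc s) x))"

definition filter_dist ::
  "'a measure \<Rightarrow> ('a \<Rightarrow> 'a \<Rightarrow> real) \<Rightarrow> (nat \<Rightarrow> 'a \<Rightarrow> real) \<Rightarrow> 'a measure \<Rightarrow> nat \<Rightarrow> 'a measure" where
  "filter_dist lam q g chi s = prob_normalize (forward_measure lam q g chi s)"

text \<open>\<open>backward_likelihood lam q g T t x\<close> is
  \<open>\<integral> [\<Prod>\<^sub>u\<^sub>=\<^sub>t\<^sub>+\<^sub>1\<^sup>T g\<^sub>u\<^sub>-\<^sub>1(x\<^sub>u\<^sub>-\<^sub>1) Q(x\<^sub>u\<^sub>-\<^sub>1, dx\<^sub>u)] g\<^sub>T(x\<^sub>T)\<close> with \<open>x\<^sub>t = x\<close>, for \<open>t \<le> T\<close>.\<close>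

function backward_likelihood ::
  "'a measure \<Rightarrow> ('a \<Rightarrow> 'a \<Rightarrow> real) \<Rightarrow> (nat \<Rightarrow> 'a \<Rightarrow> real) \<Rightarrow> nat \<Rightarrow> nat \<Rightarrow> 'a \<Rightarrow> ennreal" where
  "backward_likelihood lam q g T t =
     (if t < T
      then (\<lambda>x. ennreal (g t x) *
                 (\<integral>\<^sup>+x'. backward_likelihood lam q g T (Suc t) x' \<partial>kernel lam q x))
      else (\<lambda>x. ennreal (g T x)))"
  by pat_completeness auto
termination by (relation "Wellfounded.measure (\<lambda>(lam, q, g, T, t). T - t)") auto

declare backward_likelihood.simps [simp del]

definition backward_measure ::
  "'a measure \<Rightarrow> ('a \<Rightarrow> 'a \<Rightarrow> real) \<Rightarrow> (nat \<Rightarrow> 'a \<Rightarrow> real) \<Rightarrow> (nat \<Rightarrow> 'a \<Rightarrow> real) \<Rightarrow> nat \<Rightarrow> nat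
     \<Rightarrow> 'a measure" where
  "backward_measure lam q g gam T t =
     density lam (\<lambda>x. ennreal (gam t x) * backward_likelihood lam q g T t x)"

definition backward_info_filter ::
  "'a measure \<Rightarrow> ('a \<Rightarrow> 'a \<Rightarrow> real) \<Rightarrow> (nat \<Rightarrow> 'a \<Rightarrow> real) \<Rightarrow> (nat \<Rightarrow> 'a \<Rightarrow> real) \<Rightarrow> nat \<Rightarrow> nat
     \<Rightarrow> 'a measure" where
  "backward_info_filter lam q g gam T t = prob_normalize (backward_measure lam q g gam T t)"

text \<open>Division on \<^typ>\<open>ennreal\<close> satisfies \<open>0 / 0 = 0\<close> and \<open>c / 0 = \<infinity>\<close> for \<open>c > 0\<close>, which is the
  intended convention for weights; all quotients below are therefore taken there.\<close>

text \<open>\<open>D\<close> is a version of the Radon-Nikodym derivative of the initial law with respect to the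
  initial proposal.\<close>

definition omega0 :: "('a \<Rightarrow> ennreal) \<Rightarrow> (nat \<Rightarrow> 'a \<Rightarrow> real) \<Rightarrow> 'a \<Rightarrow> ennreal" where
  "omega0 D g x = D x * ennreal (g 0 x)"

definition omega ::
  "('a \<Rightarrow> 'a \<Rightarrow> real) \<Rightarrow> (nat \<Rightarrow> 'a \<Rightarrow> real) \<Rightarrow> (nat \<Rightarrow> 'a \<Rightarrow> real) \<Rightarrow> (nat \<Rightarrow> 'a \<Rightarrow> 'a \<Rightarrow> real)
     \<Rightarrow> nat \<Rightarrow> 'a \<Rightarrow> 'a \<Rightarrow> ennreal" where
  "omega q g th p t x x' = ennreal (q x x' * g t x') / ennreal (th t x * p t x x')"

definition bomegaT ::
  "(nat \<Rightarrow> 'a \<Rightarrow> real) \<Rightarrow> (nat \<Rightarrow> 'a \<Rightarrow> real) \<Rightarrow> ('a \<Rightarrow> real) \<Rightarrow> nat \<Rightarrow> 'a \<Rightarrow> ennreal" where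
  "bomegaT g gam brho T x = ennreal (g T x * gam T x) / ennreal (brho x)"

definition bomega ::
  "('a \<Rightarrow> 'a \<Rightarrow> real) \<Rightarrow> (nat \<Rightarrow> 'a \<Rightarrow> real) \<Rightarrow> (nat \<Rightarrow> 'a \<Rightarrow> real) \<Rightarrow> (nat \<Rightarrow> 'a \<Rightarrow> real)
     \<Rightarrow> (nat \<Rightarrow> 'a \<Rightarrow> 'a \<Rightarrow> real) \<Rightarrow> nat \<Rightarrow> 'a \<Rightarrow> 'a \<Rightarrow> ennreal" where
  "bomega q g gam bth r t x x' =
     ennreal (gam t x * g t x * q x x') / ennreal (bth t x' * r t x' x)"

definition tomega ::
  "('a \<Rightarrow> 'a \<Rightarrow> real) \<Rightarrow> (nat \<Rightarrow> 'a \<Rightarrow> real) \<Rightarrow> (nat \<Rightarrow> 'a \<Rightarrow> 'a \<Rightarrow> real)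
     \<Rightarrow> (nat \<Rightarrow> 'a \<Rightarrow> 'a \<Rightarrow> 'a \<Rightarrow> real) \<Rightarrow> nat \<Rightarrow> 'a \<Rightarrow> 'a \<Rightarrow> 'a \<Rightarrow> ennreal" where
  "tomega q g tth tr t x x' x'' =
     ennreal (q x x'' * q x'' x' * g t x'') / ennreal (tth t x x' * tr t x x' x'')"

text \<open>Particles \<open>xi u l\<close> and indices \<open>I u l\<close> are random variables on \<open>P\<close>, with \<open>u\<close> the time and
  \<open>l \<in> {1..N}\<close> the particle number. \<open>particle_algebra P lam N U V xi I\<close> is the sub-sigma-field
  of \<open>P\<close> generated by the particles at times in \<open>U\<close> and the indices at times in \<open>V\<close>.\<close>

definition particle_algebra ::
  "'w measure \<Rightarrow> 'a measure \<Rightarrow> nat \<Rightarrow> nat set \<Rightarrow> nat set \<Rightarrow> (nat \<Rightarrow> nat \<Rightarrow> 'w \<Rightarrow> 'a)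
     \<Rightarrow> (nat \<Rightarrow> nat \<Rightarrow> 'w \<Rightarrow> nat) \<Rightarrow> 'w measure" where
  "particle_algebra P lam N U V xi I = sigma (space P)
     ({xi u l -` A \<inter> space P | u l A. u \<in> U \<and> l \<in> {1..N} \<and> A \<in> sets lam} \<union>
      {I u l -` J \<inter> space P | u l J. u \<in> V \<and> l \<in> {1..N}})"

text \<open>Conditionally on \<open>F\<close>, the \<open>S\<close>-valued variables \<open>Z 1, \<dots>, Z N\<close> are i.i.d. with the
  (random) distribution \<open>K\<close>.\<close>

definition cond_iid ::
  "'w measure \<Rightarrow> 'w measure \<Rightarrow> nat \<Rightarrow> 'b measure \<Rightarrow> (nat \<Rightarrow> 'w \<Rightarrow> 'b) \<Rightarrow> ('w \<Rightarrow> 'b measure) \<Rightarrow> bool"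
where
  "cond_iid P F N S Z K \<longleftrightarrow>
     (\<forall>l\<in>{1..N}. Z l \<in> measurable P S) \<and>
     (\<forall>A. (\<forall>l\<in>{1..N}. A l \<in> sets S) \<longrightarrow>
        (AE w in P.
           real_cond_exp P F (indicat_real {v \<in> space P. \<forall>l\<in>{1..N}. Z l v \<in> A l}) w
           = (\<Prod>l\<in>{1..N}. measure (K w) (A l))))"

fun forward_weight ::
  "('a \<Rightarrow> 'a \<Rightarrow> real) \<Rightarrow> (nat \<Rightarrow> 'a \<Rightarrow> real) \<Rightarrow> ('a \<Rightarrow> ennreal) \<Rightarrow> (nat \<Rightarrow> 'a \<Rightarrow> real)
     \<Rightarrow> (nat \<Rightarrow> 'a \<Rightarrow> 'a \<Rightarrow> real) \<Rightarrow> (nat \<Rightarrow> nat \<Rightarrow> 'w \<Rightarrow> 'a) \<Rightarrow> (nat \<Rightarrow> nat \<Rightarrow> 'w \<Rightarrow> nat)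
     \<Rightarrow> nat \<Rightarrow> nat \<Rightarrow> 'w \<Rightarrow> ennreal" where
  "forward_weight q g D th p xi I 0 l w = omega0 D g (xi 0 l w)"
| "forward_weight q g D th p xi I (Suc s) l w =
     omega q g th p (Suc s) (xi s (I (Suc s) l w) w) (xi (Suc s) l w)"

definition forward_proposal ::
  "'a measure \<Rightarrow> nat \<Rightarrow> ('a \<Rightarrow> 'a \<Rightarrow> real) \<Rightarrow> (nat \<Rightarrow> 'a \<Rightarrow> real) \<Rightarrow> ('a \<Rightarrow> ennreal)
     \<Rightarrow> (nat \<Rightarrow> 'a \<Rightarrow> real) \<Rightarrow> (nat \<Rightarrow> 'a \<Rightarrow> 'a \<Rightarrow> real) \<Rightarrow> (nat \<Rightarrow> nat \<Rightarrow> 'w \<Rightarrow> 'a)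
     \<Rightarrow> (nat \<Rightarrow> nat \<Rightarrow> 'w \<Rightarrow> nat) \<Rightarrow> nat \<Rightarrow> 'w \<Rightarrow> (nat \<times> 'a) measure" where
  "forward_proposal lam N q g D th p xi I s w =
     density (count_space {1..N} \<Otimes>\<^sub>M lam)
       (\<lambda>(i, x). forward_weight q g D th p xi I (s - 1) i w *
          ennreal (th s (xi (s - 1) i w)) * ennreal (p s (xi (s - 1) i w) x))"

definition forward_system ::
  "'w measure \<Rightarrow> 'a measure \<Rightarrow> nat \<Rightarrow> nat \<Rightarrow> ('a \<Rightarrow> 'a \<Rightarrow> real) \<Rightarrow> (nat \<Rightarrow> 'a \<Rightarrow> real)
     \<Rightarrow> 'a measure \<Rightarrow> ('a \<Rightarrow> ennreal) \<Rightarrow> (nat \<Rightarrow> 'a \<Rightarrow> real) \<Rightarrow> (nat \<Rightarrow> 'a \<Rightarrow> 'a \<Rightarrow> real)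
     \<Rightarrow> (nat \<Rightarrow> nat \<Rightarrow> 'w \<Rightarrow> 'a) \<Rightarrow> (nat \<Rightarrow> nat \<Rightarrow> 'w \<Rightarrow> nat) \<Rightarrow> bool" where
  "forward_system P lam T N q g rho0 D th p xi I \<longleftrightarrow>
     prob_space.indep_vars P (\<lambda>_. lam) (xi 0) {1..N} \<and>
     (\<forall>l\<in>{1..N}. distr P lam (xi 0 l) = rho0) \<and>
     (\<forall>s\<in>{1..T}.
        (AE w in P. 0 < emeasure (forward_proposal lam N q g D th p xi I s w)
                          ({1..N} \<times> space lam)) \<and>
        cond_iid P (particle_algebra P lam N {..<s} {1..<s} xi I) N
          (count_space {1..N} \<Otimes>\<^sub>M lam) (\<lambda>l w. (I s l w, xi s l w))
          (\<lambda>w. prob_normalize (forward_proposal lam N q g D th p xi I s w)))"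

definition backward_weight ::
  "nat \<Rightarrow> ('a \<Rightarrow> 'a \<Rightarrow> real) \<Rightarrow> (nat \<Rightarrow> 'a \<Rightarrow> real) \<Rightarrow> (nat \<Rightarrow> 'a \<Rightarrow> real) \<Rightarrow> ('a \<Rightarrow> real)
     \<Rightarrow> (nat \<Rightarrow> 'a \<Rightarrow> real) \<Rightarrow> (nat \<Rightarrow> 'a \<Rightarrow> 'a \<Rightarrow> real) \<Rightarrow> (nat \<Rightarrow> nat \<Rightarrow> 'w \<Rightarrow> 'a)
     \<Rightarrow> (nat \<Rightarrow> nat \<Rightarrow> 'w \<Rightarrow> nat) \<Rightarrow> nat \<Rightarrow> nat \<Rightarrow> 'w \<Rightarrow> ennreal" where
  "backward_weight T q g gam brho bth r bxi bI t l w =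
     (if t = T then bomegaT g gam brho T (bxi T l w)
      else bomega q g gam bth r t (bxi t l w) (bxi (Suc t) (bI t l w) w))"

definition backward_proposal ::
  "'a measure \<Rightarrow> nat \<Rightarrow> nat \<Rightarrow> ('a \<Rightarrow> 'a \<Rightarrow> real) \<Rightarrow> (nat \<Rightarrow> 'a \<Rightarrow> real) \<Rightarrow> (nat \<Rightarrow> 'a \<Rightarrow> real)
     \<Rightarrow> ('a \<Rightarrow> real) \<Rightarrow> (nat \<Rightarrow> 'a \<Rightarrow> real) \<Rightarrow> (nat \<Rightarrow> 'a \<Rightarrow> 'a \<Rightarrow> real)
     \<Rightarrow> (nat \<Rightarrow> nat \<Rightarrow> 'w \<Rightarrow> 'a) \<Rightarrow> (nat \<Rightarrow> nat \<Rightarrow> 'w \<Rightarrow> nat) \<Rightarrow> nat \<Rightarrow> 'w \<Rightarrow> (nat \<times> 'a) measure" where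
  "backward_proposal lam T N q g gam brho bth r bxi bI t w =
     density (count_space {1..N} \<Otimes>\<^sub>M lam)
       (\<lambda>(j, x). backward_weight T q g gam brho bth r bxi bI (Suc t) j w *
          ennreal (bth t (bxi (Suc t) j w) / gam (Suc t) (bxi (Suc t) j w)) *
          ennreal (r t (bxi (Suc t) j w) x))"

definition backward_system ::
  "'w measure \<Rightarrow> 'a measure \<Rightarrow> nat \<Rightarrow> nat \<Rightarrow> ('a \<Rightarrow> 'a \<Rightarrow> real) \<Rightarrow> (nat \<Rightarrow> 'a \<Rightarrow> real)
     \<Rightarrow> (nat \<Rightarrow> 'a \<Rightarrow> real) \<Rightarrow> ('a \<Rightarrow> real) \<Rightarrow> (nat \<Rightarrow> 'a \<Rightarrow> real) \<Rightarrow> (nat \<Rightarrow> 'a \<Rightarrow> 'a \<Rightarrow> real)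
     \<Rightarrow> (nat \<Rightarrow> nat \<Rightarrow> 'w \<Rightarrow> 'a) \<Rightarrow> (nat \<Rightarrow> nat \<Rightarrow> 'w \<Rightarrow> nat) \<Rightarrow> bool" where
  "backward_system P lam T N q g gam brho bth r bxi bI \<longleftrightarrow>
     prob_space.indep_vars P (\<lambda>_. lam) (bxi T) {1..N} \<and>
     (\<forall>l\<in>{1..N}. distr P lam (bxi T l) = density lam (\<lambda>x. ennreal (brho x))) \<and>
     (\<forall>t<T.
        (AE w in P. 0 < emeasure (backward_proposal lam T N q g gam brho bth r bxi bI t w)
                          ({1..N} \<times> space lam)) \<and>
        cond_iid P (particle_algebra P lam N {t<..T} {t<..<T} bxi bI) N
          (count_space {1..N} \<Otimes>\<^sub>M lam) (\<lambda>l w. (bI t l w, bxi t l w))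
          (\<lambda>w. prob_normalize (backward_proposal lam T N q g gam brho bth r bxi bI t w)))"

definition indep_systems ::
  "'w measure \<Rightarrow> 'a measure \<Rightarrow> nat \<Rightarrow> nat \<Rightarrow> (nat \<Rightarrow> nat \<Rightarrow> 'w \<Rightarrow> 'a) \<Rightarrow> (nat \<Rightarrow> nat \<Rightarrow> 'w \<Rightarrow> nat)
     \<Rightarrow> (nat \<Rightarrow> nat \<Rightarrow> 'w \<Rightarrow> 'a) \<Rightarrow> (nat \<Rightarrow> nat \<Rightarrow> 'w \<Rightarrow> nat) \<Rightarrow> bool" where
  "indep_systems P lam T N xi I bxi bI \<longleftrightarrow>
     prob_space.indep_set P
       (sets (particle_algebra P lam N {..T} {1..T} xi I))
       (sets (particle_algebra P lam N {..T} {..<T} bxi bI))"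

end

theory Submission
  imports Defs
begin

text \<open>Given the past, the particles of one generation are i.i.d., so a conditional form of
  Hoeffding's inequality controls their weighted average around its conditional mean. This mean is
  an estimator of the previous generation, evaluated at a kernel image of the test function and
  divided by a bounded random factor that cancels after self-normalization. Induction over the
  generations therefore yields, separately for the forward and the backward filter, exponential
  bounds that scale with the range of the test function. For a function of two variables, freeze the
  forward particles: the forward average of \<open>h(x, y)\<close> over \<open>x\<close> is a bounded function of \<open>y\<close>
  independent of the backward particles, so the backward bound applies to it by Fubini. What remains
  is the forward bound for the function \<open>x \<mapsto> \<psi>[h(x, -)]\<close>. Subtracting the infimum of \<open>h\<close>
  turns the range into the oscillation.\<close>

section \<open>Conditional Hoeffding inequality\<close>

text \<open>\<open>cond_iid\<close> supplies only almost sure identities for conditional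
  probabilities of rectangles, each with its own exceptional set, and no regular conditional law of
  the whole generation. The sampling law has a jointly measurable density, however, so the joint law
  of the past and the new generation is an explicit density on a product space, and conditioning
  becomes Tonelli's theorem.

  The normalizing constant of the sampling law has no positive lower bound, so a conditional mean
  divided by it cannot be compared with a fixed target. The comparison is made after multiplication
  by a random scale that is bounded above and cancels this constant.

  Targets stay unnormalized: successive ones are then linked by a linear identity between integrals,
  of the same shape in both time directions, so one induction step serves both filters; the ratio of
  their masses is the constant \<beta>. Test functions are kept in [0, M] because a kernel image
  then lies in an interval of the same form whose length is proportional to M, which preserves the
  quadratic scaling of the exponent in every generation.\<close>

lemma sets_pair_PiM_rectangles:
  assumes "finite I"
  shows "sets (F \<Otimes>\<^sub>M PiM I M)
    = sigma_sets (space F \<times> (\<Pi>\<^sub>E i\<in>I. space (M i)))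
        {B \<times> Pi\<^sub>E I A | B A. B \<in> sets F \<and> (\<forall>i\<in>I. A i \<in> sets (M i))}"
    (is "_ = sigma_sets ?S ?E")
proof -
  let ?Eb = "{Pi\<^sub>E I A | A. \<forall>i\<in>I. A i \<in> sets (M i)}"
  have Eb: "sets (PiM I M) = sigma_sets (\<Pi>\<^sub>E i\<in>I. space (M i)) ?Eb"
  proof -
    have "prod_algebra I M = ?Eb"
      using prod_algebra_eq_finite[OF assms, of M] by (auto simp: Pi_iff)
    then show ?thesis by (simp add: sets_PiM)
  qed
  have sub: "?Eb \<subseteq> Pow (\<Pi>\<^sub>E i\<in>I. space (M i))"
    by (auto simp: PiE_iff dest: sets.sets_into_space)
  have "sets (F \<Otimes>\<^sub>M PiM I M) = sets (sigma ?S {a \<times> b |a b. a \<in> sets F \<and> b \<in> ?Eb})"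
    unfolding space_PiM[symmetric]
  \<comment> \<open>Each generator contains the whole space of its factor, so singletons serve as
    the countable covers.\<close>
  proof (rule sets_pair_eq[where Ca = "{space F}" and Cb = "{space (PiM I M)}"])
    show "sets F = sigma_sets (space F) (sets F)"
      by (simp add: sets.sigma_sets_eq)
  qed (use sub Eb sets.space_closed[of F] in \<open>auto simp: space_PiM\<close>)
  also have "{a \<times> b |a b. a \<in> sets F \<and> b \<in> ?Eb} = ?E"
    by blast
  also have "sets (sigma ?S ?E) = sigma_sets ?S ?E"
    by (rule sets_measure_of) (auto simp: PiE_iff dest: sets.sets_into_space)
  finally show ?thesis .
qed

text \<open>Rectangles form a generating \<pi>-system that contains the whole space, so a constant
  exhausting sequence works and finite mass of \<open>\<mu>\<close> on that one set is
  enough.\<close>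

lemma measure_eqI_pair_PiM:
  assumes "finite I"
    and sets: "sets \<mu> = sets (F \<Otimes>\<^sub>M PiM I M)" "sets \<nu> = sets (F \<Otimes>\<^sub>M PiM I M)"
    and fin: "emeasure \<mu> (space (F \<Otimes>\<^sub>M PiM I M)) \<noteq> \<infinity>"
    and eq: "\<And>B A. B \<in> sets F \<Longrightarrow> (\<And>i. i \<in> I \<Longrightarrow> A i \<in> sets (M i)) \<Longrightarrow>
      emeasure \<mu> (B \<times> Pi\<^sub>E I A) = emeasure \<nu> (B \<times> Pi\<^sub>E I A)"
  shows "\<mu> = \<nu>"
proof -
  let ?S = "space F \<times> (\<Pi>\<^sub>E i\<in>I. space (M i))"
  let ?E = "{B \<times> Pi\<^sub>E I A | B A. B \<in> sets F \<and> (\<forall>i\<in>I. A i \<in> sets (M i))}"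
  have S: "space (F \<Otimes>\<^sub>M PiM I M) = ?S" by (simp add: space_pair_measure space_PiM)
  show ?thesis
  proof (rule measure_eqI_generator_eq[where E = ?E and \<Omega> = ?S and A = "\<lambda>_. ?S"])
    show "Int_stable ?E"
    proof (rule Int_stableI, clarsimp)
      fix B A B' A' assume *: "B \<in> sets F" "\<forall>i\<in>I. A i \<in> sets (M i)"
        "B' \<in> sets F" "\<forall>i\<in>I. A' i \<in> sets (M i)"
      show "\<exists>C D. B \<times> Pi\<^sub>E I A \<inter> B' \<times> Pi\<^sub>E I A' = C \<times> Pi\<^sub>E I D \<and> C \<in> sets F \<and>
        (\<forall>i\<in>I. D i \<in> sets (M i))"
        by (rule exI[of _ "B \<inter> B'"], rule exI[of _ "\<lambda>i. A i \<inter> A' i"])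
           (use * in \<open>auto simp: PiE_Int[symmetric] Times_Int_Times\<close>)
    qed
    show "?E \<subseteq> Pow ?S" by (auto simp: PiE_iff dest: sets.sets_into_space)
    show "sets \<mu> = sigma_sets ?S ?E" "sets \<nu> = sigma_sets ?S ?E"
      by (simp_all add: sets sets_pair_PiM_rectangles[OF assms(1)])
    show "range (\<lambda>_. ?S) \<subseteq> ?E" by auto
    show "emeasure \<mu> X = emeasure \<nu> X" if "X \<in> ?E" for X using that eq by auto
    show "emeasure \<mu> ?S \<noteq> \<infinity>" using fin by (simp add: S)
  qed auto
qed

text \<open>Rewrites the law of an entire generation, with the past fixed, as a density with respect
  to a fixed reference power. The probability hypothesis ranges over all indices because
  \<open>product_prob_space\<close> asks for it at every index.\<close>

lemma (in product_sigma_finite) PiM_density: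
  assumes I: "finite I" and f: "\<And>i. i \<in> I \<Longrightarrow> f i \<in> borel_measurable (M i)"
    and sf: "\<And>i. prob_space (density (M i) (f i))"
  shows "PiM I (\<lambda>i. density (M i) (f i)) = density (PiM I M) (\<lambda>x. \<Prod>i\<in>I. f i (x i))"
proof -
  note f[measurable]
  interpret D: product_prob_space "\<lambda>i. density (M i) (f i)" by (rule product_prob_spaceI, rule sf)
  show ?thesis
  proof (rule D.PiM_eqI[symmetric, OF I])
    show "sets (density (PiM I M) (\<lambda>x. \<Prod>i\<in>I. f i (x i)))
      = sets (PiM I (\<lambda>i. density (M i) (f i)))"
      by (auto intro!: sets_PiM_cong)
    fix A assume A: "\<And>i. i \<in> I \<Longrightarrow> A i \<in> sets (density (M i) (f i))"
    then have A'[measurable]: "\<And>i. i \<in> I \<Longrightarrow> A i \<in> sets (M i)" by simp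
    have m: "(\<lambda>x. \<Prod>i\<in>I. f i (x i)) \<in> borel_measurable (PiM I M)"
      using f by (intro borel_measurable_prod_ennreal) auto
    have "emeasure (density (PiM I M) (\<lambda>x. \<Prod>i\<in>I. f i (x i))) (Pi\<^sub>E I A)
      = (\<integral>\<^sup>+x. (\<Prod>i\<in>I. f i (x i)) * indicator (Pi\<^sub>E I A) x \<partial>PiM I M)"
      using I A' m by (intro emeasure_density) auto
    also have "\<dots> = (\<integral>\<^sup>+x. (\<Prod>i\<in>I. f i (x i) * indicator (A i) (x i)) \<partial>PiM I M)"
    proof (rule nn_integral_cong)
      fix x assume "x \<in> space (PiM I M)"
      then have "indicator (Pi\<^sub>E I A) x = (\<Prod>i\<in>I. indicator (A i) (x i) :: ennreal)"
        using I by (auto simp: indicator_def space_PiM PiE_iff)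
      then show "(\<Prod>i\<in>I. f i (x i)) * indicator (Pi\<^sub>E I A) x
        = (\<Prod>i\<in>I. f i (x i) * indicator (A i) (x i))"
        by (simp add: prod.distrib)
    qed
    also have "\<dots> = (\<Prod>i\<in>I. \<integral>\<^sup>+y. f i y * indicator (A i) y \<partial>M i)"
      using I f A' by (intro product_nn_integral_prod) auto
    also have "\<dots> = (\<Prod>i\<in>I. emeasure (density (M i) (f i)) (A i))"
      using f A' by (intro prod.cong) (auto simp: emeasure_density)
    finally show "emeasure (density (PiM I M) (\<lambda>x. \<Prod>i\<in>I. f i (x i))) (Pi\<^sub>E I A)
      = (\<Prod>i\<in>I. emeasure (density (M i) (f i)) (A i))" .
  qed
qed

section \<open>Hoeffding bounds for i.i.d. and conditionally i.i.d. samples\<close>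

lemma Hoeffding_same_law:
  assumes P: "prob_space P" and indep: "prob_space.indep_vars P (\<lambda>_. S) Z {1..N}"
    and law: "\<And>l. l \<in> {1..N} \<Longrightarrow> distr P S (Z l) = \<nu>"
    and u: "u \<in> borel_measurable S" "\<And>z. z \<in> space S \<Longrightarrow> 0 \<le> u z \<and> u z \<le> c"
    and c: "0 < c" and N: "1 \<le> N" and \<epsilon>: "0 \<le> \<epsilon>"
  shows "measure P {w \<in> space P. \<bar>(\<Sum>l\<in>{1..N}. u (Z l w)) / real N - (\<integral>z. u z \<partial>\<nu>)\<bar> \<ge> \<epsilon>}
    \<le> 2 * exp (- 2 * real N * \<epsilon>\<^sup>2 / c\<^sup>2)"
proof -
  interpret P: prob_space P by (rule P)
  have Z: "Z l \<in> measurable P S" if "l \<in> {1..N}" for l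
    using indep that unfolding P.indep_vars_def by blast
  have one: "1 \<in> {1..N}" using N by simp
  have *: "distr P borel (\<lambda>w. u (Z l w)) = distr \<nu> borel u" if "l \<in> {1..N}" for l
    using distr_distr[OF u(1) Z[OF that]] law[OF that] by (simp add: comp_def)
  have m: "(\<lambda>w. u (Z l w)) \<in> borel_measurable P" if "l \<in> {1..N}" for l
    using measurable_compose[OF Z[OF that] u(1)] .
  have i: "P.indep_vars (\<lambda>_. borel) (\<lambda>l w. u (Z l w)) {1..N}"
    using P.indep_vars_compose2[OF indep, of "\<lambda>_. u" "\<lambda>_. borel"] u(1) by simp
  interpret H: Hoeffding_ineq_iid P "{1..N}" "\<lambda>l w. u (Z l w)" "\<lambda>w. u (Z 1 w)" 0 c
    "P.expectation (\<lambda>w. u (Z 1 w))"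
  proof unfold_locales
    show "finite {1..N}" "P.indep_vars (\<lambda>_. borel) (\<lambda>l w. u (Z l w)) {1..N}"
      "P.random_variable borel (\<lambda>w. u (Z 1 w))" using i m[OF one] by auto
    show "distr P borel (\<lambda>w. u (Z l w)) = distr P borel (\<lambda>w. u (Z 1 w))" if "l \<in> {1..N}" for l
      using *[OF that] *[OF one] by simp
    show "AE w in P. u (Z 1 w) \<in> {0..c}"
      using measurable_space[OF Z[OF one]] u(2) by auto
  qed simp
  have E: "P.expectation (\<lambda>w. u (Z 1 w)) = (\<integral>z. u z \<partial>\<nu>)"
    unfolding law[OF one, symmetric] by (rule integral_distr[OF Z[OF one] u(1), symmetric])
  have ne: "{1..N} \<noteq> {}" using one by blast
  show ?thesis
    using H.Hoeffding_ineq_abs_ge'[OF \<epsilon> c ne]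
    unfolding E card_atLeastAtMost diff_Suc_1 diff_zero by simp
qed

text \<open>Canonical version, in which the sample is the coordinate vector of a product space. It
  is applied with the past frozen, when \<open>K\<close> is the sampling law at a single
  outcome.\<close>

lemma Hoeffding_PiM:
  assumes K: "prob_space K"
    and u: "u \<in> borel_measurable K" "\<And>z. z \<in> space K \<Longrightarrow> 0 \<le> u z \<and> u z \<le> c"
    and c: "0 < c" and N: "1 \<le> N" and \<epsilon>: "0 \<le> \<epsilon>"
  shows "measure (PiM {1..N} (\<lambda>_. K)) {z \<in> space (PiM {1..N} (\<lambda>_. K)).
      \<bar>(\<Sum>l\<in>{1..N}. u (z l)) / real N - (\<integral>z. u z \<partial>K)\<bar> \<ge> \<epsilon>}
    \<le> 2 * exp (- 2 * real N * \<epsilon>\<^sup>2 / c\<^sup>2)"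
proof (rule Hoeffding_same_law[where S = K and \<nu> = K and Z = "\<lambda>l z. z l"])
  interpret Q: prob_space "PiM {1..N} (\<lambda>_. K)" by (rule prob_space_PiM, rule K)
  interpret product_prob_space "\<lambda>_::nat. K" "{1..N}" by (rule product_prob_spaceI, rule K)
  show "prob_space (PiM {1..N} (\<lambda>_. K))" by unfold_locales
  show law: "distr (PiM {1..N} (\<lambda>_. K)) K (\<lambda>z. z l) = K" if "l \<in> {1..N}" for l
    using PiM_component[OF that] .
  show "Q.indep_vars (\<lambda>_. K) (\<lambda>l z. z l) {1..N}"
  proof (subst Q.indep_vars_iff_distr_eq_PiM')
    \<comment> \<open>Restriction to the index set is the identity on extensional functions, so the
      joint law of the coordinates is the product measure itself.\<close>
    have "distr (PiM {1..N} (\<lambda>_. K)) (PiM {1..N} (\<lambda>_. K)) (\<lambda>x. \<lambda>i\<in>{1..N}. x i)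
      = distr (PiM {1..N} (\<lambda>_. K)) (PiM {1..N} (\<lambda>_. K)) (\<lambda>x. x)"
      by (rule distr_cong) (auto simp: space_PiM PiE_restrict)
    also have "\<dots> = PiM {1..N} (\<lambda>i. distr (PiM {1..N} (\<lambda>_. K)) K (\<lambda>z. z i))"
      unfolding distr_id by (rule PiM_cong) (simp_all only: law)
    finally show "distr (PiM {1..N} (\<lambda>_. K)) (PiM {1..N} (\<lambda>_. K)) (\<lambda>x. \<lambda>i\<in>{1..N}. x i)
      = PiM {1..N} (\<lambda>i. distr (PiM {1..N} (\<lambda>_. K)) K (\<lambda>z. z i))" .
    show "{1..N} \<noteq> {}" using N by simp
    show "(\<lambda>z. z l) \<in> PiM {1..N} (\<lambda>_. K) \<rightarrow>\<^sub>M K" if "l \<in> {1..N}" for l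
      by (rule measurable_component_singleton[OF that])
  qed
qed (rule u c N \<epsilon>; assumption)+

text \<open>Integrating the conditional probability of a rectangle over a set \<open>B\<close> of
  \<open>F\<close> gives the joint law on rectangles, and these determine it. The sets
  \<open>A\<close> are fixed before integrating, so exceptional sets that depend on them do no harm.
  The first coordinate lives in \<open>restr_to_subalg P F\<close> because \<open>k\<close> is
  measurable with respect to \<open>F\<close> there.\<close>

lemma cond_iid_joint_law:
  assumes P: "prob_space P" and F: "subalgebra P F" and S: "sigma_finite_measure S"
    and cond: "cond_iid P F N S Z K"
    and k[measurable]: "(\<lambda>(w, z). k w z) \<in> borel_measurable (F \<Otimes>\<^sub>M S)"
    and K: "AE w in P. K w = density S (k w) \<and> prob_space (K w)"
  shows "distr P (restr_to_subalg P F \<Otimes>\<^sub>M PiM {1..N} (\<lambda>_. S)) (\<lambda>w. (w, \<lambda>l\<in>{1..N}. Z l w))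
    = density (restr_to_subalg P F \<Otimes>\<^sub>M PiM {1..N} (\<lambda>_. S)) (\<lambda>(w, z). \<Prod>l\<in>{1..N}. k w (z l))"
    (is "?L = ?R")
proof -
  interpret P: prob_space P by (rule P)
  interpret S: sigma_finite_measure S by (rule S)
  interpret Fs: finite_measure_subalgebra P F by standard (rule F)
  let ?I = "{1..N}" and ?F = "restr_to_subalg P F"
  interpret SP: product_sigma_finite "\<lambda>_::nat. S" by standard
  interpret SF: finite_product_sigma_finite "\<lambda>_::nat. S" ?I by standard simp
  interpret Rp: prob_space ?F by (rule prob_space_restr_to_subalg[OF F P])
  have setsF[measurable_cong]: "sets ?F = sets F" by (rule sets_restr_to_subalg[OF F])
  have spF: "space F = space P" using F by (simp add: subalgebra_def)
  have Z[measurable]: "Z l \<in> measurable P S" if "l \<in> ?I" for l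
    using cond that by (auto simp: cond_iid_def)
  have idm: "(\<lambda>w. w) \<in> measurable P ?F"
    using measurable_from_subalg[OF F, of "\<lambda>w. w" F] setsF by (simp cong: measurable_cong_sets)
  have Zr: "(\<lambda>w. \<lambda>l\<in>?I. Z l w) \<in> measurable P (PiM ?I (\<lambda>_. S))"
    by (rule measurable_restrict) (rule Z)
  have pairm: "(\<lambda>w. (w, \<lambda>l\<in>?I. Z l w)) \<in> measurable P (?F \<Otimes>\<^sub>M PiM ?I (\<lambda>_. S))"
    using idm Zr by (rule measurable_Pair)
  have km: "(\<lambda>(w, z). \<Prod>l\<in>?I. k w (z l)) \<in> borel_measurable (?F \<Otimes>\<^sub>M PiM ?I (\<lambda>_. S))"
    by measurable
  show ?thesis
  proof (rule measure_eqI_pair_PiM[where F = ?F and I = ?I and M = "\<lambda>_. S"])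
    show "emeasure ?L (space (?F \<Otimes>\<^sub>M PiM ?I (\<lambda>_. S))) \<noteq> \<infinity>"
      using P.emeasure_finite by (subst emeasure_distr[OF pairm]) auto
  next
    fix B A assume "B \<in> sets ?F" and A[measurable]: "\<And>i. i \<in> ?I \<Longrightarrow> A i \<in> sets S"
    then have B[measurable]: "B \<in> sets F" using setsF by simp
    then have BP[measurable]: "B \<in> sets P" using F by (auto simp: subalgebra_def)
    have B': "B \<in> sets ?F" using B setsF by simp
    let ?E = "{v \<in> space P. \<forall>l\<in>?I. Z l v \<in> A l}"
    have Em[measurable]: "?E \<in> sets P"
      by (rule sets.sets_Collect_finite_All) (auto intro: measurable_sets_Collect[OF Z])
    define r where "r = real_cond_exp P F (indicat_real ?E)"
    have r: "AE w in P. r w = (\<Prod>l\<in>?I. measure (K w) (A l))"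
      using cond A unfolding cond_iid_def r_def by auto
    have int: "integrable P (\<lambda>w. indicat_real B w * indicat_real ?E w)"
      by (rule P.integrable_const_bound[where B = 1]) (auto simp: indicator_def)
    \<comment> \<open>Defining property of the conditional expectation, tested against
      \<open>B\<close> in \<open>F\<close>.\<close>
    have rint: "integrable P (\<lambda>w. indicat_real B w * r w)"
      "(\<integral>w. indicat_real B w * r w \<partial>P) = (\<integral>w. indicat_real B w * indicat_real ?E w \<partial>P)"
      unfolding r_def
      by (rule Fs.real_cond_exp_intg[OF int]; simp)+
    have [measurable]: "Pi\<^sub>E ?I A \<in> sets (PiM ?I (\<lambda>_. S))"
      by (rule sets_PiM_I_finite) auto
    have "emeasure ?L (B \<times> Pi\<^sub>E ?I A) = emeasure P (B \<inter> ?E)"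
    proof (subst emeasure_distr[OF pairm])
      show "B \<times> Pi\<^sub>E ?I A \<in> sets (?F \<Otimes>\<^sub>M PiM ?I (\<lambda>_. S))" using B' by auto
      have "(\<lambda>w. (w, \<lambda>l\<in>?I. Z l w)) -` (B \<times> Pi\<^sub>E ?I A) \<inter> space P = B \<inter> ?E"
        using sets.sets_into_space[OF BP] by (auto simp: PiE_iff)
      then show "emeasure P ((\<lambda>w. (w, \<lambda>l\<in>?I. Z l w)) -` (B \<times> Pi\<^sub>E ?I A) \<inter> space P)
        = emeasure P (B \<inter> ?E)" by simp
    qed
    also have "\<dots> = ennreal (\<integral>w. indicat_real (B \<inter> ?E) w \<partial>P)"
      by (subst Bochner_Integration.integral_indicator)
         (simp_all add: P.emeasure_eq_measure)
    also have "\<dots> = ennreal (\<integral>w. indicat_real B w * r w \<partial>P)"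
      unfolding rint(2) by (simp add: indicator_inter_arith)
    also have "\<dots> = (\<integral>\<^sup>+w. ennreal (indicat_real B w * r w) \<partial>P)"
    proof (rule nn_integral_eq_integral[symmetric, OF rint(1)])
      show "AE w in P. 0 \<le> indicat_real B w * r w"
        using r by eventually_elim (simp add: prod_nonneg)
    qed
    also have "\<dots> = (\<integral>\<^sup>+w. indicator B w * (\<Prod>l\<in>?I. \<integral>\<^sup>+z. k w z * indicator (A l) z \<partial>S) \<partial>P)"
    proof (rule nn_integral_cong_AE)
      show "AE w in P. ennreal (indicat_real B w * r w)
          = indicator B w * (\<Prod>l\<in>?I. \<integral>\<^sup>+z. k w z * indicator (A l) z \<partial>S)"
        using r K AE_space
      proof eventually_elim
        case (elim w)
        interpret Kw: prob_space "K w" using elim(2) by blast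
        have kw[measurable]: "k w \<in> borel_measurable S"
          using measurable_Pair2[OF k, of w] elim(3) by (simp add: spF)
        have "ennreal (measure (K w) (A l)) = (\<integral>\<^sup>+z. k w z * indicator (A l) z \<partial>S)"
          if "l \<in> ?I" for l
          using A[OF that] elim(2) Kw.emeasure_eq_measure[of "A l"]
          by (simp add: emeasure_density)
        then show ?case
          unfolding elim(1)
          by (simp add: ennreal_mult prod_nonneg prod_ennreal[symmetric] ennreal_indicator
              del: atLeastAtMost_iff)
      qed
    qed
    \<comment> \<open>The integrand is \<open>F\<close>-measurable, so \<open>P\<close> may be
      replaced by its restriction, which puts both sides on the same product space.\<close>
    also have "\<dots> = (\<integral>\<^sup>+w. indicator B w * (\<Prod>l\<in>?I. \<integral>\<^sup>+z. k w z * indicator (A l) z \<partial>S) \<partial>?F)"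
      by (rule nn_integral_subalgebra2[OF F, symmetric]) measurable
    also have "\<dots> = (\<integral>\<^sup>+w. \<integral>\<^sup>+z. (\<Prod>l\<in>?I. k w (z l)) * indicator (B \<times> Pi\<^sub>E ?I A) (w, z)
        \<partial>PiM ?I (\<lambda>_. S) \<partial>?F)"
    proof (rule nn_integral_cong)
      fix w assume w: "w \<in> space ?F"
      have kw[measurable]: "k w \<in> borel_measurable S"
        using measurable_Pair2[OF k, of w] w by (simp add: spF space_restr_to_subalg)
      have "(\<integral>\<^sup>+z. (\<Prod>l\<in>?I. k w (z l)) * indicator (B \<times> Pi\<^sub>E ?I A) (w, z) \<partial>PiM ?I (\<lambda>_. S))
        = (\<integral>\<^sup>+z. indicator B w * (\<Prod>l\<in>?I. k w (z l) * indicator (A l) (z l)) \<partial>PiM ?I (\<lambda>_. S))"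
      proof (rule nn_integral_cong)
        fix z assume "z \<in> space (PiM ?I (\<lambda>_. S))"
        then have "indicator (Pi\<^sub>E ?I A) z = (\<Prod>i\<in>?I. indicator (A i) (z i) :: ennreal)"
          by (auto simp: indicator_def space_PiM PiE_iff)
        then show "(\<Prod>l\<in>?I. k w (z l)) * indicator (B \<times> Pi\<^sub>E ?I A) (w, z)
          = indicator B w * (\<Prod>l\<in>?I. k w (z l) * indicator (A l) (z l))"
          by (simp add: prod.distrib indicator_times mult_ac)
      qed
      also have "\<dots> = indicator B w
          * (\<integral>\<^sup>+z. (\<Prod>l\<in>?I. k w (z l) * indicator (A l) (z l)) \<partial>PiM ?I (\<lambda>_. S))"
        by (rule nn_integral_cmult) measurable
      also have "\<dots> = indicator B w * (\<Prod>l\<in>?I. \<integral>\<^sup>+z. k w z * indicator (A l) z \<partial>S)"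
        by (subst SP.product_nn_integral_prod) auto
      finally show "indicator B w * (\<Prod>l\<in>?I. \<integral>\<^sup>+z. k w z * indicator (A l) z \<partial>S) =
        (\<integral>\<^sup>+z. (\<Prod>l\<in>?I. k w (z l)) * indicator (B \<times> Pi\<^sub>E ?I A) (w, z) \<partial>PiM ?I (\<lambda>_. S))"
        by simp
    qed
    also have "\<dots> = emeasure ?R (B \<times> Pi\<^sub>E ?I A)"
    proof -
      have BA: "B \<times> Pi\<^sub>E ?I A \<in> sets (?F \<Otimes>\<^sub>M PiM ?I (\<lambda>_. S))" using B' by auto
      have "(\<lambda>x. (case x of (w, z) \<Rightarrow> \<Prod>l\<in>?I. k w (z l)) * indicator (B \<times> Pi\<^sub>E ?I A) x)
        \<in> borel_measurable (?F \<Otimes>\<^sub>M PiM ?I (\<lambda>_. S))"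
        using km BA by (intro borel_measurable_times_ennreal borel_measurable_indicator)
      from SF.nn_integral_fst[OF this] show ?thesis
        unfolding emeasure_density[OF km BA] by simp
    qed
    finally show "emeasure ?L (B \<times> Pi\<^sub>E ?I A) = emeasure ?R (B \<times> Pi\<^sub>E ?I A)" .
  qed auto
qed

text \<open>The slice at a fixed outcome is a deviation event for an i.i.d. sample of
  \<open>K w\<close>. Hoeffding bounds it by a constant free of \<open>w\<close>, which survives
  integration over the past. The conditional mean enters through an \<open>F\<close>-measurable
  version \<open>m\<close>, so the deviation event is measurable without a claim about how the
  integrals against \<open>K w\<close> depend on \<open>w\<close>.\<close>

lemma cond_iid_Hoeffding:
  assumes P: "prob_space P" and F: "subalgebra P F" and S: "sigma_finite_measure S"
    and cond: "cond_iid P F N S Z K"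
    and k[measurable]: "(\<lambda>(w, z). k w z) \<in> borel_measurable (F \<Otimes>\<^sub>M S)"
    and K: "AE w in P. K w = density S (k w) \<and> prob_space (K w)"
    and u[measurable]: "(\<lambda>(w, z). u w z) \<in> borel_measurable (F \<Otimes>\<^sub>M S)"
    and ub: "\<And>w z. w \<in> space P \<Longrightarrow> z \<in> space S \<Longrightarrow> 0 \<le> u w z \<and> u w z \<le> c"
    and m[measurable]: "m \<in> borel_measurable F" and mean: "AE w in P. m w = (\<integral>z. u w z \<partial>K w)"
    and c: "0 < c" and N: "1 \<le> N" and \<epsilon>: "0 \<le> \<epsilon>"
  shows "measure P {w \<in> space P. \<bar>(\<Sum>l\<in>{1..N}. u w (Z l w)) / real N - m w\<bar> \<ge> \<epsilon>}
    \<le> 2 * exp (- 2 * real N * \<epsilon>\<^sup>2 / c\<^sup>2)"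
proof -
  interpret P: prob_space P by (rule P)
  interpret S: sigma_finite_measure S by (rule S)
  let ?I = "{1..N}" and ?F = "restr_to_subalg P F"
  let ?Q = "PiM ?I (\<lambda>_. S)"
  interpret SP: product_sigma_finite "\<lambda>_::nat. S" by standard
  interpret SF: finite_product_sigma_finite "\<lambda>_::nat. S" ?I by standard simp
  interpret Rp: prob_space ?F by (rule prob_space_restr_to_subalg[OF F P])
  have setsF[measurable_cong]: "sets ?F = sets F" by (rule sets_restr_to_subalg[OF F])
  have spF: "space F = space P" using F by (simp add: subalgebra_def)
  have Z[measurable]: "Z l \<in> measurable P S" if "l \<in> ?I" for l
    using cond that by (auto simp: cond_iid_def)
  have idm: "(\<lambda>w. w) \<in> measurable P ?F"
    using measurable_from_subalg[OF F, of "\<lambda>w. w" F] setsF by (simp cong: measurable_cong_sets)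
  have Zr: "(\<lambda>w. \<lambda>l\<in>?I. Z l w) \<in> measurable P ?Q"
    by (rule measurable_restrict) (rule Z)
  have pairm: "(\<lambda>w. (w, \<lambda>l\<in>?I. Z l w)) \<in> measurable P (?F \<Otimes>\<^sub>M ?Q)"
    using idm Zr by (rule measurable_Pair)
  have km: "(\<lambda>(w, z). \<Prod>l\<in>?I. k w (z l)) \<in> borel_measurable (?F \<Otimes>\<^sub>M ?Q)"
    by measurable
  let ?D = "\<lambda>w z. \<bar>(\<Sum>l\<in>?I. u w (z l)) / real N - m w\<bar> \<ge> \<epsilon>"
  let ?E = "{x \<in> space (?F \<Otimes>\<^sub>M ?Q). ?D (fst x) (snd x)}"
  let ?b = "2 * exp (- 2 * real N * \<epsilon>\<^sup>2 / c\<^sup>2)"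
  have E[measurable]: "?E \<in> sets (?F \<Otimes>\<^sub>M ?Q)" by measurable
  have "emeasure P {w \<in> space P. ?D w (\<lambda>l. Z l w)}
    = emeasure (distr P (?F \<Otimes>\<^sub>M ?Q) (\<lambda>w. (w, \<lambda>l\<in>?I. Z l w))) ?E"
  proof (subst emeasure_distr[OF pairm E], rule arg_cong[where f = "emeasure P"])
    show "{w \<in> space P. ?D w (\<lambda>l. Z l w)} = (\<lambda>w. (w, \<lambda>l\<in>?I. Z l w)) -` ?E \<inter> space P"
      using measurable_space[OF pairm] by auto
  qed
  also have "\<dots> = (\<integral>\<^sup>+w. \<integral>\<^sup>+z. (\<Prod>l\<in>?I. k w (z l)) * indicator ?E (w, z) \<partial>?Q \<partial>?F)"
  proof -
    have "(\<lambda>x. (case x of (w, z) \<Rightarrow> \<Prod>l\<in>?I. k w (z l)) * indicator ?E x)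
      \<in> borel_measurable (?F \<Otimes>\<^sub>M ?Q)"
      using km E by (intro borel_measurable_times_ennreal borel_measurable_indicator)
    from SF.nn_integral_fst[OF this] show ?thesis
      unfolding cond_iid_joint_law[OF P F S cond k K] emeasure_density[OF km E] by simp
  qed
  also have "\<dots> = (\<integral>\<^sup>+w. \<integral>\<^sup>+z. (\<Prod>l\<in>?I. k w (z l)) * indicator ?E (w, z) \<partial>?Q \<partial>P)"
    by (rule nn_integral_subalgebra2[OF F]) measurable
  also have "\<dots> \<le> (\<integral>\<^sup>+w. ennreal ?b \<partial>P)"
  proof (rule nn_integral_mono_AE)
    show "AE w in P. (\<integral>\<^sup>+z. (\<Prod>l\<in>?I. k w (z l)) * indicator ?E (w, z) \<partial>?Q) \<le> ennreal ?b"
      using K mean AE_space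
    proof eventually_elim
      case (elim w)
      then have Kw: "prob_space (density S (k w))" by auto
      have kw[measurable]: "k w \<in> borel_measurable S"
        using measurable_Pair2[OF k, of w] elim(3) by (simp add: spF)
      have uw[measurable]: "u w \<in> borel_measurable S"
        using measurable_Pair2[OF u, of w] elim(3) by (simp add: spF)
      interpret Q: prob_space "PiM ?I (\<lambda>_. density S (k w))" by (rule prob_space_PiM, rule Kw)
      \<comment> \<open>The product of densities in the joint law is recognized as the law of an
        i.i.d. sample of \<open>K w\<close>.\<close>
      have Q: "PiM ?I (\<lambda>_. density S (k w)) = density ?Q (\<lambda>z. \<Prod>l\<in>?I. k w (z l))"
        by (rule SP.PiM_density) (use Kw in auto)
      have kz: "(\<lambda>z. \<Prod>l\<in>?I. k w (z l)) \<in> borel_measurable ?Q" by measurable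
      have D: "{z \<in> space ?Q. ?D w z} \<in> sets ?Q" by measurable
      have "(\<integral>\<^sup>+z. (\<Prod>l\<in>?I. k w (z l)) * indicator ?E (w, z) \<partial>?Q)
        = (\<integral>\<^sup>+z. (\<Prod>l\<in>?I. k w (z l)) * indicator {z \<in> space ?Q. ?D w z} z \<partial>?Q)"
        using elim(3) by (intro nn_integral_cong)
          (simp add: indicator_def space_pair_measure space_restr_to_subalg)
      also have "\<dots> = emeasure (PiM ?I (\<lambda>_. density S (k w))) {z \<in> space ?Q. ?D w z}"
        unfolding Q using kz D by (rule emeasure_density[symmetric])
      also have "\<dots> = ennreal (measure (PiM ?I (\<lambda>_. density S (k w)))
          {z \<in> space (PiM ?I (\<lambda>_. density S (k w))).
            \<bar>(\<Sum>l\<in>?I. u w (z l)) / real N - (\<integral>z. u w z \<partial>density S (k w))\<bar> \<ge> \<epsilon>})"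
        unfolding Q.emeasure_eq_measure[symmetric] using elim by (simp add: space_PiM)
      also have "\<dots> \<le> ennreal ?b"
        by (rule ennreal_leI, rule Hoeffding_PiM[OF Kw _ _ c N \<epsilon>])
           (use ub elim(3) in auto)
      finally show ?case .
    qed
  qed
  also have "\<dots> = ennreal ?b" by (simp add: P.emeasure_space_1)
  finally show ?thesis by (simp add: P.emeasure_eq_measure)
qed

section \<open>Concentration of self-normalized estimators\<close>

text \<open>The mass is divided out here and not in the measure, so that measures of successive
  generations remain linked by a linear identity.\<close>

definition normalized_mean :: "'a measure \<Rightarrow> ('a \<Rightarrow> real) \<Rightarrow> real" where
  "normalized_mean \<mu> f = (\<integral>x. f x \<partial>\<mu>) / measure \<mu> (space \<mu>)"

text \<open>Total by the convention on division: when the real weights sum to 0 the value is 0,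
  which still lies in [0, M] for a test function with values there.\<close>

definition weighted_mean ::
  "nat \<Rightarrow> (nat \<Rightarrow> 'w \<Rightarrow> ennreal) \<Rightarrow> (nat \<Rightarrow> 'w \<Rightarrow> 'a) \<Rightarrow> ('a \<Rightarrow> real) \<Rightarrow> 'w \<Rightarrow> real" where
  "weighted_mean N v xi f w =
     (\<Sum>l\<in>{1..N}. enn2real (v l w) * f (xi l w)) / (\<Sum>l\<in>{1..N}. enn2real (v l w))"

text \<open>The scale \<open>M\<close> bounds the range instead of measuring the oscillation, since
  kernel images of functions with values in [0, M] again take values in an interval starting at
  0.\<close>

definition concentrates ::
  "'w measure \<Rightarrow> 'a measure \<Rightarrow> nat \<Rightarrow> (nat \<Rightarrow> 'w \<Rightarrow> ennreal) \<Rightarrow> (nat \<Rightarrow> 'w \<Rightarrow> 'a) \<Rightarrow> 'a measure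
     \<Rightarrow> real \<Rightarrow> real \<Rightarrow> bool" where
  "concentrates P lam N v xi \<mu> B C \<longleftrightarrow>
     (\<forall>M>0. \<forall>\<epsilon>>0. \<forall>f\<in>borel_measurable lam. (\<forall>x\<in>space lam. 0 \<le> f x \<and> f x \<le> M) \<longrightarrow>
        measure P {w \<in> space P. \<bar>weighted_mean N v xi f w - normalized_mean \<mu> f\<bar> > \<epsilon>}
        \<le> B * exp (- (C * real N * \<epsilon>\<^sup>2 / M\<^sup>2)))"

lemma concentratesD:
  assumes "concentrates P lam N v xi \<mu> B C" "0 < M" "0 < \<epsilon>" "f \<in> borel_measurable lam"
    "\<And>x. x \<in> space lam \<Longrightarrow> 0 \<le> f x \<and> f x \<le> M"
  shows "measure P {w \<in> space P. \<bar>weighted_mean N v xi f w - normalized_mean \<mu> f\<bar> > \<epsilon>}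
    \<le> B * exp (- (C * real N * \<epsilon>\<^sup>2 / M\<^sup>2))"
  using assms by (auto simp: concentrates_def)

lemma weighted_mean_bounds:
  assumes "\<And>l. l \<in> {1..N} \<Longrightarrow> 0 \<le> f (xi l w) \<and> f (xi l w) \<le> M" "0 \<le> M"
  shows "0 \<le> weighted_mean N v xi f w" "weighted_mean N v xi f w \<le> M"
proof -
  let ?d = "\<Sum>l\<in>{1..N}. enn2real (v l w)"
  let ?n = "\<Sum>l\<in>{1..N}. enn2real (v l w) * f (xi l w)"
  have d: "0 \<le> ?d" by (simp add: sum_nonneg)
  have n: "0 \<le> ?n" using assms by (intro sum_nonneg) simp
  have "?n \<le> (\<Sum>l\<in>{1..N}. enn2real (v l w) * M)"
    using assms by (intro sum_mono mult_left_mono) auto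
  then have nd: "?n \<le> M * ?d" by (simp only: sum_distrib_left mult.commute)
  show "0 \<le> weighted_mean N v xi f w" using d n by (simp add: weighted_mean_def)
  show "weighted_mean N v xi f w \<le> M"
    using d nd assms(2) by (cases "?d = 0") (auto simp: weighted_mean_def divide_le_eq)
qed

lemma weighted_mean_measurable:
  assumes [measurable]: "\<And>l. l \<in> {1..N} \<Longrightarrow> v l \<in> borel_measurable P"
    "\<And>l. l \<in> {1..N} \<Longrightarrow> xi l \<in> measurable P lam" "f \<in> borel_measurable lam"
  shows "weighted_mean N v xi f \<in> borel_measurable P"
  unfolding weighted_mean_def[abs_def] by measurable

lemma normalized_mean_bounds:
  assumes \<mu>: "finite_measure \<mu>" "0 < measure \<mu> (space \<mu>)"
    and f: "f \<in> borel_measurable \<mu>" "\<And>x. x \<in> space \<mu> \<Longrightarrow> 0 \<le> f x \<and> f x \<le> M"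
  shows "0 \<le> normalized_mean \<mu> f" "normalized_mean \<mu> f \<le> M"
proof -
  interpret finite_measure \<mu> by (rule \<mu>)
  show "0 \<le> normalized_mean \<mu> f"
    using f unfolding normalized_mean_def by (intro divide_nonneg_nonneg integral_nonneg_AE) auto
  have int: "integrable \<mu> f"
    by (rule integrable_const_bound[where B = M]) (use f in auto)
  have "(\<integral>x. f x \<partial>\<mu>) \<le> (\<integral>x. M \<partial>\<mu>)"
    by (rule integral_mono[OF int]) (use f in auto)
  then show "normalized_mean \<mu> f \<le> M"
    using \<mu>(2) by (simp add: normalized_mean_def divide_le_eq mult.commute)
qed

text \<open>Suppose both deviations are small. As \<open>n / d\<close> and \<open>e\<close> lie in
  [0, M], the deviation of the ratio forces \<epsilon> < M, so \<open>d\<close> is at least three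
  quarters of \<beta>. Writing n - d e as (n - \<beta> e) + (\<beta> - d) e bounds it by \<beta>
  \<epsilon> / 2, which is less than d \<epsilon>. The case \<open>d = 0\<close> is covered because
  \<open>n / 0\<close> is 0.\<close>

lemma ratio_deviation:
  fixes n d \<beta> e M \<epsilon> :: real
  assumes "0 < \<beta>" "0 \<le> e" "e \<le> M" "0 < \<epsilon>" "0 \<le> n" "0 \<le> d" "n \<le> M * d" "0 < M"
    and dev: "\<bar>n / d - e\<bar> > \<epsilon>"
  shows "\<bar>n - \<beta> * e\<bar> > \<beta> * \<epsilon> / 4 \<or> \<bar>d - \<beta>\<bar> > \<beta> * \<epsilon> / (4 * M)"
proof (rule ccontr)
  assume "\<not> ?thesis"
  then have 1: "\<bar>n - \<beta> * e\<bar> \<le> \<beta> * \<epsilon> / 4" and 2: "\<bar>d - \<beta>\<bar> \<le> \<beta> * \<epsilon> / (4 * M)" by auto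
  have nd: "0 \<le> n / d" "n / d \<le> M"
    using assms by (cases "d = 0"; simp add: divide_le_eq)+
  then have eM: "\<epsilon> < M" using dev assms by linarith
  have "\<beta> * \<epsilon> / (4 * M) \<le> \<beta> / 4" using eM assms by (simp add: divide_simps)
  then have d: "3 / 4 * \<beta> \<le> d" using 2 by linarith
  then have d0: "0 < d" using assms by linarith
  have "\<bar>n - d * e\<bar> \<le> \<bar>n - \<beta> * e\<bar> + \<bar>\<beta> - d\<bar> * e"
    using abs_triangle_ineq[of "n - \<beta> * e" "(\<beta> - d) * e"] assms(2)
    by (simp add: abs_mult) (simp add: algebra_simps)
  also have "\<dots> \<le> \<beta> * \<epsilon> / 4 + \<beta> * \<epsilon> / (4 * M) * M"
    using 1 2 assms by (intro add_mono mult_mono) auto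
  also have "\<dots> = \<beta> * \<epsilon> / 2" using assms by simp
  also have "\<dots> < d * \<epsilon>" using d assms by (auto intro: mult_strict_right_mono)
  finally have "\<bar>n - d * e\<bar> < d * \<epsilon>" .
  moreover have "n / d - e = (n - d * e) / d" using d0 by (simp add: field_simps)
  ultimately have "\<bar>n / d - e\<bar> < \<epsilon>" using d0 by (simp add: abs_divide divide_less_eq mult.commute)
  then show False using dev by simp
qed

text \<open>\<open>\<theta>\<close> is a random scaling that cancels in the self-normalized estimator. Comparing numerator
  and denominator separately with \<open>\<beta>\<close> times their targets makes a lower bound on the sum of the
  weights unnecessary.\<close>

lemma concentrates_ratio:
  assumes P: "prob_space P" and N: "1 \<le> N"
    and v: "\<And>l. l \<in> {1..N} \<Longrightarrow> v l \<in> borel_measurable P"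
    and xi: "\<And>l. l \<in> {1..N} \<Longrightarrow> xi l \<in> measurable P lam"
    and \<theta>: "\<theta> \<in> borel_measurable P" "AE w in P. 0 < \<theta> w"
    and \<mu>: "finite_measure \<mu>" "0 < measure \<mu> (space \<mu>)" "sets \<mu> = sets lam"
    and \<beta>: "0 < \<beta>"
    and H: "\<And>M \<epsilon> f. 0 < M \<Longrightarrow> 0 < \<epsilon> \<Longrightarrow> f \<in> borel_measurable lam \<Longrightarrow>
      (\<And>x. x \<in> space lam \<Longrightarrow> 0 \<le> f x \<and> f x \<le> M) \<Longrightarrow>
      measure P {w \<in> space P. \<bar>\<theta> w * ((\<Sum>l\<in>{1..N}. enn2real (v l w) * f (xi l w)) / real N)
         - \<beta> * normalized_mean \<mu> f\<bar> > \<epsilon>} \<le> B * exp (- (C * real N * \<epsilon>\<^sup>2 / M\<^sup>2))"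
  shows "concentrates P lam N v xi \<mu> (2 * B) (C * \<beta>\<^sup>2 / 16)"
  unfolding concentrates_def
proof (intro allI impI ballI)
  fix M \<epsilon> :: real and f assume M: "0 < M" and \<epsilon>: "0 < \<epsilon>" and f: "f \<in> borel_measurable lam"
    and fM: "\<forall>x\<in>space lam. 0 \<le> f x \<and> f x \<le> M"
  interpret P: prob_space P by (rule P)
  note v[measurable] xi[measurable] f[measurable] \<theta>(1)[measurable]
  have sp: "space \<mu> = space lam" by (rule sets_eq_imp_space_eq[OF \<mu>(3)])
  have f\<mu>: "f \<in> borel_measurable \<mu>" using f \<mu>(3) by (simp cong: measurable_cong_sets)
  define D where "D f w = \<theta> w * ((\<Sum>l\<in>{1..N}. enn2real (v l w) * f (xi l w)) / real N)" for f w
  have Dm[measurable]: "D g \<in> borel_measurable P" if "g \<in> borel_measurable lam" for g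
    unfolding D_def[abs_def] using that by measurable
  let ?A = "{w \<in> space P. \<bar>D f w - \<beta> * normalized_mean \<mu> f\<bar> > \<beta> * \<epsilon> / 4}"
  \<comment> \<open>The denominator is the numerator for the constant function 1, whose target is 1.
    Thus \<open>H\<close> covers both events, with range bound \<open>M\<close> for the first and 1
    for the second.\<close>
  let ?B = "{w \<in> space P. \<bar>D (\<lambda>_. 1) w - \<beta> * normalized_mean \<mu> (\<lambda>_. 1)\<bar> > \<beta> * \<epsilon> / (4 * M)}"
  have wm[measurable]: "weighted_mean N v xi f \<in> borel_measurable P"
    by (rule weighted_mean_measurable[OF v xi f])
  have one: "normalized_mean \<mu> (\<lambda>_. 1) = 1" using \<mu>(2) by (simp add: normalized_mean_def)
  have AB: "?A \<in> sets P" "?B \<in> sets P" by measurable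
  have "measure P {w \<in> space P. \<bar>weighted_mean N v xi f w - normalized_mean \<mu> f\<bar> > \<epsilon>}
    \<le> measure P (?A \<union> ?B)"
  proof (rule P.finite_measure_mono_AE)
    show "AE w in P. w \<in> {w \<in> space P. \<bar>weighted_mean N v xi f w - normalized_mean \<mu> f\<bar> > \<epsilon>}
      \<longrightarrow> w \<in> ?A \<union> ?B"
      using \<theta>(2) AE_space
    proof eventually_elim
      case (elim w)
      have xiX: "xi l w \<in> space lam" if "l \<in> {1..N}" for l
        using measurable_space[OF xi[OF that] elim(2)] .
      let ?n = "\<Sum>l\<in>{1..N}. enn2real (v l w) * f (xi l w)"
      let ?d = "\<Sum>l\<in>{1..N}. enn2real (v l w)"
      have "?n \<le> (\<Sum>l\<in>{1..N}. enn2real (v l w) * M)"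
        using fM xiX by (intro sum_mono mult_left_mono) auto
      then have nd: "?n \<le> M * ?d" by (simp only: sum_distrib_left mult.commute)
      have n0: "0 \<le> ?n" using fM xiX by (intro sum_nonneg mult_nonneg_nonneg) auto
      have d0: "0 \<le> ?d" by (rule sum_nonneg) simp
      have s: "0 < \<theta> w / real N" using elim(1) N by simp
      have D: "D f w = \<theta> w / real N * ?n" "D (\<lambda>_. 1) w = \<theta> w / real N * ?d"
        by (simp_all add: D_def)
      have wD: "weighted_mean N v xi f w = D f w / D (\<lambda>_. 1) w"
        unfolding D weighted_mean_def by (rule mult_divide_mult_cancel_left[symmetric]) (use s in linarith)
      show ?case
      proof
        assume "w \<in> {w \<in> space P. \<bar>weighted_mean N v xi f w - normalized_mean \<mu> f\<bar> > \<epsilon>}"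
        then have dev: "\<bar>D f w / D (\<lambda>_. 1) w - normalized_mean \<mu> f\<bar> > \<epsilon>" by (simp add: wD)
        have "\<bar>D f w - \<beta> * normalized_mean \<mu> f\<bar> > \<beta> * \<epsilon> / 4
            \<or> \<bar>D (\<lambda>_. 1) w - \<beta>\<bar> > \<beta> * \<epsilon> / (4 * M)"
        proof (rule ratio_deviation[OF \<beta> _ _ \<epsilon> _ _ _ M dev])
          show "0 \<le> normalized_mean \<mu> f" "normalized_mean \<mu> f \<le> M"
            using normalized_mean_bounds[OF \<mu>(1,2) f\<mu>, of M] fM sp by auto
          show "0 \<le> D f w" "0 \<le> D (\<lambda>_. 1) w"
            unfolding D using s n0 d0 by (auto intro: mult_nonneg_nonneg simp del: times_divide_eq_left)
          show "D f w \<le> M * D (\<lambda>_. 1) w"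
            unfolding D using mult_left_mono[OF nd, of "\<theta> w / real N"] s by (simp add: mult_ac)
        qed
        then show "w \<in> ?A \<union> ?B" using elim(2) one by auto
      qed
    qed
  qed (use AB in auto)
  also have "\<dots> \<le> measure P ?A + measure P ?B" using AB by (rule measure_Un_le)
  also have "\<dots> \<le> B * exp (- (C * real N * (\<beta> * \<epsilon> / 4)\<^sup>2 / M\<^sup>2))
      + B * exp (- (C * real N * (\<beta> * \<epsilon> / (4 * M))\<^sup>2 / 1\<^sup>2))"
    using H[of M "\<beta> * \<epsilon> / 4" f] H[of 1 "\<beta> * \<epsilon> / (4 * M)" "\<lambda>_. 1"] f fM M \<epsilon> \<beta>
    unfolding D_def by (intro add_mono) auto
  \<comment> \<open>The threshold \<beta> \<epsilon> / 4 on range M and the threshold \<beta>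
    \<epsilon> / (4 M) on range 1 give the same exponent; hence the factor 2 on \<open>B\<close> and
    \<beta>^2 / 16 on the rate.\<close>
  also have "\<dots> = 2 * B * exp (- (C * \<beta>\<^sup>2 / 16 * real N * \<epsilon>\<^sup>2 / M\<^sup>2))"
    using M by (simp add: power_divide power_mult_distrib field_simps)
  finally show "measure P {w \<in> space P. \<bar>weighted_mean N v xi f w - normalized_mean \<mu> f\<bar> > \<epsilon>}
    \<le> 2 * B * exp (- (C * \<beta>\<^sup>2 / 16 * real N * \<epsilon>\<^sup>2 / M\<^sup>2))" .
qed

section \<open>The first generation of particles\<close>

lemma concentrates_iid:
  assumes P: "prob_space P" and N: "1 \<le> N"
    and indep: "prob_space.indep_vars P (\<lambda>_. lam) xi {1..N}"
    and law: "\<And>l. l \<in> {1..N} \<Longrightarrow> distr P lam (xi l) = \<rho>"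
    and W[measurable]: "W \<in> borel_measurable lam" "\<And>x. x \<in> space lam \<Longrightarrow> W x \<le> ennreal c"
    and c: "0 < c"
    and \<mu>: "finite_measure \<mu>" "0 < measure \<mu> (space \<mu>)" and \<mu>_eq: "\<mu> = density \<rho> W"
  shows "concentrates P lam N (\<lambda>l w. W (xi l w)) xi \<mu> 4 ((measure \<mu> (space \<mu>))\<^sup>2 / (8 * c\<^sup>2))"
proof -
  interpret P: prob_space P by (rule P)
  have xi[measurable]: "xi l \<in> measurable P lam" if "l \<in> {1..N}" for l
    using indep that unfolding P.indep_vars_def by blast
  have "1 \<in> {1..N}" using N by simp
  \<comment> \<open>The \<sigma>-field of \<rho> is known only through the law of a particle, so at
    least one particle must exist.\<close>
  from law[OF this] have s\<rho>[measurable_cong]: "sets \<rho> = sets lam" by (metis sets_distr)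
  have s\<mu>: "sets \<mu> = sets lam" by (simp add: \<mu>_eq s\<rho>)
  have sp: "space \<rho> = space lam" using s\<rho> by (rule sets_eq_imp_space_eq)
  have Wf: "W x = ennreal (enn2real (W x))" if "x \<in> space lam" for x
    using W(2)[OF that] by (metis ennreal_enn2real ennreal_less_top le_less_trans)
  have Wc: "enn2real (W x) \<le> c" if "x \<in> space lam" for x
    using enn2real_mono[OF W(2)[OF that]] c by simp
  let ?m = "measure \<mu> (space \<mu>)"
  \<comment> \<open>Hoeffding for values in [0, c M] gives the factor 2 and the rate 2 / c^2. With
    \<theta> = 1 and \<beta> the mass of \<mu>, the ratio lemma turns these into 4 and \<beta>^2 /
    (8 c^2).\<close>
  have "concentrates P lam N (\<lambda>l w. W (xi l w)) xi \<mu> (2 * 2) (2 / c\<^sup>2 * ?m\<^sup>2 / 16)"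
  proof (rule concentrates_ratio[OF P N _ _ _ _ \<mu> s\<mu> \<mu>(2), where \<theta> = "\<lambda>_. 1"])
    fix M \<epsilon> :: real and f assume M: "0 < M" and \<epsilon>: "0 < \<epsilon>"
      and f[measurable]: "f \<in> borel_measurable lam"
      and fM: "\<And>x. x \<in> space lam \<Longrightarrow> 0 \<le> f x \<and> f x \<le> M"
    let ?u = "\<lambda>x. enn2real (W x) * f x"
    have "density \<rho> W = density \<rho> (\<lambda>x. ennreal (enn2real (W x)))"
      by (rule density_cong) (use Wf sp in auto)
    then have "(\<integral>x. f x \<partial>\<mu>) = (\<integral>x. ?u x \<partial>\<rho>)"
      unfolding \<mu>_eq by (simp add: integral_density)
    then have mean: "?m * normalized_mean \<mu> f = (\<integral>x. ?u x \<partial>\<rho>)"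
      using \<mu>(2) by (simp add: normalized_mean_def)
    have "measure P {w \<in> space P. \<bar>(\<Sum>l\<in>{1..N}. ?u (xi l w)) / real N - (\<integral>x. ?u x \<partial>\<rho>)\<bar> \<ge> \<epsilon>}
      \<le> 2 * exp (- 2 * real N * \<epsilon>\<^sup>2 / (c * M)\<^sup>2)"
      by (rule Hoeffding_same_law[OF P indep law _ _ _ N])
         (use c M \<epsilon> fM Wc in \<open>auto intro!: mult_mono\<close>)
    moreover have "measure P {w \<in> space P. \<bar>(\<Sum>l\<in>{1..N}. ?u (xi l w)) / real N - (\<integral>x. ?u x \<partial>\<rho>)\<bar> > \<epsilon>}
      \<le> measure P {w \<in> space P. \<bar>(\<Sum>l\<in>{1..N}. ?u (xi l w)) / real N - (\<integral>x. ?u x \<partial>\<rho>)\<bar> \<ge> \<epsilon>}"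
      by (rule P.finite_measure_mono) auto
    ultimately show "measure P {w \<in> space P. \<bar>1 * ((\<Sum>l\<in>{1..N}. enn2real (W (xi l w)) * f (xi l w)) / real N)
         - ?m * normalized_mean \<mu> f\<bar> > \<epsilon>} \<le> 2 * exp (- (2 / c\<^sup>2 * real N * \<epsilon>\<^sup>2 / M\<^sup>2))"
      unfolding mean by (simp add: power_mult_distrib)
  qed (use W xi in auto)
  then show ?thesis by (simp add: field_simps)
qed

section \<open>Normalized laws, random indices, and the passage between generations\<close>

lemma enn2real_divide: "enn2real (a / b) = enn2real a / enn2real b"
proof (cases "b = 0 \<or> b = \<top>")
  case True
  \<comment> \<open>Both sides are 0: \<open>enn2real\<close> sends an infinite quotient to 0, and
    division by the real number 0 gives 0.\<close>
  then show ?thesis by (cases "a = 0") (auto simp: ennreal_divide_zero)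
next
  case False
  then obtain b' where b: "b = ennreal b'" "0 < b'"
    by (cases b) (auto simp: le_less)
  show ?thesis
    by (cases a) (use b in \<open>auto simp: divide_ennreal ennreal_top_divide\<close>)
qed

lemma emeasure_density_space:
  assumes "k \<in> borel_measurable M"
  shows "emeasure (density M k) (space M) = (\<integral>\<^sup>+z. k z \<partial>M)"
  using assms by (simp add: emeasure_density cong: nn_integral_cong)

text \<open>Puts the sampling law into the form that the conditional Hoeffding inequality expects, a
  density with respect to the reference measure. The identity is algebraic and holds for every total
  mass.\<close>

lemma prob_normalize_density:
  assumes "k \<in> borel_measurable M"
  shows "prob_normalize (density M k) = density M (\<lambda>z. k z / (\<integral>\<^sup>+z. k z \<partial>M))"
proof (rule measure_eqI)
  fix A assume "A \<in> sets (prob_normalize (density M k))"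
  then have A: "A \<in> sets M" by (simp add: prob_normalize_def)
  have s: "emeasure (density M k) (space M) = (\<integral>\<^sup>+z. k z \<partial>M)"
    by (rule emeasure_density_space[OF assms])
  show "emeasure (prob_normalize (density M k)) A
    = emeasure (density M (\<lambda>z. k z / (\<integral>\<^sup>+z. k z \<partial>M))) A"
    using A assms
    by (simp add: prob_normalize_def s emeasure_density nn_integral_cmult[symmetric]
        ennreal_times_divide divide_ennreal_def mult_ac)
qed (simp add: prob_normalize_def)

lemma prob_space_prob_normalize:
  assumes "emeasure M (space M) \<noteq> 0" "emeasure M (space M) \<noteq> \<infinity>"
  shows "prob_space (prob_normalize M)"
  by (rule prob_spaceI)
     (use assms in \<open>simp add: prob_normalize_def space_scale_measure ennreal_divide_times ennreal_divide_self less_top\<close>)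

lemma nn_integral_count_pair:
  fixes f :: "'i \<times> 'a \<Rightarrow> ennreal"
  assumes "sigma_finite_measure lam" "finite I" "f \<in> borel_measurable (count_space I \<Otimes>\<^sub>M lam)"
  shows "(\<integral>\<^sup>+z. f z \<partial>(count_space I \<Otimes>\<^sub>M lam)) = (\<Sum>i\<in>I. \<integral>\<^sup>+x. f (i, x) \<partial>lam)"
  using sigma_finite_measure.nn_integral_fst[OF assms(1,3)] assms(2)
  by (simp add: nn_integral_count_space_finite)

lemma sigma_finite_count_pair:
  assumes "sigma_finite_measure lam" "finite I"
  shows "sigma_finite_measure (count_space I \<Otimes>\<^sub>M lam)"
proof -
  interpret lam: sigma_finite_measure lam by fact
  interpret c: sigma_finite_measure "count_space I"
    using assms(2) by (intro sigma_finite_measure_count_space_countable countable_finite)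
  interpret pair_sigma_finite "count_space I" lam ..
  show ?thesis ..
qed

text \<open>The index takes countably many values, so joint measurability can be checked with the
  index fixed.\<close>

lemma measurable_pair_count_pair:
  assumes "countable I" "\<And>i. i \<in> I \<Longrightarrow> (\<lambda>(w, x). g i w x) \<in> measurable (F \<Otimes>\<^sub>M lam) N"
  shows "(\<lambda>(w, i, x). g i w x) \<in> measurable (F \<Otimes>\<^sub>M (count_space I \<Otimes>\<^sub>M lam)) N"
proof -
  have "(\<lambda>y. (\<lambda>(w, x). g (fst (snd y)) w x) (fst y, snd (snd y)))
    \<in> measurable (F \<Otimes>\<^sub>M (count_space I \<Otimes>\<^sub>M lam)) N"
  proof (rule measurable_compose_countable'[where I = I and g = "\<lambda>y. fst (snd y)"
        and f = "\<lambda>i y. (\<lambda>(w, x). g i w x) (fst y, snd (snd y))"])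
    fix i assume "i \<in> I"
    show "(\<lambda>y. (\<lambda>(w, x). g i w x) (fst y, snd (snd y)))
      \<in> measurable (F \<Otimes>\<^sub>M (count_space I \<Otimes>\<^sub>M lam)) N"
      by (rule measurable_compose[OF _ assms(2)[OF \<open>i \<in> I\<close>]]) measurable
  qed (use assms(1) in auto)
  then show ?thesis by (simp add: split_beta')
qed

text \<open>The scaling \<open>\<theta>\<close> used here is the old estimator applied to \<open>x \<mapsto> \<integral> m x x' dx'\<close>. Multiplied by
  \<open>\<theta>\<close>, the conditional mean of the new weighted average of \<open>f\<close> is exactly the old estimator applied
  to \<open>x \<mapsto> \<integral> W x x' m x x' f x' dx'\<close>, to which the hypothesis on the old particles applies.\<close>

lemma concentrates_step:
  fixes W m :: "'a \<Rightarrow> 'a \<Rightarrow> ennreal" and v :: "nat \<Rightarrow> 'w \<Rightarrow> ennreal"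
  assumes P: "prob_space P" and lam: "sigma_finite_measure lam" and F: "subalgebra P F"
    and N: "1 \<le> N"
    and xi[measurable]: "\<And>l. l \<in> {1..N} \<Longrightarrow> xi l \<in> measurable F lam"
    and v[measurable]: "\<And>l. l \<in> {1..N} \<Longrightarrow> v l \<in> borel_measurable F"
    and vfin: "\<And>l w. l \<in> {1..N} \<Longrightarrow> w \<in> space P \<Longrightarrow> v l w < \<infinity>"
    and m[measurable]: "(\<lambda>(x, x'). m x x') \<in> borel_measurable (lam \<Otimes>\<^sub>M lam)"
    and mA: "\<And>x. x \<in> space lam \<Longrightarrow> (\<integral>\<^sup>+x'. m x x' \<partial>lam) \<le> ennreal A" and A: "0 < A"
    and W[measurable]: "(\<lambda>(x, x'). W x x') \<in> borel_measurable (lam \<Otimes>\<^sub>M lam)"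
    and Wc: "\<And>x x'. x \<in> space lam \<Longrightarrow> x' \<in> space lam \<Longrightarrow> W x x' \<le> ennreal c" and c: "0 < c"
    and \<mu>: "finite_measure \<mu>" "0 < measure \<mu> (space \<mu>)" "sets \<mu> = sets lam"
    and \<mu>': "finite_measure \<mu>'" "0 < measure \<mu>' (space \<mu>')" "sets \<mu>' = sets lam"
    and step: "\<And>f :: 'a \<Rightarrow> ennreal. f \<in> borel_measurable lam \<Longrightarrow>
      (\<integral>\<^sup>+x. f x \<partial>\<mu>') = (\<integral>\<^sup>+x. \<integral>\<^sup>+x'. W x x' * m x x' * f x' \<partial>lam \<partial>\<mu>)"
    and pos: "AE w in P. 0 < emeasure (density (count_space {1..N} \<Otimes>\<^sub>M lam)
        (\<lambda>(i, x). v i w * m (xi i w) x)) ({1..N} \<times> space lam)"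
    and cond: "cond_iid P F N (count_space {1..N} \<Otimes>\<^sub>M lam) (\<lambda>l w. (J l w, xi' l w))
      (\<lambda>w. prob_normalize (density (count_space {1..N} \<Otimes>\<^sub>M lam)
        (\<lambda>(i, x). v i w * m (xi i w) x)))"
    and IH: "concentrates P lam N v xi \<mu> B C"
  shows "concentrates P lam N (\<lambda>l w. W (xi (J l w) w) (xi' l w)) xi' \<mu>'
    (2 * (2 + B)) (min 2 C / (4 * A\<^sup>2 * c\<^sup>2) * (measure \<mu>' (space \<mu>') / measure \<mu> (space \<mu>))\<^sup>2 / 16)"
proof -
  interpret P: prob_space P by (rule P)
  interpret lam: sigma_finite_measure lam by (rule lam)
  let ?I = "{1..N}"
  let ?S = "count_space ?I \<Otimes>\<^sub>M lam"
  let ?\<beta> = "measure \<mu>' (space \<mu>') / measure \<mu> (space \<mu>)"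
  let ?C = "min 2 C / (4 * A\<^sup>2 * c\<^sup>2)"
  have spF: "space F = space P" using F by (simp add: subalgebra_def)
  have sp: "space \<mu> = space lam" "space \<mu>' = space lam"
    using \<mu>(3) \<mu>'(3) by (auto dest: sets_eq_imp_space_eq)
  have xiX: "xi l w \<in> space lam" if "l \<in> ?I" "w \<in> space P" for l w
    using measurable_space[OF xi[OF that(1)]] that(2) by (simp add: spF)
  have xiP[measurable]: "xi l \<in> measurable P lam" if "l \<in> ?I" for l
    by (rule measurable_from_subalg[OF F xi[OF that]])
  have Jx: "(\<lambda>w. (J l w, xi' l w)) \<in> measurable P ?S" if "l \<in> ?I" for l
    using cond that by (auto simp: cond_iid_def)
  have J[measurable]: "J l \<in> measurable P (count_space ?I)" if "l \<in> ?I" for l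
    using measurable_compose[OF Jx[OF that] measurable_fst] by simp
  have xi'[measurable]: "xi' l \<in> measurable P lam" if "l \<in> ?I" for l
    using measurable_compose[OF Jx[OF that] measurable_snd] by simp
  have JI: "J l w \<in> ?I" if "l \<in> ?I" "w \<in> space P" for l w
    using measurable_space[OF J[OF that(1)] that(2)] by simp
  have xi'X: "xi' l w \<in> space lam" if "l \<in> ?I" "w \<in> space P" for l w
    using measurable_space[OF xi'[OF that(1)] that(2)] .
  have v'[measurable]: "(\<lambda>w. W (xi (J l w) w) (xi' l w)) \<in> borel_measurable P" if l: "l \<in> ?I" for l
  proof (rule measurable_compose_countable'[where I = ?I and g = "J l"])
    show "(\<lambda>w. W (xi i w) (xi' l w)) \<in> borel_measurable P" if "i \<in> ?I" for i
      using measurable_compose[OF measurable_Pair[OF xiP[OF that] xi'[OF l]] W] by simp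
  qed (use J[OF l] in auto)
  have kerF: "(\<lambda>y. k (xi i (fst y)) (snd y)) \<in> borel_measurable (F \<Otimes>\<^sub>M lam)"
    if "(\<lambda>(x, x'). k x x') \<in> borel_measurable (lam \<Otimes>\<^sub>M lam)" "i \<in> ?I"
    for k :: "'a \<Rightarrow> 'a \<Rightarrow> ennreal" and i
    using measurable_compose[OF measurable_Pair[OF measurable_compose[OF measurable_fst xi[OF that(2)]]
          measurable_snd] that(1)] by simp

  define a where "a x = (\<integral>\<^sup>+x'. m x x' \<partial>lam)" for x
  have am[measurable]: "a \<in> borel_measurable lam"
    unfolding a_def[abs_def] by measurable
  have afin: "a x < \<infinity>" if "x \<in> space lam" for x
    using mA[OF that] by (auto simp: a_def intro: le_less_trans)
  have aA: "enn2real (a x) \<le> A" if "x \<in> space lam" for x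
    using enn2real_mono[OF mA[OF that]] A by (simp add: a_def)
  \<comment> \<open>Normalizing constant of the sampling law: \<open>a\<close> is the mass that
    \<open>m\<close> emits from one particle, and \<open>s\<close> divided by the old weight sum
    will be \<theta>.\<close>
  define s where "s w = (\<Sum>i\<in>?I. v i w * a (xi i w))" for w
  have sm[measurable]: "s \<in> borel_measurable F" unfolding s_def[abs_def] by measurable
  have sfin: "s w < \<infinity>" if "w \<in> space P" for w
    using vfin afin xiX that by (auto simp: s_def ennreal_mult_less_top)
  let ?\<kappa> = "\<lambda>w (i, x). v i w * m (xi i w) x"
  have \<kappa>F: "(\<lambda>(w, z). ?\<kappa> w z) \<in> borel_measurable (F \<Otimes>\<^sub>M ?S)"
  proof -
    have "(\<lambda>(w, i, x). v i w * m (xi i w) x) \<in> borel_measurable (F \<Otimes>\<^sub>M ?S)"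
    proof (rule measurable_pair_count_pair)
      fix i assume i: "i \<in> ?I"
      show "(\<lambda>(w, x). v i w * m (xi i w) x) \<in> borel_measurable (F \<Otimes>\<^sub>M lam)"
        using borel_measurable_times_ennreal[OF measurable_compose[OF measurable_fst v[OF i]] kerF[OF m i]]
        by (simp add: split_beta')
    qed simp
    then show ?thesis by (simp add: split_beta')
  qed
  have \<kappa>m: "?\<kappa> w \<in> borel_measurable ?S" if "w \<in> space P" for w
    using measurable_Pair2[OF \<kappa>F, of w] that by (simp add: spF)
  have \<kappa>s: "(\<integral>\<^sup>+z. ?\<kappa> w z \<partial>?S) = s w" if w: "w \<in> space P" for w
  proof -
    have "(\<integral>\<^sup>+z. ?\<kappa> w z \<partial>?S) = (\<Sum>i\<in>?I. \<integral>\<^sup>+x. v i w * m (xi i w) x \<partial>lam)"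
      using nn_integral_count_pair[OF lam _ \<kappa>m[OF w]] by simp
    also have "\<dots> = s w"
      unfolding s_def a_def using xiX[OF _ w]
      by (intro sum.cong nn_integral_cmult refl) (auto intro: measurable_Pair2[OF m])
    finally show ?thesis .
  qed
  define K where "K w = prob_normalize (density ?S (?\<kappa> w))" for w
  have spos: "AE w in P. 0 < s w"
    using pos AE_space
  proof eventually_elim
    case (elim w)
    have "emeasure (density ?S (?\<kappa> w)) (?I \<times> space lam) = (\<integral>\<^sup>+z. ?\<kappa> w z \<partial>?S)"
      using emeasure_density_space[OF \<kappa>m[OF elim(2)]]
      unfolding space_pair_measure space_count_space .
    then show ?case using elim \<kappa>s by simp
  qed
  let ?k = "\<lambda>w z. ?\<kappa> w z / s w"
  have km: "(\<lambda>(w, z). ?k w z) \<in> borel_measurable (F \<Otimes>\<^sub>M ?S)"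
    using borel_measurable_divide_ennreal[OF \<kappa>F measurable_compose[OF measurable_fst sm]]
    by (simp add: split_beta')
  have Kk: "K w = density ?S (?k w)" if "w \<in> space P" for w
    unfolding K_def prob_normalize_density[OF \<kappa>m[OF that]] \<kappa>s[OF that] ..
  have Kp: "AE w in P. K w = density ?S (?k w) \<and> prob_space (K w)"
    using spos AE_space
  proof eventually_elim
    case (elim w)
    have "emeasure (density ?S (?\<kappa> w)) (space ?S) = s w"
      using emeasure_density_space[OF \<kappa>m[OF elim(2)]] \<kappa>s[OF elim(2)] by simp
    then show ?case
      using elim sfin[OF elim(2)] unfolding Kk[OF elim(2), symmetric] K_def
      by (auto intro!: prob_space_prob_normalize)
  qed

  let ?V = "\<lambda>w. \<Sum>i\<in>?I. enn2real (v i w)"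
  define \<theta> where "\<theta> w = weighted_mean N v xi (\<lambda>x. enn2real (a x)) w" for w
  have sreal: "enn2real (s w) = (\<Sum>i\<in>?I. enn2real (v i w) * enn2real (a (xi i w)))"
    if "w \<in> space P" for w
    unfolding s_def using vfin afin xiX that
    by (subst enn2real_sum) (auto simp: enn2real_mult ennreal_mult_less_top)
  have \<theta>eq: "\<theta> w = enn2real (s w) / ?V w" if "w \<in> space P" for w
    by (simp add: \<theta>_def weighted_mean_def sreal[OF that])
  have vP[measurable]: "v l \<in> borel_measurable P" if "l \<in> ?I" for l
    by (rule measurable_from_subalg[OF F v[OF that]])
  have \<theta>m[measurable]: "\<theta> \<in> borel_measurable P"
    unfolding \<theta>_def[abs_def]
    by (rule weighted_mean_measurable[OF vP xiP borel_measurable_enn2real[OF am]])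
  have \<theta>A: "\<theta> w \<le> A" if "w \<in> space P" for w
    unfolding \<theta>_def by (rule weighted_mean_bounds) (use aA xiX that A in auto)
  have sr: "0 < enn2real (s w)" if "w \<in> space P" "0 < s w" for w
    using sfin[OF that(1)] that(2) by (simp add: enn2real_positive_iff)
  \<comment> \<open>A positive normalizing constant forces some old weight to be positive.\<close>
  have V: "0 < ?V w" if w: "w \<in> space P" "0 < s w" for w
  proof -
    have "0 < (\<Sum>i\<in>?I. enn2real (v i w) * enn2real (a (xi i w)))"
      using sr[OF w] sreal[OF w(1)] by simp
    then have "\<not> (\<forall>i\<in>?I. enn2real (v i w) = 0)" by force
    then show ?thesis by (simp add: sum_nonneg_eq_0_iff sum_nonneg less_le)
  qed
  have \<theta>pos: "AE w in P. 0 < \<theta> w"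
    using spos AE_space by eventually_elim (simp only: \<theta>eq divide_pos_pos[OF sr V])
  show ?thesis
  proof (rule concentrates_ratio[OF P N v' xi' \<theta>m \<theta>pos \<mu>'])
    show "0 < ?\<beta>" using \<mu> \<mu>' by simp
  next
    fix M \<epsilon> :: real and f assume M: "0 < M" and \<epsilon>: "0 < \<epsilon>"
      and f[measurable]: "f \<in> borel_measurable lam"
      and fM: "\<And>x. x \<in> space lam \<Longrightarrow> 0 \<le> f x \<and> f x \<le> M"
    define L where "L x = (\<integral>\<^sup>+x'. W x x' * m x x' * ennreal (f x') \<partial>lam)" for x
    have Lm[measurable]: "L \<in> borel_measurable lam" unfolding L_def[abs_def] by measurable
    \<comment> \<open>The range of the kernel image is proportional to \<open>M\<close>, with a
      factor c A that does not depend on \<open>f\<close>.\<close>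
    have Lb: "L x \<le> ennreal (c * A * M)" if x: "x \<in> space lam" for x
    proof -
      have "L x \<le> (\<integral>\<^sup>+x'. ennreal (c * M) * m x x' \<partial>lam)"
        unfolding L_def
      proof (rule nn_integral_mono)
        fix x' assume x': "x' \<in> space lam"
        have "W x x' * ennreal (f x') \<le> ennreal c * ennreal M"
          by (rule mult_mono) (use Wc[OF x x'] fM[OF x'] in \<open>auto intro: ennreal_leI\<close>)
        then have "m x x' * (W x x' * ennreal (f x')) \<le> m x x' * ennreal (c * M)"
          using c M by (intro mult_left_mono) (auto simp: ennreal_mult)
        then show "W x x' * m x x' * ennreal (f x') \<le> ennreal (c * M) * m x x'"
          by (simp add: mult_ac)
      qed
      also have "\<dots> = ennreal (c * M) * (\<integral>\<^sup>+x'. m x x' \<partial>lam)"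
        by (rule nn_integral_cmult) (use x in \<open>auto intro: measurable_Pair2[OF m]\<close>)
      also have "\<dots> \<le> ennreal (c * M) * ennreal A"
        by (rule mult_left_mono[OF mA[OF x]]) simp
      also have "\<dots> = ennreal (c * A * M)" using c M A by (simp add: ennreal_mult[symmetric] mult_ac)
      finally show ?thesis .
    qed
    have Lfin: "L x < \<infinity>" if "x \<in> space lam" for x
      using Lb[OF that] by (auto intro: le_less_trans)
    let ?Lf = "\<lambda>x. enn2real (L x)"
    have Lr: "0 \<le> ?Lf x \<and> ?Lf x \<le> c * A * M" if "x \<in> space lam" for x
      using enn2real_mono[OF Lb[OF that]] c A M by simp
    \<comment> \<open>Linearity of the unnormalized recursion: both means have the same numerator
      and differ only in the mass they divide by, which produces \<beta>.\<close>
    have \<eta>: "normalized_mean \<mu> ?Lf = ?\<beta> * normalized_mean \<mu>' f"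
    proof -
      have "(\<integral>x. ?Lf x \<partial>\<mu>) = enn2real (\<integral>\<^sup>+x. ennreal (?Lf x) \<partial>\<mu>)"
        by (rule integral_eq_nn_integral) (use \<mu>(3) in \<open>auto cong: measurable_cong_sets\<close>)
      also have "(\<integral>\<^sup>+x. ennreal (?Lf x) \<partial>\<mu>) = (\<integral>\<^sup>+x. L x \<partial>\<mu>)"
        using Lfin sp by (intro nn_integral_cong) (simp add: less_top)
      also have "\<dots> = (\<integral>\<^sup>+x. ennreal (f x) \<partial>\<mu>')"
        unfolding L_def by (rule step[symmetric]) simp
      also have "enn2real \<dots> = (\<integral>x. f x \<partial>\<mu>')"
        by (rule integral_eq_nn_integral[symmetric])
           (use \<mu>'(3) fM sp in \<open>auto cong: measurable_cong_sets\<close>)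
      finally show ?thesis using \<mu>(2) \<mu>'(2) by (simp add: normalized_mean_def)
    qed
    define u where "u w z = enn2real (W (xi (fst z) w) (snd z)) * f (snd z)" for w z
    have um: "(\<lambda>(w, z). u w z) \<in> borel_measurable (F \<Otimes>\<^sub>M ?S)"
    proof -
      have "(\<lambda>(w, i, x). enn2real (W (xi i w) x) * f x) \<in> borel_measurable (F \<Otimes>\<^sub>M ?S)"
      proof (rule measurable_pair_count_pair)
        fix i assume i: "i \<in> ?I"
        show "(\<lambda>(w, x). enn2real (W (xi i w) x) * f x) \<in> borel_measurable (F \<Otimes>\<^sub>M lam)"
          using borel_measurable_times[OF borel_measurable_enn2real[OF kerF[OF W i]]
              measurable_compose[OF measurable_snd f]]
          by (simp add: split_beta')
      qed simp
      then show ?thesis by (simp add: split_beta' u_def)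
    qed
    have ub: "0 \<le> u w z \<and> u w z \<le> c * M" if w: "w \<in> space P" and z: "z \<in> space ?S" for w z
    proof -
      have z': "fst z \<in> ?I" "snd z \<in> space lam" using z by (auto simp: space_pair_measure)
      have "enn2real (W (xi (fst z) w) (snd z)) \<le> c"
        using enn2real_mono[OF Wc[OF xiX[OF z'(1) w] z'(2)]] c by simp
      then show ?thesis
        using fM[OF z'(2)] c unfolding u_def by (auto intro!: mult_mono)
    qed
    \<comment> \<open>Explicit \<open>F\<close>-measurable version of the conditional mean, a
      quotient of two sums over the old particles.\<close>
    define mn where "mn w = (\<Sum>i\<in>?I. enn2real (v i w) * ?Lf (xi i w)) / enn2real (s w)" for w
    have mnm[measurable]: "mn \<in> borel_measurable F" unfolding mn_def[abs_def] by measurable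
    have mean: "AE w in P. mn w = (\<integral>z. u w z \<partial>K w)"
      using spos AE_space
    proof eventually_elim
      case (elim w)
      note w = elim(2)
      have uw[measurable]: "u w \<in> borel_measurable ?S"
        using measurable_Pair2[OF um, of w] w by (simp add: spF)
      have kw[measurable]: "?k w \<in> borel_measurable ?S"
        using measurable_Pair2[OF km, of w] w by (simp add: spF)
      have \<kappa>u: "(\<lambda>z. ?\<kappa> w z * ennreal (u w z)) \<in> borel_measurable ?S"
        by (rule borel_measurable_times_ennreal[OF \<kappa>m[OF w] measurable_compose[OF uw measurable_ennreal]])
      have "(\<integral>z. u w z \<partial>K w) = enn2real (\<integral>\<^sup>+z. ennreal (u w z) \<partial>K w)"
        unfolding Kk[OF w]
      proof (rule integral_eq_nn_integral)
        show "u w \<in> borel_measurable (density ?S (?k w))"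
          by (simp only: measurable_density_eq1 uw)
        show "AE z in density ?S (?k w). 0 \<le> u w z"
          by (rule AE_I2) (use ub[OF w] in \<open>simp only: space_density\<close>)
      qed
      also have "(\<integral>\<^sup>+z. ennreal (u w z) \<partial>K w) = (\<integral>\<^sup>+z. ?\<kappa> w z * ennreal (u w z) / s w \<partial>?S)"
        unfolding Kk[OF w]
        by (subst nn_integral_density[OF kw measurable_compose[OF uw measurable_ennreal]])
           (simp add: divide_ennreal_def mult_ac)
      also have "\<dots> = (\<integral>\<^sup>+z. ?\<kappa> w z * ennreal (u w z) \<partial>?S) / s w"
        by (rule nn_integral_divide[OF \<kappa>u])
      also have "(\<integral>\<^sup>+z. ?\<kappa> w z * ennreal (u w z) \<partial>?S) = (\<Sum>i\<in>?I. v i w * L (xi i w))"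
      proof -
        have "(\<integral>\<^sup>+z. ?\<kappa> w z * ennreal (u w z) \<partial>?S)
          = (\<Sum>i\<in>?I. \<integral>\<^sup>+x. v i w * m (xi i w) x * ennreal (u w (i, x)) \<partial>lam)"
          by (subst nn_integral_count_pair[OF lam _ \<kappa>u]) simp_all
        also have "\<dots> = (\<Sum>i\<in>?I. v i w * L (xi i w))"
        proof (rule sum.cong[OF refl])
          fix i assume i: "i \<in> ?I"
          note x = xiX[OF i w]
          have [measurable]: "m (xi i w) \<in> borel_measurable lam" "W (xi i w) \<in> borel_measurable lam"
            using x by (auto intro: measurable_Pair2[OF m] measurable_Pair2[OF W])
          have "(\<integral>\<^sup>+x. v i w * m (xi i w) x * ennreal (u w (i, x)) \<partial>lam)
            = (\<integral>\<^sup>+x. v i w * (W (xi i w) x * m (xi i w) x * ennreal (f x)) \<partial>lam)"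
          proof (rule nn_integral_cong)
            fix y assume y: "y \<in> space lam"
            \<comment> \<open>Finiteness allows \<open>enn2real\<close> to be undone inside the
              integral.\<close>
            have "W (xi i w) y < \<infinity>" using Wc[OF x y] by (auto intro: le_less_trans)
            then show "v i w * m (xi i w) y * ennreal (u w (i, y))
              = v i w * (W (xi i w) y * m (xi i w) y * ennreal (f y))"
              using fM[OF y] by (simp add: u_def ennreal_mult less_top mult_ac)
          qed
          also have "\<dots> = v i w * L (xi i w)"
            unfolding L_def by (rule nn_integral_cmult) measurable
          finally show "(\<integral>\<^sup>+x. v i w * m (xi i w) x * ennreal (u w (i, x)) \<partial>lam)
            = v i w * L (xi i w)" .
        qed
        finally show ?thesis .
      qed
      also have "enn2real ((\<Sum>i\<in>?I. v i w * L (xi i w)) / s w) = mn w"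
      proof -
        have "enn2real (\<Sum>i\<in>?I. v i w * L (xi i w))
          = (\<Sum>i\<in>?I. enn2real (v i w) * ?Lf (xi i w))"
          using vfin Lfin xiX w
          by (subst enn2real_sum) (auto simp: enn2real_mult ennreal_mult_less_top)
        then show ?thesis by (simp add: mn_def enn2real_divide)
      qed
      finally show ?case by simp
    qed
    let ?G = "\<lambda>w. (\<Sum>l\<in>?I. u w (J l w, xi' l w)) / real N"
    have Gm[measurable]: "?G \<in> borel_measurable P"
    proof -
      have "(\<lambda>w. enn2real (W (xi (J l w) w) (xi' l w)) * f (xi' l w)) \<in> borel_measurable P"
        if "l \<in> ?I" for l
        by (intro borel_measurable_times measurable_compose[OF v'[OF that]]
              measurable_compose[OF xi'[OF that] f]) simp
      then show ?thesis unfolding u_def fst_conv snd_conv by measurable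
    qed
    have mnP[measurable]: "mn \<in> borel_measurable P" by (rule measurable_from_subalg[OF F mnm])
    have wL[measurable]: "weighted_mean N v xi ?Lf \<in> borel_measurable P"
      by (rule weighted_mean_measurable[OF vP xiP borel_measurable_enn2real[OF Lm]])
    \<comment> \<open>Since \<theta> is at most \<open>A\<close>, an error below \<epsilon> / (2 A)
      contributes at most \<epsilon> / 2 after scaling. The other half of \<epsilon> is left for the
      old particles.\<close>
    let ?E1 = "{w \<in> space P. \<bar>?G w - mn w\<bar> \<ge> \<epsilon> / (2 * A)}"
    let ?E2 = "{w \<in> space P. \<bar>weighted_mean N v xi ?Lf w - normalized_mean \<mu> ?Lf\<bar> > \<epsilon> / 2}"
    have E: "?E1 \<in> sets P" "?E2 \<in> sets P" by measurable
    have "measure P {w \<in> space P. \<bar>\<theta> w * ?G w - ?\<beta> * normalized_mean \<mu>' f\<bar> > \<epsilon>}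
      \<le> measure P (?E1 \<union> ?E2)"
    proof (rule P.finite_measure_mono_AE)
      show "AE w in P. w \<in> {w \<in> space P. \<bar>\<theta> w * ?G w - ?\<beta> * normalized_mean \<mu>' f\<bar> > \<epsilon>}
        \<longrightarrow> w \<in> ?E1 \<union> ?E2"
        using spos AE_space
      proof eventually_elim
        case (elim w)
        note w = elim(2)
        have \<theta>0: "0 < \<theta> w" unfolding \<theta>eq[OF w] by (rule divide_pos_pos[OF sr[OF w elim(1)] V[OF w elim(1)]])
        \<comment> \<open>The random constant \<open>s\<close> cancels exactly here, leaving the old
          estimator of the kernel image, whose target is not random.\<close>
        have \<theta>mn: "\<theta> w * mn w = weighted_mean N v xi ?Lf w"
          using sr[OF w elim(1)] by (simp add: \<theta>eq[OF w] mn_def weighted_mean_def)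
        show ?case
        proof
          assume "w \<in> {w \<in> space P. \<bar>\<theta> w * ?G w - ?\<beta> * normalized_mean \<mu>' f\<bar> > \<epsilon>}"
          then have gt: "\<bar>\<theta> w * ?G w - normalized_mean \<mu> ?Lf\<bar> > \<epsilon>" by (simp add: \<eta>)
          show "w \<in> ?E1 \<union> ?E2"
          proof (rule ccontr)
            assume "w \<notin> ?E1 \<union> ?E2"
            then have 1: "\<bar>?G w - mn w\<bar> < \<epsilon> / (2 * A)"
              and 2: "\<bar>weighted_mean N v xi ?Lf w - normalized_mean \<mu> ?Lf\<bar> \<le> \<epsilon> / 2"
              using w by auto
            have "\<bar>\<theta> w * ?G w - \<theta> w * mn w\<bar> = \<theta> w * \<bar>?G w - mn w\<bar>"
              unfolding right_diff_distrib[symmetric] abs_mult using \<theta>0 by (simp only: abs_of_pos)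
            also have "\<dots> \<le> A * (\<epsilon> / (2 * A))"
              using 1 \<theta>0 \<theta>A[OF w] A by (intro mult_mono) auto
            also have "\<dots> = \<epsilon> / 2" using A by simp
            finally show False using 2 gt unfolding \<theta>mn by linarith
          qed
        qed
      qed
    qed (use E in auto)
    also have "\<dots> \<le> measure P ?E1 + measure P ?E2" using E by (rule measure_Un_le)
    also have "\<dots> \<le> 2 * exp (- 2 * real N * (\<epsilon> / (2 * A))\<^sup>2 / (c * M)\<^sup>2)
        + B * exp (- (C * real N * (\<epsilon> / 2)\<^sup>2 / (c * A * M)\<^sup>2))"
    proof (rule add_mono)
      show "measure P ?E1 \<le> 2 * exp (- 2 * real N * (\<epsilon> / (2 * A))\<^sup>2 / (c * M)\<^sup>2)"
        by (rule cond_iid_Hoeffding[OF P F sigma_finite_count_pair[OF lam] cond[folded K_def]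
              km Kp um ub mnm mean _ N])
           (use c M \<epsilon> A in auto)
      show "measure P ?E2 \<le> B * exp (- (C * real N * (\<epsilon> / 2)\<^sup>2 / (c * A * M)\<^sup>2))"
        by (rule concentratesD[OF IH]) (use c A M \<epsilon> Lr in auto)
    qed
    also have "\<dots> \<le> 2 * exp (- (?C * real N * \<epsilon>\<^sup>2 / M\<^sup>2)) + B * exp (- (?C * real N * \<epsilon>\<^sup>2 / M\<^sup>2))"
    proof -
      \<comment> \<open>\<open>concentrates\<close> imposes no sign on \<open>B\<close>. Tested on
        the zero function, it bounds a probability by \<open>B\<close> times a positive
        number.\<close>
      have B: "0 \<le> B"
      proof -
        have "0 \<le> B * exp (- (C * real N * 1\<^sup>2 / 1\<^sup>2))"
          by (rule order_trans[OF measure_nonneg concentratesD[OF IH, of 1 1 "\<lambda>_. 0"]]) auto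
        then show ?thesis by (simp add: zero_le_mult_iff)
      qed
      \<comment> \<open>Both exponents are multiples of this number: the factor is 2 for Hoeffding
        on range c M and \<open>C\<close> for the old particles on range c A M. The smaller factor
        serves both.\<close>
      let ?r = "real N * \<epsilon>\<^sup>2 / (4 * A\<^sup>2 * c\<^sup>2 * M\<^sup>2)"
      have r: "0 \<le> ?r" by simp
      have e1: "2 * real N * (\<epsilon> / (2 * A))\<^sup>2 / (c * M)\<^sup>2 = 2 * ?r"
        and e2: "C * real N * (\<epsilon> / 2)\<^sup>2 / (c * A * M)\<^sup>2 = C * ?r"
        and e3: "?C * real N * \<epsilon>\<^sup>2 / M\<^sup>2 = min 2 C * ?r"
        by (simp_all add: power_divide power_mult_distrib mult_ac)
      have "min 2 C * ?r \<le> 2 * ?r" "min 2 C * ?r \<le> C * ?r"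
        by (rule mult_right_mono[OF _ r]; simp)+
      then have "exp (- (2 * ?r)) \<le> exp (- (min 2 C * ?r))" "exp (- (C * ?r)) \<le> exp (- (min 2 C * ?r))"
        by simp_all
      then show ?thesis
        unfolding e2 e3 minus_mult_left[symmetric] minus_divide_left[symmetric] e1
        using B by (intro add_mono mult_left_mono) auto
    qed
    also have "\<dots> = (2 + B) * exp (- (?C * real N * \<epsilon>\<^sup>2 / M\<^sup>2))" by (simp add: algebra_simps)
    finally show "measure P {w \<in> space P. \<bar>\<theta> w * ((\<Sum>l\<in>?I. enn2real (W (xi (J l w) w) (xi' l w))
        * f (xi' l w)) / real N) - ?\<beta> * normalized_mean \<mu>' f\<bar> > \<epsilon>}
      \<le> (2 + B) * exp (- (?C * real N * \<epsilon>\<^sup>2 / M\<^sup>2))"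
      by (simp add: u_def)
  qed
qed

section \<open>Positivity, and real bounds extracted from finite suprema\<close>

lemma nn_integral_pos:
  assumes "emeasure M (space M) \<noteq> 0" "f \<in> borel_measurable M" "\<And>x. x \<in> space M \<Longrightarrow> 0 < f x"
  shows "0 < (\<integral>\<^sup>+x. f x \<partial>M)"
proof (rule ccontr)
  assume "\<not> ?thesis"
  then have "AE x in M. f x = 0" using assms(2) by (simp add: nn_integral_0_iff_AE)
  then have "AE x in M. False" using AE_space by eventually_elim (use assms(3) in force)
  then show False using assms(1) by (simp add: AE_iff_null null_sets_def)
qed

lemma ennreal_SUP_bound:
  assumes "(SUP x\<in>A. f x) < (\<infinity> :: ennreal)"
  obtains c :: real where "0 < c" "\<And>x. x \<in> A \<Longrightarrow> f x \<le> ennreal c"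
proof -
  obtain c where c: "(SUP x\<in>A. f x) = ennreal c" "0 \<le> c"
    using assms by (cases "SUP x\<in>A. f x") auto
  show thesis
  \<comment> \<open>The supremum may be 0, whereas the bound is later used as a divisor.\<close>
  proof (rule that[of "c + 1"])
    fix x assume "x \<in> A"
    then have "f x \<le> ennreal c" unfolding c(1)[symmetric] by (rule SUP_upper)
    also have "\<dots> \<le> ennreal (c + 1)" by (rule ennreal_leI) simp
    finally show "f x \<le> ennreal (c + 1)" .
  qed (use c in simp)
qed

lemma sup_norm_bound:
  assumes "sup_norm A f < \<infinity>"
  obtains c :: real where "0 < c" "\<And>z. z \<in> A \<Longrightarrow> \<bar>f z\<bar> \<le> c"
proof -
  obtain c where c: "0 < c" "\<And>z. z \<in> A \<Longrightarrow> ennreal \<bar>f z\<bar> \<le> ennreal c"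
    using ennreal_SUP_bound[OF assms[unfolded sup_norm_def]] by blast
  then show thesis using that[of c] by (simp add: ennreal_le_iff)
qed

text \<open>A finite quotient excludes a positive numerator over 0, so a zero denominator forces a
  zero numerator. Bounded weights thereby yield the support condition on which importance sampling
  rests.\<close>

lemma ennreal_divide_mult_cancel:
  fixes a b :: ennreal
  assumes "a / b < \<infinity>" "b < \<infinity>"
  shows "a / b * b = a"
proof (cases "b = 0")
  case True
  then show ?thesis using assms(1) by (cases "a = 0") auto
next
  case False
  then show ?thesis
    using assms(2) mult_divide_eq_ennreal[of b a] by (simp add: ennreal_divide_times ennreal_times_divide)
qed

lemma measurable_ancestor:
  assumes W: "(\<lambda>(x, x'). W x x') \<in> measurable (lam \<Otimes>\<^sub>M lam) R"
    and I: "countable I" "J \<in> measurable F (count_space I)"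
    and xi: "\<And>i. i \<in> I \<Longrightarrow> xi i \<in> measurable F lam" and y: "y \<in> measurable F lam"
  shows "(\<lambda>w. W (xi (J w) w) (y w)) \<in> measurable F R"
proof (rule measurable_compose_countable'[where I = I and g = J])
  show "(\<lambda>w. W (xi i w) (y w)) \<in> measurable F R" if "i \<in> I" for i
    using measurable_compose[OF measurable_Pair[OF xi[OF that] y] W] by simp
qed (use I in auto)

section \<open>Forward and backward filters\<close>

lemma space_particle_algebra [simp]: "space (particle_algebra P lam N U V xi I) = space P"
  by (simp add: particle_algebra_def space_measure_of_conv)

lemma sets_particle_algebra:
  "sets (particle_algebra P lam N U V xi I) = sigma_sets (space P)
     ({xi u l -` A \<inter> space P | u l A. u \<in> U \<and> l \<in> {1..N} \<and> A \<in> sets lam} \<union>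
      {I u l -` J \<inter> space P | u l J. u \<in> V \<and> l \<in> {1..N}})"
  unfolding particle_algebra_def by (rule sets_measure_of) auto

lemma particle_measurable:
  assumes "u \<in> U" "l \<in> {1..N}" "\<And>w. w \<in> space P \<Longrightarrow> xi u l w \<in> space lam"
  shows "xi u l \<in> measurable (particle_algebra P lam N U V xi I) lam"
proof (rule measurableI)
  fix A assume "A \<in> sets lam"
  then have "xi u l -` A \<inter> space P \<in> sets (particle_algebra P lam N U V xi I)"
    unfolding sets_particle_algebra using assms by (intro sigma_sets.Basic) blast
  then show "xi u l -` A \<inter> space (particle_algebra P lam N U V xi I)
    \<in> sets (particle_algebra P lam N U V xi I)" by simp
qed (use assms in simp)

lemma index_measurable:
  assumes "u \<in> V" "l \<in> {1..N}" "\<And>w. w \<in> space P \<Longrightarrow> I u l w \<in> S"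
  shows "I u l \<in> measurable (particle_algebra P lam N U V xi I) (count_space S)"
proof (rule measurableI)
  fix A
  have "I u l -` A \<inter> space P \<in> sets (particle_algebra P lam N U V xi I)"
    unfolding sets_particle_algebra using assms by (intro sigma_sets.Basic) blast
  then show "I u l -` A \<inter> space (particle_algebra P lam N U V xi I)
    \<in> sets (particle_algebra P lam N U V xi I)" by simp
qed (use assms in simp)

lemma subalgebra_particle_algebra:
  assumes xi: "\<And>u l. u \<in> U \<Longrightarrow> l \<in> {1..N} \<Longrightarrow> xi u l \<in> measurable P lam"
    and I: "\<And>u l. u \<in> V \<Longrightarrow> l \<in> {1..N} \<Longrightarrow> I u l \<in> measurable P (count_space S)"
  shows "subalgebra P (particle_algebra P lam N U V xi I)"
  unfolding subalgebra_def
proof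
  \<comment> \<open>The generator admits arbitrary sets \<open>J\<close> of indices, so
    \<open>J\<close> is first cut down to the range \<open>S\<close>.\<close>
  have "I u l -` J \<inter> space P \<in> sets P" if "u \<in> V" "l \<in> {1..N}" for u l J
  proof -
    have "I u l -` J \<inter> space P = I u l -` (J \<inter> S) \<inter> space P"
      using measurable_space[OF I[OF that]] by auto
    then show ?thesis using measurable_sets[OF I[OF that], of "J \<inter> S"] by simp
  qed
  then show "sets (particle_algebra P lam N U V xi I) \<subseteq> sets P"
    unfolding sets_particle_algebra using measurable_sets[OF xi]
    by (intro sets.sigma_sets_subset) auto
qed simp

lemma prob_density_measurable: "prob_density lam f \<Longrightarrow> f \<in> borel_measurable lam"
  by (simp add: prob_density_def)

section \<open>The hidden chain shared by both filters\<close>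

locale hidden_chain =
  fixes lam :: "'a measure" and q :: "'a \<Rightarrow> 'a \<Rightarrow> real" and g :: "nat \<Rightarrow> 'a \<Rightarrow> real" and T :: nat
  assumes sigma_finite: "sigma_finite_measure lam"
    and q: "transition_density lam q"
    and g_measurable: "t \<le> T \<Longrightarrow> g t \<in> borel_measurable lam"
    and g_pos: "t \<le> T \<Longrightarrow> x \<in> space lam \<Longrightarrow> 0 < g t x"
    and g_bounded: "t \<le> T \<Longrightarrow> sup_norm (space lam) (g t) < \<infinity>"
begin

sublocale lam: sigma_finite_measure lam by (rule sigma_finite)

lemma q_measurable [measurable]: "(\<lambda>(x, x'). q x x') \<in> borel_measurable (lam \<Otimes>\<^sub>M lam)"
  using q by (simp add: transition_density_def)

lemma q_section_measurable: "x \<in> space lam \<Longrightarrow> q x \<in> borel_measurable lam"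
  using q by (auto simp: transition_density_def prob_density_def)

lemma q_nonneg: "x \<in> space lam \<Longrightarrow> x' \<in> space lam \<Longrightarrow> 0 \<le> q x x'"
  using q by (auto simp: transition_density_def prob_density_def)

lemma sets_kernel [simp, measurable_cong]: "sets (kernel lam q x) = sets lam"
  by (simp add: kernel_def)

lemma space_kernel [simp]: "space (kernel lam q x) = space lam"
  by (simp add: kernel_def)

lemma prob_space_kernel: "x \<in> space lam \<Longrightarrow> prob_space (kernel lam q x)"
  using q by (intro prob_spaceI)
    (auto simp: kernel_def emeasure_density_space transition_density_def prob_density_def)

lemma nn_integral_kernel:
  "x \<in> space lam \<Longrightarrow> f \<in> borel_measurable lam \<Longrightarrow>
    (\<integral>\<^sup>+x'. f x' \<partial>kernel lam q x) = (\<integral>\<^sup>+x'. ennreal (q x x') * f x' \<partial>lam)"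
  using q_section_measurable unfolding kernel_def by (intro nn_integral_density) auto

text \<open>\<open>forward_measure\<close> is built with the Giry bind, whose integral formula asks
  for measurability into \<open>subprob_algebra\<close>.\<close>

lemma kernel_measurable: "kernel lam q \<in> measurable lam (subprob_algebra lam)"
proof (rule measurable_subprob_algebra)
  fix x assume x: "x \<in> space lam"
  show "subprob_space (kernel lam q x)"
    by (rule prob_space_imp_subprob_space[OF prob_space_kernel[OF x]])
next
  fix A assume A[measurable]: "A \<in> sets lam"
  have "(\<lambda>x. \<integral>\<^sup>+x'. ennreal (q x x') * indicator A x' \<partial>lam) \<in> borel_measurable lam"
    by measurable
  then show "(\<lambda>x. emeasure (kernel lam q x) A) \<in> borel_measurable lam"
    by (rule measurable_cong[THEN iffD2, rotated])
       (simp add: kernel_def emeasure_density q_section_measurable A)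
qed simp

lemma nn_integral_kernel_measurable:
  assumes "f \<in> borel_measurable lam"
  shows "(\<lambda>x. \<integral>\<^sup>+x'. f x' \<partial>kernel lam q x) \<in> borel_measurable lam"
proof -
  note assms[measurable]
  have "(\<lambda>x. \<integral>\<^sup>+x'. ennreal (q x x') * f x' \<partial>lam) \<in> borel_measurable lam" by measurable
  then show ?thesis
    by (rule measurable_cong[THEN iffD2, rotated]) (rule nn_integral_kernel[OF _ assms])
qed

end

section \<open>The forward filter\<close>

locale forward_filter = hidden_chain +
  fixes chi rho0 :: "'a measure" and D :: "'a \<Rightarrow> ennreal"
    and th :: "nat \<Rightarrow> 'a \<Rightarrow> real" and p :: "nat \<Rightarrow> 'a \<Rightarrow> 'a \<Rightarrow> real"
  assumes chi: "prob_space chi" "sets chi = sets lam"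
    and rho0: "sets rho0 = sets lam"
    and D: "D \<in> borel_measurable lam" "chi = density rho0 D"
    and th_measurable: "t \<in> {1..T} \<Longrightarrow> th t \<in> borel_measurable lam"
    and th_nonneg: "t \<in> {1..T} \<Longrightarrow> x \<in> space lam \<Longrightarrow> 0 \<le> th t x"
    and p: "t \<in> {1..T} \<Longrightarrow> transition_density lam (p t)"
    and omega0_bounded: "(SUP x\<in>space lam. omega0 D g x) < \<infinity>"
    and omega_bounded:
      "t \<in> {1..T} \<Longrightarrow> (SUP (x, x')\<in>space lam \<times> space lam. omega q g th p t x x') < \<infinity>"
    and th_bounded: "t \<in> {1..T} \<Longrightarrow> sup_norm (space lam) (th t) < \<infinity>"
begin

abbreviation "\<phi> \<equiv> forward_measure lam q g chi"

lemma space_chi: "space chi = space lam"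
  by (rule sets_eq_imp_space_eq[OF chi(2)])

lemma sets_forward_measure [measurable_cong]: "sets (\<phi> s) = sets lam"
  and nn_integral_forward_measure_Suc: "f \<in> borel_measurable lam \<Longrightarrow> Suc s \<le> T \<Longrightarrow>
    (\<integral>\<^sup>+x. f x \<partial>\<phi> (Suc s)) = (\<integral>\<^sup>+x. \<integral>\<^sup>+x'. ennreal (q x x' * g (Suc s) x') * f x' \<partial>lam \<partial>\<phi> s)"
proof -
  \<comment> \<open>The rule for the \<sigma>-field of a bind needs a nonempty space, which follows
    because \<open>chi\<close> is a probability.\<close>
  have X: "space lam \<noteq> {}"
    using prob_space.not_empty[OF chi(1)] space_chi by simp
  have kern: "kernel lam q \<in> measurable M (subprob_algebra lam)" if "sets M = sets lam" for M
    using kernel_measurable measurable_cong_sets[OF that refl] by blast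
  have sp: "space M \<noteq> {}" if "sets M = sets lam" for M :: "'a measure"
    using X sets_eq_imp_space_eq[OF that] by simp
  have bind: "sets (M \<bind> kernel lam q) = sets lam" if "sets M = sets lam" for M
    by (rule sets_bind[OF _ sp[OF that]]) simp
  have sets: "sets (\<phi> s) = sets lam" for s
  proof (induction s)
    case 0
    then show ?case by (simp add: chi)
  next
    case (Suc s)
    then show ?case using bind[OF Suc] by simp
  qed
  show "sets (\<phi> s) = sets lam" by (rule sets)
  assume f[measurable]: "f \<in> borel_measurable lam" and s: "Suc s \<le> T"
  note g_measurable[OF s, measurable]
  have b: "sets (\<phi> s \<bind> kernel lam q) = sets lam" by (rule bind[OF sets])
  have "(\<integral>\<^sup>+x. f x \<partial>\<phi> (Suc s)) = (\<integral>\<^sup>+x. ennreal (g (Suc s) x) * f x \<partial>(\<phi> s \<bind> kernel lam q))"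
    unfolding forward_measure.simps
    by (rule nn_integral_density) (simp_all cong: measurable_cong_sets add: measurable_cong_sets[OF b refl])
  also have "\<dots> = (\<integral>\<^sup>+x. \<integral>\<^sup>+x'. ennreal (g (Suc s) x') * f x' \<partial>kernel lam q x \<partial>\<phi> s)"
    by (rule nn_integral_bind[OF _ kern[OF sets]]) measurable
  also have "\<dots> = (\<integral>\<^sup>+x. \<integral>\<^sup>+x'. ennreal (q x x' * g (Suc s) x') * f x' \<partial>lam \<partial>\<phi> s)"
  proof (rule nn_integral_cong)
    fix x assume "x \<in> space (\<phi> s)"
    then have x: "x \<in> space lam" using sets_eq_imp_space_eq[OF sets] by simp
    have "(\<integral>\<^sup>+x'. ennreal (g (Suc s) x') * f x' \<partial>kernel lam q x)
      = (\<integral>\<^sup>+x'. ennreal (q x x') * (ennreal (g (Suc s) x') * f x') \<partial>lam)"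
      by (rule nn_integral_kernel[OF x]) measurable
    also have "\<dots> = (\<integral>\<^sup>+x'. ennreal (q x x' * g (Suc s) x') * f x' \<partial>lam)"
      using q_nonneg[OF x] g_pos[OF s]
      by (intro nn_integral_cong) (simp add: ennreal_mult less_imp_le mult_ac)
    finally show "(\<integral>\<^sup>+x'. ennreal (g (Suc s) x') * f x' \<partial>kernel lam q x)
      = (\<integral>\<^sup>+x'. ennreal (q x x' * g (Suc s) x') * f x' \<partial>lam)" .
  qed
  finally show "(\<integral>\<^sup>+x. f x \<partial>\<phi> (Suc s))
    = (\<integral>\<^sup>+x. \<integral>\<^sup>+x'. ennreal (q x x' * g (Suc s) x') * f x' \<partial>lam \<partial>\<phi> s)" .
qed

lemma space_forward_measure: "space (\<phi> s) = space lam"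
  by (rule sets_eq_imp_space_eq[OF sets_forward_measure])

text \<open>Mass stays positive because the kernel is Markov and each \<open>g\<close> is strictly
  positive; it stays finite because each \<open>g\<close> is bounded. Both facts are needed to
  divide by the mass and to form the ratio \<beta>.\<close>

lemma emeasure_forward_measure:
  "s \<le> T \<Longrightarrow> 0 < emeasure (\<phi> s) (space lam) \<and> emeasure (\<phi> s) (space lam) < \<infinity>"
proof (induction s)
  case 0
  interpret chi: prob_space chi by (rule chi)
  note g_measurable[OF 0, measurable]
  have gm: "(\<lambda>x. ennreal (g 0 x)) \<in> borel_measurable chi"
    using g_measurable[OF 0] by (simp cong: measurable_cong_sets add: chi)
  obtain c where c: "0 < c" "\<And>x. x \<in> space lam \<Longrightarrow> \<bar>g 0 x\<bar> \<le> c"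
    using sup_norm_bound[OF g_bounded[OF 0]] by blast
  have eq: "emeasure (\<phi> 0) (space lam) = (\<integral>\<^sup>+x. ennreal (g 0 x) \<partial>chi)"
    using emeasure_density_space[OF gm] by (simp add: space_chi)
  have "(\<integral>\<^sup>+x. ennreal (g 0 x) \<partial>chi) \<le> (\<integral>\<^sup>+x. ennreal c \<partial>chi)"
    by (rule nn_integral_mono) (use c(2) space_chi in \<open>force intro: ennreal_leI\<close>)
  also have "\<dots> < \<infinity>" by (simp add: chi.emeasure_space_1)
  finally have fin: "(\<integral>\<^sup>+x. ennreal (g 0 x) \<partial>chi) < \<infinity>" .
  have "0 < (\<integral>\<^sup>+x. ennreal (g 0 x) \<partial>chi)"
    by (rule nn_integral_pos[OF _ gm]) (use g_pos[OF 0] chi.emeasure_space_1 space_chi in auto)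
  then show ?case using fin eq by simp
next
  case (Suc s)
  then have s: "s \<le> T" and IH: "0 < emeasure (\<phi> s) (space lam)" "emeasure (\<phi> s) (space lam) < \<infinity>"
    by auto
  note g_measurable[OF Suc.prems, measurable]
  obtain c where c: "0 < c" "\<And>x. x \<in> space lam \<Longrightarrow> \<bar>g (Suc s) x\<bar> \<le> c"
    using sup_norm_bound[OF g_bounded[OF Suc.prems]] by blast
  let ?h = "\<lambda>x. \<integral>\<^sup>+x'. ennreal (g (Suc s) x') \<partial>kernel lam q x"
  have hm: "?h \<in> borel_measurable (\<phi> s)"
    using nn_integral_kernel_measurable[of "\<lambda>x'. ennreal (g (Suc s) x')"]
    by (simp cong: measurable_cong_sets add: measurable_cong_sets[OF sets_forward_measure refl])
  have "emeasure (\<phi> (Suc s)) (space lam) = (\<integral>\<^sup>+x. 1 \<partial>\<phi> (Suc s))"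
    by (simp add: space_forward_measure del: forward_measure.simps)
  also have "\<dots> = (\<integral>\<^sup>+x. ?h x \<partial>\<phi> s)"
    unfolding nn_integral_forward_measure_Suc[OF borel_measurable_const Suc.prems] mult_1_right
  proof (rule nn_integral_cong)
    fix x assume "x \<in> space (\<phi> s)"
    then have x: "x \<in> space lam" by (simp add: space_forward_measure)
    have "?h x = (\<integral>\<^sup>+x'. ennreal (q x x') * ennreal (g (Suc s) x') \<partial>lam)"
      by (rule nn_integral_kernel[OF x]) measurable
    also have "\<dots> = (\<integral>\<^sup>+x'. ennreal (q x x' * g (Suc s) x') \<partial>lam)"
      using q_nonneg[OF x] g_pos[OF Suc.prems]
      by (intro nn_integral_cong) (simp add: ennreal_mult less_imp_le)
    finally show "(\<integral>\<^sup>+x'. ennreal (q x x' * g (Suc s) x') \<partial>lam) = ?h x" by simp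
  qed
  finally have eq: "emeasure (\<phi> (Suc s)) (space lam) = (\<integral>\<^sup>+x. ?h x \<partial>\<phi> s)" .
  have "(\<integral>\<^sup>+x. ?h x \<partial>\<phi> s) \<le> (\<integral>\<^sup>+x. ennreal c \<partial>\<phi> s)"
  proof (rule nn_integral_mono)
    fix x assume "x \<in> space (\<phi> s)"
    then have x: "x \<in> space lam" by (simp add: space_forward_measure)
    interpret prob_space "kernel lam q x" by (rule prob_space_kernel[OF x])
    have "?h x \<le> (\<integral>\<^sup>+x'. ennreal c \<partial>kernel lam q x)"
      by (rule nn_integral_mono) (use c(2) in \<open>force intro: ennreal_leI\<close>)
    then show "?h x \<le> ennreal c" using emeasure_space_1 by simp
  qed
  also have "\<dots> < \<infinity>" using IH(2) by (simp add: space_forward_measure ennreal_mult_less_top)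
  finally have fin: "(\<integral>\<^sup>+x. ?h x \<partial>\<phi> s) < \<infinity>" .
  have "0 < (\<integral>\<^sup>+x. ?h x \<partial>\<phi> s)"
  proof (rule nn_integral_pos[OF _ hm])
    show "emeasure (\<phi> s) (space (\<phi> s)) \<noteq> 0" using IH(1) by (simp add: space_forward_measure)
    fix x assume "x \<in> space (\<phi> s)"
    then have x: "x \<in> space lam" by (simp add: space_forward_measure)
    interpret prob_space "kernel lam q x" by (rule prob_space_kernel[OF x])
    show "0 < ?h x"
      by (rule nn_integral_pos) (use emeasure_space_1 g_pos[OF Suc.prems] in \<open>auto simp: g_measurable[OF Suc.prems] cong: measurable_cong_sets\<close>)
  qed
  then show ?case using fin eq by simp
qed

lemma finite_forward_measure:
  assumes "s \<le> T"
  shows "finite_measure (\<phi> s)" "0 < measure (\<phi> s) (space (\<phi> s))"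
proof -
  show "finite_measure (\<phi> s)"
    by (rule finite_measureI) (use emeasure_forward_measure[OF assms] in \<open>simp add: space_forward_measure less_top\<close>)
  show "0 < measure (\<phi> s) (space (\<phi> s))"
    using emeasure_forward_measure[OF assms]
    by (simp add: measure_def space_forward_measure enn2real_positive_iff)
qed

end

context forward_filter
begin

lemma omega_measurable:
  assumes "t \<in> {1..T}"
  shows "(\<lambda>(x, x'). omega q g th p t x x') \<in> borel_measurable (lam \<Otimes>\<^sub>M lam)"
proof -
  have [measurable]: "(\<lambda>(x, x'). p t x x') \<in> borel_measurable (lam \<Otimes>\<^sub>M lam)"
    using p[OF assms] by (simp add: transition_density_def)
  note th_measurable[OF assms, measurable]
  have [measurable]: "g t \<in> borel_measurable lam" using g_measurable assms by simp
  show ?thesis unfolding omega_def by measurable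
qed

text \<open>The importance weight undoes the proposal. The supremum bound is essential: it makes the
  numerator vanish wherever the product of selection function and proposal density does.\<close>

lemma omega_mult:
  assumes t: "t \<in> {1..T}" and x: "x \<in> space lam" and x': "x' \<in> space lam"
  shows "omega q g th p t x x' * (ennreal (th t x) * ennreal (p t x x'))
    = ennreal (q x x' * g t x')"
proof -
  have p0: "0 \<le> p t x x'"
    using p[OF t] x x' by (auto simp: transition_density_def prob_density_def)
  obtain c where c: "\<And>z. z \<in> space lam \<times> space lam \<Longrightarrow>
      (case z of (x, x') \<Rightarrow> omega q g th p t x x') \<le> ennreal c"
    using ennreal_SUP_bound[OF omega_bounded[OF t]] by blast
  have "omega q g th p t x x' \<le> ennreal c" using c[of "(x, x')"] x x' by simp
  then have "omega q g th p t x x' < \<infinity>" by (auto intro: le_less_trans)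
  then have "omega q g th p t x x' * ennreal (th t x * p t x x') = ennreal (q x x' * g t x')"
    unfolding omega_def by (intro ennreal_divide_mult_cancel) auto
  then show ?thesis using th_nonneg[OF t x] p0 by (simp add: ennreal_mult)
qed

lemma forward_particles_measurable:
  assumes sys: "forward_system P lam T N q g rho0 D th p xi I" and P: "prob_space P"
    and l: "l \<in> {1..N}"
  shows "s \<le> T \<Longrightarrow> xi s l \<in> measurable P lam"
    and "s \<in> {1..T} \<Longrightarrow> I s l \<in> measurable P (count_space {1..N})"
proof -
  interpret P: prob_space P by (rule P)
  have pair: "(\<lambda>w. (I s l w, xi s l w)) \<in> measurable P (count_space {1..N} \<Otimes>\<^sub>M lam)"
    if "s \<in> {1..T}" for s
    using sys that l unfolding forward_system_def cond_iid_def by blast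
  show "I s l \<in> measurable P (count_space {1..N})" if "s \<in> {1..T}"
    using measurable_compose[OF pair[OF that] measurable_fst] by simp
  show "xi s l \<in> measurable P lam" if "s \<le> T"
  proof (cases "s = 0")
    case True
    then show ?thesis using sys l unfolding forward_system_def P.indep_vars_def by blast
  next
    case False
    then show ?thesis using measurable_compose[OF pair[of s] measurable_snd] that by simp
  qed
qed

lemma forward_weight_measurable:
  assumes s: "s \<le> T" and l: "l \<in> {1..N}"
    and xi: "\<And>u l. u \<le> s \<Longrightarrow> l \<in> {1..N} \<Longrightarrow> xi u l \<in> measurable F lam"
    and I: "\<And>u l. u \<in> {1..s} \<Longrightarrow> l \<in> {1..N} \<Longrightarrow> I u l \<in> measurable F (count_space {1..N})"
  shows "forward_weight q g D th p xi I s l \<in> borel_measurable F"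
proof (cases s)
  case 0
  note D(1)[measurable] g_measurable[of 0, measurable]
  have "omega0 D g \<in> borel_measurable lam" unfolding omega0_def by measurable
  from measurable_compose[OF xi[of 0 l] this]
  have "(\<lambda>w. omega0 D g (xi 0 l w)) \<in> borel_measurable F" using l by simp
  also have "(\<lambda>w. omega0 D g (xi 0 l w)) = forward_weight q g D th p xi I s l"
    by (simp add: 0 fun_eq_iff)
  finally show ?thesis .
next
  case (Suc s')
  have "(\<lambda>w. omega q g th p s (xi s' (I s l w) w) (xi s l w)) \<in> borel_measurable F"
    by (rule measurable_ancestor[OF omega_measurable _ I]) (use s l xi Suc in auto)
  also have "(\<lambda>w. omega q g th p s (xi s' (I s l w) w) (xi s l w))
    = forward_weight q g D th p xi I s l"
    by (simp add: Suc fun_eq_iff)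
  finally show ?thesis .
qed

text \<open>The weight functions are bounded pointwise, so finiteness holds at every outcome and
  \<open>enn2real\<close> loses nothing on weights.\<close>

lemma forward_weight_finite:
  assumes s: "s \<le> T" and l: "l \<in> {1..N}" and w: "w \<in> space P"
    and sys: "forward_system P lam T N q g rho0 D th p xi I" and P: "prob_space P"
  shows "forward_weight q g D th p xi I s l w < \<infinity>"
proof -
  have X: "xi u k w \<in> space lam" if "u \<le> T" "k \<in> {1..N}" for u k
    by (rule measurable_space[OF forward_particles_measurable(1)[OF sys P that(2,1)] w])
  show ?thesis
  proof (cases s)
    case 0
    obtain c where c: "\<And>x. x \<in> space lam \<Longrightarrow> omega0 D g x \<le> ennreal c"
      using ennreal_SUP_bound[OF omega0_bounded] by blast
    show ?thesis using c[OF X[OF s l]] 0 by (auto intro: le_less_trans)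
  next
    case (Suc s')
    have t: "s \<in> {1..T}" using Suc s by simp
    obtain c where c: "\<And>z. z \<in> space lam \<times> space lam \<Longrightarrow>
        (case z of (x, x') \<Rightarrow> omega q g th p s x x') \<le> ennreal c"
      using ennreal_SUP_bound[OF omega_bounded[OF t]] by blast
    have "I s l w \<in> {1..N}"
      using measurable_space[OF forward_particles_measurable(2)[OF sys P l t] w] by simp
    then show ?thesis
      using c[of "(xi s' (I s l w) w, xi s l w)"] X[of s'] X[OF s l] s Suc
      by (auto intro: le_less_trans)
  qed
qed

text \<open>The constants are chosen before \<open>N\<close>, the probability space and the
  particles. They therefore depend on the model alone, and the induction hypothesis applies to any
  system of the same type.\<close>

theorem forward_concentrates:
  assumes "s \<le> T"
  shows "\<exists>B>0. \<exists>C>0. \<forall>N\<ge>1. \<forall>(P :: 'w measure) xi I. prob_space P \<longrightarrow>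
    forward_system P lam T N q g rho0 D th p xi I \<longrightarrow>
    concentrates P lam N (forward_weight q g D th p xi I s) (xi s) (\<phi> s) B C"
  using assms
proof (induction s)
  case 0
  obtain c where c: "0 < c" "\<And>x. x \<in> space lam \<Longrightarrow> omega0 D g x \<le> ennreal c"
    using ennreal_SUP_bound[OF omega0_bounded] by blast
  note D(1)[measurable] g_measurable[OF 0, measurable]
  have o: "omega0 D g \<in> borel_measurable lam" unfolding omega0_def by measurable
  \<comment> \<open>Importance sampling at time 0: as \<open>D\<close> is the density of
    \<open>chi\<close> relative to \<open>rho0\<close>, the target has density \<open>omega0\<close>
    relative to the proposal.\<close>
  have \<mu>: "\<phi> 0 = density rho0 (omega0 D g)"
    unfolding forward_measure.simps D(2) omega0_def
    by (rule density_density_eq) (use D(1) g_measurable[OF 0] rho0 in \<open>auto cong: measurable_cong_sets\<close>)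
  show ?case
  proof (rule exI[of _ 4], rule conjI[OF _ exI[of _ "(measure (\<phi> 0) (space (\<phi> 0)))\<^sup>2 / (8 * c\<^sup>2)"]],
      goal_cases pos conc)
    case pos
    show ?case by simp
  next
    case conc
    show ?case
    proof (intro conjI allI impI)
    show "0 < (measure (\<phi> 0) (space (\<phi> 0)))\<^sup>2 / (8 * c\<^sup>2)"
      using finite_forward_measure(2)[OF 0] c by simp
    fix N :: nat and P :: "'w measure" and xi I
    assume N: "1 \<le> N" and P: "prob_space P"
      and sys: "forward_system P lam T N q g rho0 D th p xi I"
    have "concentrates P lam N (\<lambda>l w. omega0 D g (xi 0 l w)) (xi 0) (\<phi> 0) 4
        ((measure (\<phi> 0) (space (\<phi> 0)))\<^sup>2 / (8 * c\<^sup>2))"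
      by (rule concentrates_iid[OF P N _ _ o c(2,1) finite_forward_measure[OF 0] \<mu>])
         (use sys in \<open>auto simp: forward_system_def\<close>)
    then show "concentrates P lam N (forward_weight q g D th p xi I 0) (xi 0) (\<phi> 0) 4
        ((measure (\<phi> 0) (space (\<phi> 0)))\<^sup>2 / (8 * c\<^sup>2))"
      by (simp add: concentrates_def weighted_mean_def)
    qed
  qed
next
  case (Suc s)
  then have s: "s \<le> T" and t: "Suc s \<in> {1..T}" by auto
  obtain B C where BC: "0 < B" "0 < C" and IH: "\<And>N (P :: 'w measure) xi I. 1 \<le> N \<Longrightarrow> prob_space P \<Longrightarrow>
      forward_system P lam T N q g rho0 D th p xi I \<Longrightarrow>
      concentrates P lam N (forward_weight q g D th p xi I s) (xi s) (\<phi> s) B C"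
    using Suc.IH[OF s] by blast
  obtain c where c: "0 < c" and c': "\<And>z. z \<in> space lam \<times> space lam \<Longrightarrow>
      (case z of (x, x') \<Rightarrow> omega q g th p (Suc s) x x') \<le> ennreal c"
    using ennreal_SUP_bound[OF omega_bounded[OF t]] by blast
  obtain A where A: "0 < A" "\<And>x. x \<in> space lam \<Longrightarrow> \<bar>th (Suc s) x\<bar> \<le> A"
    using sup_norm_bound[OF th_bounded[OF t]] by blast
  let ?m = "\<lambda>x x'. ennreal (th (Suc s) x) * ennreal (p (Suc s) x x')"
  let ?W = "omega q g th p (Suc s)"
  note th_measurable[OF t, measurable]
  have [measurable]: "(\<lambda>(x, x'). p (Suc s) x x') \<in> borel_measurable (lam \<Otimes>\<^sub>M lam)"
    using p[OF t] by (simp add: transition_density_def)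
  have m: "(\<lambda>(x, x'). ?m x x') \<in> borel_measurable (lam \<Otimes>\<^sub>M lam)" by measurable
  have mA: "(\<integral>\<^sup>+x'. ?m x x' \<partial>lam) \<le> ennreal A" if x: "x \<in> space lam" for x
  proof -
    have px: "prob_density lam (p (Suc s) x)" using p[OF t] x by (simp add: transition_density_def)
    have "(\<integral>\<^sup>+x'. ?m x x' \<partial>lam) = ennreal (th (Suc s) x) * (\<integral>\<^sup>+x'. ennreal (p (Suc s) x x') \<partial>lam)"
      by (rule nn_integral_cmult) (use prob_density_measurable[OF px] in simp)
    also have "\<dots> = ennreal (th (Suc s) x)" using px by (simp add: prob_density_def)
    also have "\<dots> \<le> ennreal A" by (rule ennreal_leI) (use A(2)[OF x] in simp)
    finally show ?thesis .
  qed
  let ?\<beta> = "measure (\<phi> (Suc s)) (space (\<phi> (Suc s))) / measure (\<phi> s) (space (\<phi> s))"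
  \<comment> \<open>The rate delivered by \<open>concentrates_step\<close>, with \<open>A\<close>
    bounding the selection function and \<open>c\<close> the weight function.\<close>
  let ?C = "min 2 C / (4 * A\<^sup>2 * c\<^sup>2) * ?\<beta>\<^sup>2 / 16"
  note f = finite_forward_measure[OF s] finite_forward_measure[OF Suc.prems]
  have step: "(\<integral>\<^sup>+x. f x \<partial>\<phi> (Suc s)) = (\<integral>\<^sup>+x. \<integral>\<^sup>+x'. ?W x x' * ?m x x' * f x' \<partial>lam \<partial>\<phi> s)"
    if "f \<in> borel_measurable lam" for f
    unfolding nn_integral_forward_measure_Suc[OF that Suc.prems]
    by (intro nn_integral_cong) (simp add: space_forward_measure omega_mult[OF t])
  show ?case
  proof (rule exI[of _ "2 * (2 + B)"], rule conjI[OF _ exI[of _ ?C]], goal_cases pos conc)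
    case pos
    show ?case using BC by simp
  next
    case conc
    show ?case
    proof (intro conjI allI impI)
    have "0 < ?\<beta>" using f by (simp del: forward_measure.simps)
    then have "0 < ?\<beta>\<^sup>2" by (rule zero_less_power)
    then show "0 < ?C" using BC A(1) c by (intro divide_pos_pos mult_pos_pos) auto
    fix N :: nat and P :: "'w measure" and xi I
    assume N: "1 \<le> N" and P: "prob_space P"
      and sys: "forward_system P lam T N q g rho0 D th p xi I"
    \<comment> \<open>The past contains the indices up to and including time \<open>s\<close>,
      because a weight at time \<open>s\<close> looks up its ancestor through \<open>I s\<close>.
      Time 0 has no index.\<close>
    let ?F = "particle_algebra P lam N {..<Suc s} {1..<Suc s} xi I"
    let ?v = "forward_weight q g D th p xi I s"
    note pm = forward_particles_measurable[OF sys P]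
    have sub: "subalgebra P ?F"
      by (rule subalgebra_particle_algebra[where S = "{1..N}"]) (use pm s in auto)
    have xiF: "xi u l \<in> measurable ?F lam" if "u \<le> s" "l \<in> {1..N}" for u l
      by (rule particle_measurable) (use that s measurable_space[OF pm(1)] in auto)
    have IF: "I u l \<in> measurable ?F (count_space {1..N})" if "u \<in> {1..s}" "l \<in> {1..N}" for u l
      by (rule index_measurable) (use that s measurable_space[OF pm(2)] in auto)
    have proposal: "forward_proposal lam N q g D th p xi I (Suc s) w
      = density (count_space {1..N} \<Otimes>\<^sub>M lam) (\<lambda>(i, x). ?v i w * ?m (xi s i w) x)" for w
      by (simp add: forward_proposal_def mult.assoc)
    have selection: "AE w in P. 0 < emeasure (forward_proposal lam N q g D th p xi I (Suc s) w)
        ({1..N} \<times> space lam)"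
      "cond_iid P ?F N (count_space {1..N} \<Otimes>\<^sub>M lam) (\<lambda>l w. (I (Suc s) l w, xi (Suc s) l w))
        (\<lambda>w. prob_normalize (forward_proposal lam N q g D th p xi I (Suc s) w))"
      using sys t unfolding forward_system_def by blast+
    have "concentrates P lam N (\<lambda>l w. ?W (xi s (I (Suc s) l w) w) (xi (Suc s) l w)) (xi (Suc s))
        (\<phi> (Suc s)) (2 * (2 + B)) ?C"
    proof (rule concentrates_step[OF P sigma_finite sub N xiF _ _ m mA A(1) omega_measurable[OF t] _ c
          f(1,2) sets_forward_measure f(3,4) sets_forward_measure step
          selection[unfolded proposal]])
      show "?v l \<in> borel_measurable ?F" if "l \<in> {1..N}" for l
        by (rule forward_weight_measurable[OF s that xiF IF])
      show "?v l w < \<infinity>" if "l \<in> {1..N}" "w \<in> space P" for l w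
        by (rule forward_weight_finite[OF s that sys P])
      show "?W x x' \<le> ennreal c" if "x \<in> space lam" "x' \<in> space lam" for x x'
        using c'[of "(x, x')"] that by simp
      show "concentrates P lam N ?v (xi s) (\<phi> s) B C" by (rule IH[OF N P sys])
    qed auto
    then show "concentrates P lam N (forward_weight q g D th p xi I (Suc s)) (xi (Suc s))
        (\<phi> (Suc s)) (2 * (2 + B)) ?C"
      by (simp add: concentrates_def weighted_mean_def del: forward_measure.simps)
    qed
  qed
qed

end

section \<open>The backward information filter\<close>

locale backward_filter = hidden_chain +
  fixes gam :: "nat \<Rightarrow> 'a \<Rightarrow> real" and brho :: "'a \<Rightarrow> real"
    and bth :: "nat \<Rightarrow> 'a \<Rightarrow> real" and r :: "nat \<Rightarrow> 'a \<Rightarrow> 'a \<Rightarrow> real"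
  assumes gam_measurable: "t \<le> T \<Longrightarrow> gam t \<in> borel_measurable lam"
    and gam_pos: "t \<le> T \<Longrightarrow> x \<in> space lam \<Longrightarrow> 0 < gam t x"
    and gam_integrable:
      "t \<le> T \<Longrightarrow> (\<integral>\<^sup>+x. ennreal (gam t x) * backward_likelihood lam q g T t x \<partial>lam) < \<infinity>"
    and brho: "prob_density lam brho"
    and bth_measurable: "t < T \<Longrightarrow> bth t \<in> borel_measurable lam"
    and bth_nonneg: "t < T \<Longrightarrow> x \<in> space lam \<Longrightarrow> 0 \<le> bth t x"
    and r: "t < T \<Longrightarrow> transition_density lam (r t)"
    and bomegaT_bounded: "(SUP x\<in>space lam. bomegaT g gam brho T x) < \<infinity>"
    and bomega_bounded:
      "t < T \<Longrightarrow> (SUP (x, x')\<in>space lam \<times> space lam. bomega q g gam bth r t x x') < \<infinity>"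
    and bth_bounded: "t < T \<Longrightarrow> sup_norm (space lam) (\<lambda>x. bth t x / gam (Suc t) x) < \<infinity>"
begin

abbreviation "\<L> \<equiv> backward_likelihood lam q g T"
abbreviation "\<psi> \<equiv> backward_measure lam q g gam T"

lemma backward_likelihood_T: "\<L> T = (\<lambda>x. ennreal (g T x))"
  by (subst backward_likelihood.simps) simp

lemma backward_likelihood_less:
  "t < T \<Longrightarrow> \<L> t = (\<lambda>x. ennreal (g t x) * (\<integral>\<^sup>+x'. \<L> (Suc t) x' \<partial>kernel lam q x))"
  by (subst backward_likelihood.simps) simp

text \<open>Both claims share one downward induction, since positivity of the integral at
  \<open>t\<close> uses measurability and positivity of the likelihood at
  \<open>Suc t\<close>.\<close>

lemma backward_likelihood_measurable_pos:
  assumes "t \<le> T"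
  shows "\<L> t \<in> borel_measurable lam \<and> (\<forall>x\<in>space lam. 0 < \<L> t x)"
  using assms
proof (induction rule: inc_induct)
  case base
  then show ?case using g_measurable[of T] g_pos[of T] by (auto simp: backward_likelihood_T)
next
  case (step t)
  then have t: "t \<le> T" and IH: "\<L> (Suc t) \<in> borel_measurable lam"
    "\<And>x. x \<in> space lam \<Longrightarrow> 0 < \<L> (Suc t) x" by auto
  have "0 < (\<integral>\<^sup>+x'. \<L> (Suc t) x' \<partial>kernel lam q x)" if x: "x \<in> space lam" for x
  proof -
    interpret prob_space "kernel lam q x" by (rule prob_space_kernel[OF x])
    show ?thesis
      by (rule nn_integral_pos) (use emeasure_space_1 IH in \<open>auto cong: measurable_cong_sets\<close>)
  qed
  then show ?case
    using nn_integral_kernel_measurable[OF IH(1)] g_measurable[OF t] g_pos[OF t]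
    unfolding backward_likelihood_less[OF step(2)]
    by (auto simp: ennreal_zero_less_mult_iff)
qed

lemmas backward_likelihood_measurable = backward_likelihood_measurable_pos[THEN conjunct1]

lemma weighted_likelihood_measurable:
  "t \<le> T \<Longrightarrow> (\<lambda>x. ennreal (gam t x) * \<L> t x) \<in> borel_measurable lam"
  using backward_likelihood_measurable[of t] gam_measurable[of t] by auto

lemma sets_backward_measure [measurable_cong]: "sets (\<psi> t) = sets lam"
  by (simp add: backward_measure_def)

lemma space_backward_measure: "space (\<psi> t) = space lam"
  by (simp add: backward_measure_def)

lemma finite_backward_measure:
  assumes t: "t \<le> T"
  shows "finite_measure (\<psi> t)" "0 < measure (\<psi> t) (space (\<psi> t))"
proof -
  have eq: "emeasure (\<psi> t) (space (\<psi> t)) = (\<integral>\<^sup>+x. ennreal (gam t x) * \<L> t x \<partial>lam)"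
    using emeasure_density_space[OF weighted_likelihood_measurable[OF t]]
    by (simp add: backward_measure_def)
  \<comment> \<open>A positive density gives positive mass only if the reference measure is nonzero.
    It is, since it carries the probability density \<open>brho\<close>.\<close>
  have "emeasure lam (space lam) \<noteq> 0"
  proof
    assume "emeasure lam (space lam) = 0"
    then have "AE x in lam. False" by (simp add: AE_iff_null null_sets_def)
    then have "(\<integral>\<^sup>+x. ennreal (brho x) \<partial>lam) = (\<integral>\<^sup>+x. 0 \<partial>lam)"
      by (intro nn_integral_cong_AE) (auto elim: eventually_mono)
    then show False using brho by (simp add: prob_density_def)
  qed
  then have pos: "0 < (\<integral>\<^sup>+x. ennreal (gam t x) * \<L> t x \<partial>lam)"
    by (rule nn_integral_pos[OF _ weighted_likelihood_measurable[OF t]])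
       (use backward_likelihood_measurable_pos[OF t] gam_pos[OF t] in
         \<open>auto simp: ennreal_zero_less_mult_iff\<close>)
  show "finite_measure (\<psi> t)"
    by (rule finite_measureI) (use gam_integrable[OF t] eq in \<open>simp add: less_top\<close>)
  show "0 < measure (\<psi> t) (space (\<psi> t))"
    using pos gam_integrable[OF t] unfolding measure_def eq by (simp add: enn2real_positive_iff)
qed

text \<open>The argument order is swapped: backward in time, \<open>x'\<close> is the old particle
  and \<open>x\<close> the new one, and \<open>concentrates_step\<close> takes the old particle
  first.\<close>

lemma bomega_measurable:
  assumes "t < T"
  shows "(\<lambda>(x', x). bomega q g gam bth r t x x') \<in> borel_measurable (lam \<Otimes>\<^sub>M lam)"
proof -
  have [measurable]: "(\<lambda>(x', x). r t x' x) \<in> borel_measurable (lam \<Otimes>\<^sub>M lam)"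
    using r[OF assms] by (simp add: transition_density_def)
  have [measurable]: "(\<lambda>(x', x). q x x') \<in> borel_measurable (lam \<Otimes>\<^sub>M lam)"
    using measurable_pair_swap[OF q_measurable] by simp
  note bth_measurable[OF assms, measurable]
  have [measurable]: "g t \<in> borel_measurable lam" "gam t \<in> borel_measurable lam"
    using g_measurable gam_measurable assms by simp_all
  show ?thesis unfolding bomega_def by measurable
qed

lemma bomegaT_measurable: "bomegaT g gam brho T \<in> borel_measurable lam"
proof -
  note g_measurable[of T, measurable] gam_measurable[of T, measurable]
    prob_density_measurable[OF brho, measurable]
  show ?thesis unfolding bomegaT_def by measurable
qed

text \<open>The division by \<open>gam (Suc t) x'\<close> comes from the selection law and stays on
  the right; it cancels the same factor in the density of \<open>\<psi> (Suc t)\<close> when the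
  recursion is integrated.\<close>

lemma bomega_mult:
  assumes t: "t < T" and x: "x \<in> space lam" and x': "x' \<in> space lam"
  shows "bomega q g gam bth r t x x' * (ennreal (bth t x' / gam (Suc t) x') * ennreal (r t x' x))
    = ennreal (gam t x * g t x * q x x' / gam (Suc t) x')"
proof -
  have r0: "0 \<le> r t x' x"
    using r[OF t] x x' by (auto simp: transition_density_def prob_density_def)
  have g0: "0 < gam (Suc t) x'" using gam_pos[of "Suc t"] t x' by simp
  have p0: "0 \<le> gam t x * g t x * q x x'"
    using gam_pos[of t x] g_pos[of t x] q_nonneg t x x' by simp
  obtain c where c: "\<And>z. z \<in> space lam \<times> space lam \<Longrightarrow>
      (case z of (x, x') \<Rightarrow> bomega q g gam bth r t x x') \<le> ennreal c"
    using ennreal_SUP_bound[OF bomega_bounded[OF t]] by blast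
  have "bomega q g gam bth r t x x' \<le> ennreal c" using c[of "(x, x')"] x x' by simp
  then have "bomega q g gam bth r t x x' < \<infinity>" by (auto intro: le_less_trans)
  then have "bomega q g gam bth r t x x' * ennreal (bth t x' * r t x' x)
    = ennreal (gam t x * g t x * q x x')"
    unfolding bomega_def by (intro ennreal_divide_mult_cancel) auto
  then have "bomega q g gam bth r t x x' * ennreal (bth t x' * r t x' x) * ennreal (1 / gam (Suc t) x')
    = ennreal (gam t x * g t x * q x x' * (1 / gam (Suc t) x'))"
    using p0 g0 by (simp only: ennreal_mult[symmetric] divide_nonneg_pos zero_le_one)
  moreover have "ennreal (bth t x' * r t x' x) * ennreal (1 / gam (Suc t) x')
    = ennreal (bth t x' / gam (Suc t) x') * ennreal (r t x' x)"
    using bth_nonneg[OF t x'] r0 g0 by (simp add: ennreal_mult[symmetric])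
  ultimately show ?thesis by (simp add: mult.assoc)
qed

text \<open>The likelihood at \<open>t\<close> is a weighted kernel image of the one at
  \<open>Suc t\<close>. Tonelli makes the later state the outer variable, and multiplying and
  dividing by the strictly positive \<open>gam (Suc t)\<close> exposes the density of
  \<open>\<psi> (Suc t)\<close>. The recursion thus takes the form that
  \<open>concentrates_step\<close> requires.\<close>

lemma nn_integral_backward_measure:
  assumes t: "t < T" and f[measurable]: "f \<in> borel_measurable lam"
  shows "(\<integral>\<^sup>+x. f x \<partial>\<psi> t) = (\<integral>\<^sup>+x'. \<integral>\<^sup>+x. bomega q g gam bth r t x x'
    * (ennreal (bth t x' / gam (Suc t) x') * ennreal (r t x' x)) * f x \<partial>lam \<partial>\<psi> (Suc t))"
proof -
  interpret ll: pair_sigma_finite lam lam ..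
  let ?L = "\<L> (Suc t)" and ?h = "\<lambda>x. gam t x * g t x"
  have [measurable]: "?L \<in> borel_measurable lam"
    using backward_likelihood_measurable[of "Suc t"] t by simp
  have [measurable]: "g t \<in> borel_measurable lam" "gam t \<in> borel_measurable lam"
    "gam (Suc t) \<in> borel_measurable lam"
    using g_measurable gam_measurable t by simp_all
  have q'[measurable]: "(\<lambda>(x', x). q x x') \<in> borel_measurable (lam \<Otimes>\<^sub>M lam)"
    using measurable_pair_swap[OF q_measurable] by simp
  have h0: "0 \<le> ?h x" if "x \<in> space lam" for x using gam_pos[of t x] g_pos[of t x] t that by simp
  have "(\<integral>\<^sup>+x. f x \<partial>\<psi> t) = (\<integral>\<^sup>+x. ennreal (gam t x) * \<L> t x * f x \<partial>lam)"
    unfolding backward_measure_def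
    by (rule nn_integral_density[OF weighted_likelihood_measurable f]) (use t in simp)
  also have "\<dots> = (\<integral>\<^sup>+x. \<integral>\<^sup>+x'. ennreal (?h x) * f x * (ennreal (q x x') * ?L x') \<partial>lam \<partial>lam)"
  proof (rule nn_integral_cong)
    fix x assume x: "x \<in> space lam"
    note q_section_measurable[OF x, measurable]
    have "ennreal (gam t x) * \<L> t x * f x
      = ennreal (?h x) * f x * (\<integral>\<^sup>+x'. ennreal (q x x') * ?L x' \<partial>lam)"
      using gam_pos[of t x] g_pos[of t x] t x
      by (simp add: backward_likelihood_less[OF t] nn_integral_kernel[OF x] ennreal_mult mult_ac)
    also have "\<dots> = (\<integral>\<^sup>+x'. ennreal (?h x) * f x * (ennreal (q x x') * ?L x') \<partial>lam)"
      by (rule nn_integral_cmult[symmetric]) measurable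
    finally show "ennreal (gam t x) * \<L> t x * f x = \<dots>" .
  qed
  also have "\<dots> = (\<integral>\<^sup>+x'. \<integral>\<^sup>+x. ennreal (?h x) * f x * (ennreal (q x x') * ?L x') \<partial>lam \<partial>lam)"
    by (rule ll.Fubini') measurable
  also have "\<dots> = (\<integral>\<^sup>+x'. ennreal (gam (Suc t) x') * ?L x'
      * (\<integral>\<^sup>+x. ennreal (?h x * q x x' / gam (Suc t) x') * f x \<partial>lam) \<partial>lam)"
  proof (rule nn_integral_cong)
    fix x' assume x': "x' \<in> space lam"
    have qx[measurable]: "(\<lambda>x. q x x') \<in> borel_measurable lam"
      using measurable_Pair2[OF q' x'] by simp
    have g0: "0 < gam (Suc t) x'" using gam_pos[of "Suc t"] t x' by simp
    have "(\<integral>\<^sup>+x. ennreal (?h x) * f x * (ennreal (q x x') * ?L x') \<partial>lam)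
      = (\<integral>\<^sup>+x. ennreal (gam (Suc t) x') * ?L x' * (ennreal (?h x * q x x' / gam (Suc t) x') * f x) \<partial>lam)"
    proof (rule nn_integral_cong)
      fix x assume x: "x \<in> space lam"
      have "ennreal (?h x) * f x * (ennreal (q x x') * ?L x')
        = ennreal (?h x) * ennreal (q x x') * (f x * ?L x')"
        by (simp only: mult_ac)
      also have "ennreal (?h x) * ennreal (q x x')
        = ennreal (gam (Suc t) x') * ennreal (?h x * q x x' / gam (Suc t) x')"
        using h0[OF x] q_nonneg[OF x x'] g0 by (simp add: ennreal_mult[symmetric])
      also have "\<dots> * (f x * ?L x')
        = ennreal (gam (Suc t) x') * ?L x' * (ennreal (?h x * q x x' / gam (Suc t) x') * f x)"
        by (simp only: mult_ac)
      finally show "ennreal (?h x) * f x * (ennreal (q x x') * ?L x')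
        = ennreal (gam (Suc t) x') * ?L x' * (ennreal (?h x * q x x' / gam (Suc t) x') * f x)" .
    qed
    also have "\<dots> = ennreal (gam (Suc t) x') * ?L x'
        * (\<integral>\<^sup>+x. ennreal (?h x * q x x' / gam (Suc t) x') * f x \<partial>lam)"
      by (rule nn_integral_cmult) measurable
    finally show "(\<integral>\<^sup>+x. ennreal (?h x) * f x * (ennreal (q x x') * ?L x') \<partial>lam) = \<dots>" .
  qed
  also have "\<dots> = (\<integral>\<^sup>+x'. \<integral>\<^sup>+x. ennreal (?h x * q x x' / gam (Suc t) x') * f x \<partial>lam \<partial>\<psi> (Suc t))"
    unfolding backward_measure_def
    by (rule nn_integral_density[OF weighted_likelihood_measurable, symmetric]) (use t in simp, measurable)
  also have "\<dots> = (\<integral>\<^sup>+x'. \<integral>\<^sup>+x. bomega q g gam bth r t x x'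
    * (ennreal (bth t x' / gam (Suc t) x') * ennreal (r t x' x)) * f x \<partial>lam \<partial>\<psi> (Suc t))"
    by (intro nn_integral_cong) (simp add: space_backward_measure bomega_mult[OF t])
  finally show ?thesis .
qed

lemma backward_particles_measurable:
  assumes sys: "backward_system P lam T N q g gam brho bth r bxi bI" and P: "prob_space P"
    and l: "l \<in> {1..N}"
  shows "t \<le> T \<Longrightarrow> bxi t l \<in> measurable P lam"
    and "t < T \<Longrightarrow> bI t l \<in> measurable P (count_space {1..N})"
proof -
  interpret P: prob_space P by (rule P)
  have pair: "(\<lambda>w. (bI t l w, bxi t l w)) \<in> measurable P (count_space {1..N} \<Otimes>\<^sub>M lam)"
    if "t < T" for t
    using sys that l unfolding backward_system_def cond_iid_def by blast
  show "bI t l \<in> measurable P (count_space {1..N})" if "t < T"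
    using measurable_compose[OF pair[OF that] measurable_fst] by simp
  show "bxi t l \<in> measurable P lam" if "t \<le> T"
  proof (cases "t = T")
    case True
    then show ?thesis using sys l unfolding backward_system_def P.indep_vars_def by blast
  next
    case False
    then show ?thesis using measurable_compose[OF pair[of t] measurable_snd] that by simp
  qed
qed

lemma backward_weight_measurable:
  assumes t: "t \<le> T" and l: "l \<in> {1..N}"
    and xi: "\<And>u l. t \<le> u \<Longrightarrow> u \<le> T \<Longrightarrow> l \<in> {1..N} \<Longrightarrow> bxi u l \<in> measurable F lam"
    and I: "\<And>u l. t \<le> u \<Longrightarrow> u < T \<Longrightarrow> l \<in> {1..N} \<Longrightarrow> bI u l \<in> measurable F (count_space {1..N})"
  shows "backward_weight T q g gam brho bth r bxi bI t l \<in> borel_measurable F"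
proof (cases "t = T")
  case True
  have "(\<lambda>w. bomegaT g gam brho T (bxi T l w)) \<in> borel_measurable F"
    by (rule measurable_compose[OF xi bomegaT_measurable]) (use t l in auto)
  also have "(\<lambda>w. bomegaT g gam brho T (bxi T l w))
    = backward_weight T q g gam brho bth r bxi bI t l"
    by (simp add: True backward_weight_def fun_eq_iff)
  finally show ?thesis .
next
  case False
  then have tT: "t < T" using t by simp
  have "(\<lambda>w. bomega q g gam bth r t (bxi t l w) (bxi (Suc t) (bI t l w) w)) \<in> borel_measurable F"
    by (rule measurable_ancestor[where W = "\<lambda>x' x. bomega q g gam bth r t x x'",
          OF bomega_measurable[OF tT] _ I]) (use tT l xi in auto)
  also have "(\<lambda>w. bomega q g gam bth r t (bxi t l w) (bxi (Suc t) (bI t l w) w))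
    = backward_weight T q g gam brho bth r bxi bI t l"
    using False by (simp add: backward_weight_def fun_eq_iff)
  finally show ?thesis .
qed

lemma backward_weight_finite:
  assumes t: "t \<le> T" and l: "l \<in> {1..N}" and w: "w \<in> space P"
    and sys: "backward_system P lam T N q g gam brho bth r bxi bI" and P: "prob_space P"
  shows "backward_weight T q g gam brho bth r bxi bI t l w < \<infinity>"
proof -
  have X: "bxi u k w \<in> space lam" if "u \<le> T" "k \<in> {1..N}" for u k
    by (rule measurable_space[OF backward_particles_measurable(1)[OF sys P that(2,1)] w])
  show ?thesis
  proof (cases "t = T")
    case True
    obtain c where c: "\<And>x. x \<in> space lam \<Longrightarrow> bomegaT g gam brho T x \<le> ennreal c"
      using ennreal_SUP_bound[OF bomegaT_bounded] by blast
    show ?thesis using c[OF X[OF t l]] True by (auto simp: backward_weight_def intro: le_less_trans)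
  next
    case False
    then have tT: "t < T" using t by simp
    obtain c where c: "\<And>z. z \<in> space lam \<times> space lam \<Longrightarrow>
        (case z of (x, x') \<Rightarrow> bomega q g gam bth r t x x') \<le> ennreal c"
      using ennreal_SUP_bound[OF bomega_bounded[OF tT]] by blast
    have "bI t l w \<in> {1..N}"
      using measurable_space[OF backward_particles_measurable(2)[OF sys P l tT] w] by simp
    then show ?thesis
      using c[of "(bxi t l w, bxi (Suc t) (bI t l w) w)"] X[of "Suc t"] X[OF t l] tT
      by (auto simp: backward_weight_def intro: le_less_trans)
  qed
qed

text \<open>The induction runs down from \<open>T\<close>, where the sample is i.i.d. with density
  \<open>brho\<close> and the likelihood reduces to the last \<open>g\<close>.\<close>

theorem backward_concentrates:
  assumes "t \<le> T"
  shows "\<exists>B>0. \<exists>C>0. \<forall>N\<ge>1. \<forall>(P :: 'w measure) bxi bI. prob_space P \<longrightarrow>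
    backward_system P lam T N q g gam brho bth r bxi bI \<longrightarrow>
    concentrates P lam N (backward_weight T q g gam brho bth r bxi bI t) (bxi t) (\<psi> t) B C"
  using assms
proof (induction rule: inc_induct)
  case base
  obtain c where c: "0 < c" "\<And>x. x \<in> space lam \<Longrightarrow> bomegaT g gam brho T x \<le> ennreal c"
    using ennreal_SUP_bound[OF bomegaT_bounded] by blast
  note f = finite_backward_measure[OF order_refl]
  \<comment> \<open>The proposal density cancels at every point because the weight is finite
    there.\<close>
  have \<mu>: "\<psi> T = density (density lam (\<lambda>x. ennreal (brho x))) (bomegaT g gam brho T)"
  proof -
    have bm: "(\<lambda>x. ennreal (brho x)) \<in> borel_measurable lam"
      using prob_density_measurable[OF brho] by simp
    have "density (density lam (\<lambda>x. ennreal (brho x))) (bomegaT g gam brho T)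
      = density lam (\<lambda>x. ennreal (brho x) * bomegaT g gam brho T x)"
      by (rule density_density_eq[OF bm bomegaT_measurable])
    also have "\<dots> = \<psi> T"
      unfolding backward_measure_def backward_likelihood_T
    proof (rule density_cong)
      show "(\<lambda>x. ennreal (brho x) * bomegaT g gam brho T x) \<in> borel_measurable lam"
        using bm bomegaT_measurable by simp
      show "(\<lambda>x. ennreal (gam T x) * ennreal (g T x)) \<in> borel_measurable lam"
        using gam_measurable[of T] g_measurable[of T] by simp
      show "AE x in lam. ennreal (brho x) * bomegaT g gam brho T x = ennreal (gam T x) * ennreal (g T x)"
      proof (rule AE_I2)
        fix x assume x: "x \<in> space lam"
        have "bomegaT g gam brho T x < \<infinity>" using c(2)[OF x] by (auto intro: le_less_trans)
        then have "bomegaT g gam brho T x * ennreal (brho x) = ennreal (g T x * gam T x)"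
          unfolding bomegaT_def by (intro ennreal_divide_mult_cancel) auto
        then show "ennreal (brho x) * bomegaT g gam brho T x = ennreal (gam T x) * ennreal (g T x)"
          using g_pos[of T x] gam_pos[of T x] x by (simp add: ennreal_mult mult.commute)
      qed
    qed
    finally show ?thesis by simp
  qed
  show ?case
  proof (rule exI[of _ 4], rule conjI[OF _ exI[of _ "(measure (\<psi> T) (space (\<psi> T)))\<^sup>2 / (8 * c\<^sup>2)"]],
      goal_cases pos conc)
    case pos
    show ?case by simp
  next
    case conc
    show ?case
    proof (intro conjI allI impI)
      show "0 < (measure (\<psi> T) (space (\<psi> T)))\<^sup>2 / (8 * c\<^sup>2)" using f(2) c by simp
      fix N :: nat and P :: "'w measure" and bxi bI
      assume N: "1 \<le> N" and P: "prob_space P"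
        and sys: "backward_system P lam T N q g gam brho bth r bxi bI"
      have "concentrates P lam N (\<lambda>l w. bomegaT g gam brho T (bxi T l w)) (bxi T) (\<psi> T) 4
          ((measure (\<psi> T) (space (\<psi> T)))\<^sup>2 / (8 * c\<^sup>2))"
        by (rule concentrates_iid[OF P N _ _ bomegaT_measurable c(2,1) f \<mu>])
           (use sys in \<open>auto simp: backward_system_def\<close>)
      then show "concentrates P lam N (backward_weight T q g gam brho bth r bxi bI T) (bxi T) (\<psi> T) 4
          ((measure (\<psi> T) (space (\<psi> T)))\<^sup>2 / (8 * c\<^sup>2))"
        by (simp add: concentrates_def weighted_mean_def backward_weight_def)
    qed
  qed
next
  case (step t)
  then have t: "t < T" and tT: "t \<le> T" and st: "Suc t \<le> T" by auto
  obtain B C where BC: "0 < B" "0 < C" and IH: "\<And>N (P :: 'w measure) bxi bI. 1 \<le> N \<Longrightarrow> prob_space P \<Longrightarrow>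
      backward_system P lam T N q g gam brho bth r bxi bI \<Longrightarrow>
      concentrates P lam N (backward_weight T q g gam brho bth r bxi bI (Suc t)) (bxi (Suc t))
        (\<psi> (Suc t)) B C"
    using step.IH by blast
  obtain c where c: "0 < c" and c': "\<And>z. z \<in> space lam \<times> space lam \<Longrightarrow>
      (case z of (x, x') \<Rightarrow> bomega q g gam bth r t x x') \<le> ennreal c"
    using ennreal_SUP_bound[OF bomega_bounded[OF t]] by blast
  \<comment> \<open>Backward selection uses the quotient by \<open>gam (Suc t)\<close>, so this
    quotient is what bounds the mass emitted by a particle.\<close>
  obtain A where A: "0 < A" "\<And>x. x \<in> space lam \<Longrightarrow> \<bar>bth t x / gam (Suc t) x\<bar> \<le> A"
    using sup_norm_bound[OF bth_bounded[OF t]] by blast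
  let ?m = "\<lambda>x' x. ennreal (bth t x' / gam (Suc t) x') * ennreal (r t x' x)"
  let ?W = "\<lambda>x' x. bomega q g gam bth r t x x'"
  note bth_measurable[OF t, measurable] gam_measurable[OF st, measurable]
  have [measurable]: "(\<lambda>(x', x). r t x' x) \<in> borel_measurable (lam \<Otimes>\<^sub>M lam)"
    using r[OF t] by (simp add: transition_density_def)
  have m: "(\<lambda>(x', x). ?m x' x) \<in> borel_measurable (lam \<Otimes>\<^sub>M lam)" by measurable
  have mA: "(\<integral>\<^sup>+x. ?m x' x \<partial>lam) \<le> ennreal A" if x': "x' \<in> space lam" for x'
  proof -
    have rx: "prob_density lam (r t x')" using r[OF t] x' by (simp add: transition_density_def)
    have "(\<integral>\<^sup>+x. ?m x' x \<partial>lam)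
      = ennreal (bth t x' / gam (Suc t) x') * (\<integral>\<^sup>+x. ennreal (r t x' x) \<partial>lam)"
      by (rule nn_integral_cmult) (use prob_density_measurable[OF rx] in simp)
    also have "\<dots> = ennreal (bth t x' / gam (Suc t) x')" using rx by (simp add: prob_density_def)
    also have "\<dots> \<le> ennreal A" by (rule ennreal_leI, rule order_trans[OF abs_ge_self A(2)[OF x']])
    finally show ?thesis .
  qed
  let ?\<beta> = "measure (\<psi> t) (space (\<psi> t)) / measure (\<psi> (Suc t)) (space (\<psi> (Suc t)))"
  let ?C = "min 2 C / (4 * A\<^sup>2 * c\<^sup>2) * ?\<beta>\<^sup>2 / 16"
  note f = finite_backward_measure[OF st] finite_backward_measure[OF tT]
  show ?case
  proof (rule exI[of _ "2 * (2 + B)"], rule conjI[OF _ exI[of _ ?C]], goal_cases pos conc)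
    case pos
    show ?case using BC by simp
  next
    case conc
    show ?case
    proof (intro conjI allI impI)
      have "0 < ?\<beta>" using f by simp
      then have "0 < ?\<beta>\<^sup>2" by (rule zero_less_power)
      then show "0 < ?C" using BC A(1) c by (intro divide_pos_pos mult_pos_pos) auto
      fix N :: nat and P :: "'w measure" and bxi bI
      assume N: "1 \<le> N" and P: "prob_space P"
        and sys: "backward_system P lam T N q g gam brho bth r bxi bI"
      \<comment> \<open>No index exists at time \<open>T\<close>. If \<open>Suc t\<close> is below
        \<open>T\<close>, its index belongs to the past, as the weight at \<open>Suc t\<close>
        depends on it.\<close>
      let ?F = "particle_algebra P lam N {t<..T} {t<..<T} bxi bI"
      let ?v = "backward_weight T q g gam brho bth r bxi bI (Suc t)"
      note pm = backward_particles_measurable[OF sys P]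
      have sub: "subalgebra P ?F"
        by (rule subalgebra_particle_algebra[where S = "{1..N}"]) (use pm in auto)
      have xiF: "bxi u l \<in> measurable ?F lam" if "Suc t \<le> u" "u \<le> T" "l \<in> {1..N}" for u l
        by (rule particle_measurable) (use that measurable_space[OF pm(1)] in auto)
      have IF: "bI u l \<in> measurable ?F (count_space {1..N})"
        if "Suc t \<le> u" "u < T" "l \<in> {1..N}" for u l
        by (rule index_measurable) (use that measurable_space[OF pm(2)] in auto)
      have proposal: "backward_proposal lam T N q g gam brho bth r bxi bI t w
        = density (count_space {1..N} \<Otimes>\<^sub>M lam) (\<lambda>(i, x). ?v i w * ?m (bxi (Suc t) i w) x)" for w
        by (simp add: backward_proposal_def mult.assoc)
      have selection: "AE w in P. 0 < emeasure (backward_proposal lam T N q g gam brho bth r bxi bI t w)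
          ({1..N} \<times> space lam)"
        "cond_iid P ?F N (count_space {1..N} \<Otimes>\<^sub>M lam) (\<lambda>l w. (bI t l w, bxi t l w))
          (\<lambda>w. prob_normalize (backward_proposal lam T N q g gam brho bth r bxi bI t w))"
        using sys t unfolding backward_system_def by blast+
      have "concentrates P lam N (\<lambda>l w. ?W (bxi (Suc t) (bI t l w) w) (bxi t l w)) (bxi t)
          (\<psi> t) (2 * (2 + B)) ?C"
      proof (rule concentrates_step[OF P sigma_finite sub N xiF _ _ m mA A(1) bomega_measurable[OF t] _ c
            f(1,2) sets_backward_measure f(3,4) sets_backward_measure
            nn_integral_backward_measure[OF t] selection[unfolded proposal]])
        show "?v l \<in> borel_measurable ?F" if "l \<in> {1..N}" for l
          by (rule backward_weight_measurable[OF st that xiF IF])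
        show "?v l w < \<infinity>" if "l \<in> {1..N}" "w \<in> space P" for l w
          by (rule backward_weight_finite[OF st that sys P])
        show "?W x' x \<le> ennreal c" if "x' \<in> space lam" "x \<in> space lam" for x x'
          using c'[of "(x, x')"] that by simp
        show "concentrates P lam N ?v (bxi (Suc t)) (\<psi> (Suc t)) B C" by (rule IH[OF N P sys])
      qed (use st in auto)
      then show "concentrates P lam N (backward_weight T q g gam brho bth r bxi bI t) (bxi t)
          (\<psi> t) (2 * (2 + B)) ?C"
        using t by (simp add: concentrates_def weighted_mean_def backward_weight_def)
    qed
  qed
qed

end

section \<open>Two independent particle systems\<close>

text \<open>Viewed as maps into the two restricted spaces, two copies of the identity are
  independent random variables, so the diagonal map carries \<open>P\<close> to the product measure.
  This decouples whole outcomes without introducing laws on particle spaces.\<close>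

lemma distr_diagonal_indep_subalgebras:
  assumes P: "prob_space P" and F: "subalgebra P F" and G: "subalgebra P G"
    and indep: "prob_space.indep_set P (sets F) (sets G)"
  shows "distr P (restr_to_subalg P F \<Otimes>\<^sub>M restr_to_subalg P G) (\<lambda>w. (w, w))
    = restr_to_subalg P F \<Otimes>\<^sub>M restr_to_subalg P G"
proof -
  interpret P: prob_space P by (rule P)
  have idm: "(\<lambda>w. w) \<in> measurable P (restr_to_subalg P H)" if "subalgebra P H" for H
    using measurable_from_subalg[OF that, of "\<lambda>w. w" H] sets_restr_to_subalg[OF that]
    by (simp cong: measurable_cong_sets)
  have d: "distr P (restr_to_subalg P H) (\<lambda>w. w) = restr_to_subalg P H" if H: "subalgebra P H" for H
  proof (rule measure_eqI)
    fix A assume "A \<in> sets (distr P (restr_to_subalg P H) (\<lambda>w. w))"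
    then have A: "A \<in> sets H" "A \<in> sets (restr_to_subalg P H)" by (simp_all add: sets_restr_to_subalg[OF H])
    have "A \<subseteq> space P" using sets.sets_into_space[OF A(1)] H by (simp add: subalgebra_def)
    then show "emeasure (distr P (restr_to_subalg P H) (\<lambda>w. w)) A = emeasure (restr_to_subalg P H) A"
      using emeasure_distr[OF idm[OF H] A(2)] emeasure_restr_to_subalg[OF H A(1)]
      by (simp add: Int_absorb2)
  qed simp
  have s: "sigma_sets (space P) {(\<lambda>w. w) -` A \<inter> space P |A. A \<in> sets (restr_to_subalg P H)} = sets H"
    if H: "subalgebra P H" for H
  proof -
    have "A \<inter> space P = A" if "A \<in> sets H" for A
      using sets.sets_into_space[OF that] H by (auto simp: subalgebra_def)
    then have "{(\<lambda>w. w) -` A \<inter> space P |A. A \<in> sets (restr_to_subalg P H)} = sets H"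
      by (auto simp: sets_restr_to_subalg[OF H])
    then show ?thesis using sets.sigma_sets_eq[of H] H by (simp add: subalgebra_def)
  qed
  have "P.indep_var (restr_to_subalg P F) (\<lambda>w. w) (restr_to_subalg P G) (\<lambda>w. w)"
    unfolding P.indep_var_eq using s[OF F] s[OF G] idm[OF F] idm[OF G] indep by simp
  then show ?thesis
    unfolding P.indep_var_distribution_eq using d[OF F] d[OF G] by simp
qed

text \<open>Identifies the centre of the backward deviation when the forward particles are frozen:
  it is the forward estimator of the integrated test function.\<close>

lemma normalized_mean_weighted_mean:
  fixes h :: "'a \<Rightarrow> 'b \<Rightarrow> real"
  assumes "\<And>l. l \<in> {1..N} \<Longrightarrow> integrable \<nu> (h (xi l w))"
  shows "normalized_mean \<nu> (\<lambda>y. weighted_mean N v xi (\<lambda>x. h x y) w)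
    = weighted_mean N v xi (\<lambda>x. normalized_mean \<nu> (h x)) w"
proof -
  let ?d = "\<Sum>l\<in>{1..N}. enn2real (v l w)"
  have "(\<integral>y. weighted_mean N v xi (\<lambda>x. h x y) w \<partial>\<nu>)
    = (\<integral>y. (\<Sum>l\<in>{1..N}. enn2real (v l w) * h (xi l w) y) \<partial>\<nu>) / ?d"
    unfolding weighted_mean_def by simp
  also have "(\<integral>y. (\<Sum>l\<in>{1..N}. enn2real (v l w) * h (xi l w) y) \<partial>\<nu>)
    = (\<Sum>l\<in>{1..N}. enn2real (v l w) * (\<integral>y. h (xi l w) y \<partial>\<nu>))"
    using assms by (subst Bochner_Integration.integral_sum) auto
  finally show ?thesis
    unfolding normalized_mean_def weighted_mean_def by (simp add: sum_divide_distrib mult_ac)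
qed

lemma weighted_mean_swap:
  "weighted_mean N v xi (\<lambda>x. weighted_mean N v' xi' (h x) w) w
    = weighted_mean N v' xi' (\<lambda>y. weighted_mean N v xi (\<lambda>x. h x y) w) w"
proof -
  let ?d = "\<Sum>l\<in>{1..N}. enn2real (v l w)" and ?d' = "\<Sum>l\<in>{1..N}. enn2real (v' l w)"
  have "weighted_mean N v xi (\<lambda>x. weighted_mean N v' xi' (h x) w) w
    = (\<Sum>i\<in>{1..N}. \<Sum>j\<in>{1..N}. enn2real (v i w) * enn2real (v' j w) * h (xi i w) (xi' j w)) / (?d * ?d')"
    unfolding weighted_mean_def
    by (simp add: sum_distrib_left sum_divide_distrib mult_ac)
  also have "\<dots> = (\<Sum>j\<in>{1..N}. \<Sum>i\<in>{1..N}. enn2real (v i w) * enn2real (v' j w) * h (xi i w) (xi' j w)) / (?d * ?d')"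
    by (subst sum.swap) simp
  also have "\<dots> = weighted_mean N v' xi' (\<lambda>y. weighted_mean N v xi (\<lambda>x. h x y) w) w"
    unfolding weighted_mean_def
    by (simp add: sum_distrib_left sum_divide_distrib mult_ac)
  finally show ?thesis .
qed

lemma concentrates_product:
  fixes h :: "'a \<Rightarrow> 'a \<Rightarrow> real"
  assumes P: "prob_space P" and F: "subalgebra P F" and G: "subalgebra P G"
    and indep: "prob_space.indep_set P (sets F) (sets G)"
    and v: "\<And>l. l \<in> {1..N} \<Longrightarrow> v l \<in> borel_measurable F"
    and xi: "\<And>l. l \<in> {1..N} \<Longrightarrow> xi l \<in> measurable F lam"
    and v': "\<And>l. l \<in> {1..N} \<Longrightarrow> v' l \<in> borel_measurable G"
    and xi': "\<And>l. l \<in> {1..N} \<Longrightarrow> xi' l \<in> measurable G lam"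
    and \<nu>: "finite_measure \<nu>" "0 < measure \<nu> (space \<nu>)" "sets \<nu> = sets lam"
    and c: "concentrates P lam N v xi \<mu> B C" and c': "concentrates P lam N v' xi' \<nu> B' C'"
    and h: "(\<lambda>(x, y). h x y) \<in> borel_measurable (lam \<Otimes>\<^sub>M lam)"
    and hM: "\<And>x y. x \<in> space lam \<Longrightarrow> y \<in> space lam \<Longrightarrow> 0 \<le> h x y \<and> h x y \<le> M"
    and M: "0 < M" and \<epsilon>: "0 < \<epsilon>"
  shows "measure P {w \<in> space P. \<bar>weighted_mean N v xi (\<lambda>x. weighted_mean N v' xi' (h x) w) w
      - normalized_mean \<mu> (\<lambda>x. normalized_mean \<nu> (h x))\<bar> > \<epsilon>}
    \<le> B * exp (- (C * real N * (\<epsilon> / 2)\<^sup>2 / M\<^sup>2)) + B' * exp (- (C' * real N * (\<epsilon> / 2)\<^sup>2 / M\<^sup>2))"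
proof -
  interpret P: prob_space P by (rule P)
  interpret \<nu>: finite_measure \<nu> by (rule \<nu>)
  let ?F = "restr_to_subalg P F" and ?G = "restr_to_subalg P G"
  interpret RF: prob_space ?F by (rule prob_space_restr_to_subalg[OF F P])
  interpret RG: prob_space ?G by (rule prob_space_restr_to_subalg[OF G P])
  have sp: "space F = space P" "space G = space P" "space \<nu> = space lam"
    using F G sets_eq_imp_space_eq[OF \<nu>(3)] by (auto simp: subalgebra_def)
  have xiX: "xi l w \<in> space lam" if "l \<in> {1..N}" "w \<in> space P" for l w
    using measurable_space[OF xi[OF that(1)]] that(2) by (simp add: sp)
  have vF: "v l \<in> borel_measurable ?F" and xiF: "xi l \<in> measurable ?F lam" if "l \<in> {1..N}" for l
    using measurable_in_subalg[OF F] v[OF that] xi[OF that] by blast+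
  have vG: "v' l \<in> borel_measurable ?G" and xiG: "xi' l \<in> measurable ?G lam" if "l \<in> {1..N}" for l
    using measurable_in_subalg[OF G] v'[OF that] xi'[OF that] by blast+
  have hx: "h x \<in> borel_measurable lam" if "x \<in> space lam" for x
    using measurable_Pair2[OF h that] by simp
  define f where "f x = normalized_mean \<nu> (h x)" for x
  have fm: "f \<in> borel_measurable lam"
  proof -
    have "(\<lambda>(x, y). h x y) \<in> borel_measurable (lam \<Otimes>\<^sub>M \<nu>)"
      using h \<nu>(3) by (simp cong: measurable_cong_sets sets_pair_measure_cong
          add: measurable_cong_sets[OF sets_pair_measure_cong[OF refl \<nu>(3)] refl])
    from \<nu>.borel_measurable_lebesgue_integral[OF this] show ?thesis
      unfolding f_def[abs_def] normalized_mean_def by simp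
  qed
  have h\<nu>: "h x \<in> borel_measurable \<nu>" if "x \<in> space lam" for x
    using hx[OF that] \<nu>(3) by (simp cong: measurable_cong_sets)
  have hint: "integrable \<nu> (h x)" if "x \<in> space lam" for x
    by (rule \<nu>.integrable_const_bound[where B = M]) (use h\<nu>[OF that] hM[OF that] sp in auto)
  have fM: "0 \<le> f x \<and> f x \<le> M" if "x \<in> space lam" for x
    using normalized_mean_bounds[OF \<nu>(1,2) h\<nu>[OF that], of M] hM[OF that] sp
    by (simp add: f_def)
  define k where "k w y = weighted_mean N v xi (\<lambda>x. h x y) w" for w y
  have km: "k w \<in> borel_measurable lam" if "w \<in> space P" for w
  proof -
    have [measurable]: "h (xi l w) \<in> borel_measurable lam" if "l \<in> {1..N}" for l
      by (rule hx[OF xiX[OF that \<open>w \<in> space P\<close>]])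
    show ?thesis unfolding k_def[abs_def] weighted_mean_def by measurable
  qed
  have kM: "0 \<le> k w y \<and> k w y \<le> M" if "w \<in> space P" "y \<in> space lam" for w y
    unfolding k_def using weighted_mean_bounds[of N "\<lambda>x. h x y" xi w M v] xiX that hM M by auto
  have kf: "normalized_mean \<nu> (k w) = weighted_mean N v xi f w" if "w \<in> space P" for w
    unfolding k_def f_def by (rule normalized_mean_weighted_mean) (rule hint[OF xiX[OF _ that]])
  have half: "0 < \<epsilon> / 2" using \<epsilon> by simp
  let ?D = "\<lambda>w w'. \<bar>weighted_mean N v' xi' (k w) w' - weighted_mean N v xi f w\<bar> > \<epsilon> / 2"
  let ?E = "{x \<in> space (?F \<Otimes>\<^sub>M ?G). ?D (fst x) (snd x)}"
  let ?E1 = "{w \<in> space P. ?D w w}"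
  let ?E2 = "{w \<in> space P. \<bar>weighted_mean N v xi f w - normalized_mean \<mu> f\<bar> > \<epsilon> / 2}"
  let ?b = "B' * exp (- (C' * real N * (\<epsilon> / 2)\<^sup>2 / M\<^sup>2))"
  have wF: "weighted_mean N v xi f \<in> borel_measurable ?F"
    by (rule weighted_mean_measurable[OF vF xiF fm])
  have E: "?E \<in> sets (?F \<Otimes>\<^sub>M ?G)"
  proof -
    have hij: "(\<lambda>x. h (xi i (fst x)) (xi' j (snd x))) \<in> borel_measurable (?F \<Otimes>\<^sub>M ?G)"
      if "i \<in> {1..N}" "j \<in> {1..N}" for i j
      using measurable_compose[OF measurable_Pair[OF measurable_compose[OF measurable_fst xiF[OF that(1)]]
            measurable_compose[OF measurable_snd xiG[OF that(2)]]] h] by simp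
    note vF[measurable] vG[measurable] hij[measurable] wF[measurable]
    have 1: "(\<lambda>x. weighted_mean N v' xi' (k (fst x)) (snd x)) \<in> borel_measurable (?F \<Otimes>\<^sub>M ?G)"
      unfolding k_def weighted_mean_def by measurable
    have 2: "(\<lambda>x. weighted_mean N v xi f (fst x)) \<in> borel_measurable (?F \<Otimes>\<^sub>M ?G)"
      by (rule measurable_compose[OF measurable_fst wF])
    show ?thesis using 1 2 by measurable
  qed
  have diag: "(\<lambda>w. (w, w)) \<in> measurable P (?F \<Otimes>\<^sub>M ?G)"
  proof (rule measurable_Pair)
    show "(\<lambda>w. w) \<in> measurable P ?F" "(\<lambda>w. w) \<in> measurable P ?G"
      using measurable_from_subalg[OF F, of "\<lambda>w. w" F] measurable_from_subalg[OF G, of "\<lambda>w. w" G]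
      by (simp_all cong: measurable_cong_sets add: sets_restr_to_subalg[OF F] sets_restr_to_subalg[OF G])
  qed
  have E1eq: "?E1 = (\<lambda>w. (w, w)) -` ?E \<inter> space P"
    by (auto simp: space_pair_measure space_restr_to_subalg)
  have E1: "?E1 \<in> sets P" unfolding E1eq by (rule measurable_sets[OF diag E])
  have E2: "?E2 \<in> sets P"
  proof -
    have "weighted_mean N v xi f \<in> borel_measurable P"
      using measurable_from_subalg[OF F measurable_in_subalg'[OF F wF]] .
    then show ?thesis by measurable
  qed
  have "emeasure P ?E1 = emeasure (?F \<Otimes>\<^sub>M ?G) ?E"
    unfolding E1eq emeasure_distr[OF diag E, symmetric]
    by (simp only: distr_diagonal_indep_subalgebras[OF P F G indep])
  also have "\<dots> = (\<integral>\<^sup>+w. emeasure ?G (Pair w -` ?E) \<partial>?F)"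
    by (rule RG.emeasure_pair_measure_alt[OF E])
  also have "\<dots> \<le> (\<integral>\<^sup>+w. ennreal ?b \<partial>?F)"
  proof (rule nn_integral_mono)
    fix w assume "w \<in> space ?F"
    then have w: "w \<in> space P" by (simp add: space_restr_to_subalg)
    have eq: "Pair w -` ?E = {w' \<in> space P. ?D w w'}"
      using w by (auto simp: space_pair_measure space_restr_to_subalg)
    \<comment> \<open>The slice lies in \<open>G\<close>, so its restricted measure is its
      probability under \<open>P\<close>, to which the backward bound applies.\<close>
    have "{w' \<in> space P. ?D w w'} \<in> sets G"
      using sets_Pair1[OF E, of w] unfolding eq sets_restr_to_subalg[OF G] .
    then have "emeasure ?G (Pair w -` ?E) = emeasure P {w' \<in> space P. ?D w w'}"
      unfolding eq by (rule emeasure_restr_to_subalg[OF G])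
    also have "\<dots> \<le> ennreal ?b"
      unfolding P.emeasure_eq_measure kf[OF w, symmetric]
      by (rule ennreal_leI, rule concentratesD[OF c' M half km[OF w] kM[OF w]])
    finally show "emeasure ?G (Pair w -` ?E) \<le> ennreal ?b" .
  qed
  also have "\<dots> = ennreal ?b" by (simp add: RF.emeasure_space_1)
  finally have "ennreal (measure P ?E1) \<le> ennreal ?b" by (simp only: P.emeasure_eq_measure)
  \<comment> \<open>\<open>ennreal\<close> truncates negative numbers, so the comparison descends to
    the reals only for a nonnegative bound. The zero function shows that it is one.\<close>
  moreover have "0 \<le> ?b"
  proof -
    have "0 \<le> measure P {w \<in> space P. \<bar>weighted_mean N v' xi' (\<lambda>_. 0) w
        - normalized_mean \<nu> (\<lambda>_. 0)\<bar> > \<epsilon> / 2}" by (rule measure_nonneg)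
    also have "\<dots> \<le> ?b" by (rule concentratesD[OF c' M half]) (use M in simp_all)
    finally show ?thesis .
  qed
  ultimately have b1: "measure P ?E1 \<le> ?b" using ennreal_le_iff by blast
  have b2: "measure P ?E2 \<le> B * exp (- (C * real N * (\<epsilon> / 2)\<^sup>2 / M\<^sup>2))"
    by (rule concentratesD[OF c M half fm fM])
  have "measure P {w \<in> space P. \<bar>weighted_mean N v xi (\<lambda>x. weighted_mean N v' xi' (h x) w) w
      - normalized_mean \<mu> f\<bar> > \<epsilon>} \<le> measure P (?E1 \<union> ?E2)"
  proof (rule P.finite_measure_mono)
    show "{w \<in> space P. \<bar>weighted_mean N v xi (\<lambda>x. weighted_mean N v' xi' (h x) w) w
      - normalized_mean \<mu> f\<bar> > \<epsilon>} \<subseteq> ?E1 \<union> ?E2"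
    proof
      fix w assume "w \<in> {w \<in> space P. \<bar>weighted_mean N v xi (\<lambda>x. weighted_mean N v' xi' (h x) w) w
        - normalized_mean \<mu> f\<bar> > \<epsilon>}"
      then have w: "w \<in> space P" and d: "\<bar>weighted_mean N v' xi' (k w) w - normalized_mean \<mu> f\<bar> > \<epsilon>"
        by (auto simp: weighted_mean_swap[of N v xi v' xi' h w] k_def[abs_def])
      from d have "\<bar>weighted_mean N v' xi' (k w) w - weighted_mean N v xi f w\<bar> > \<epsilon> / 2
          \<or> \<bar>weighted_mean N v xi f w - normalized_mean \<mu> f\<bar> > \<epsilon> / 2"
        by linarith
      then show "w \<in> ?E1 \<union> ?E2" using w by auto
    qed
  qed (use E1 E2 in auto)
  also have "\<dots> \<le> measure P ?E1 + measure P ?E2" using E1 E2 by (rule measure_Un_le)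
  also have "\<dots> \<le> B * exp (- (C * real N * (\<epsilon> / 2)\<^sup>2 / M\<^sup>2)) + ?b"
    using b1 b2 by simp
  finally show ?thesis unfolding f_def .
qed

section \<open>Normalization, oscillation, and the product estimator\<close>

lemma integral_prob_normalize:
  assumes \<mu>: "finite_measure \<mu>" "0 < measure \<mu> (space \<mu>)" and f: "f \<in> borel_measurable \<mu>"
  shows "(\<integral>x. f x \<partial>prob_normalize \<mu>) = normalized_mean \<mu> f"
proof -
  interpret finite_measure \<mu> by (rule \<mu>)
  let ?c = "1 / measure \<mu> (space \<mu>)"
  have r: "1 / emeasure \<mu> (space \<mu>) = ennreal ?c"
    using \<mu>(2) divide_ennreal[of 1 "measure \<mu> (space \<mu>)"] by (simp add: emeasure_eq_measure)
  have "prob_normalize \<mu> = density \<mu> (\<lambda>_. ennreal ?c)"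
    unfolding prob_normalize_def r
    by (rule measure_eqI) (simp_all add: emeasure_density_const)
  then show ?thesis
    using f by (simp add: integral_density normalized_mean_def)
qed

text \<open>For fixed \<open>z\<close>, the number \<open>h z - osc A h\<close> lies below every
  value of \<open>h\<close> on \<open>A\<close>, hence below the infimum. Boundedness and
  nonemptiness keep the real supremum and infimum meaningful.\<close>

lemma osc_shift:
  assumes ne: "A \<noteq> {}" and b: "bounded (h ` A)"
  shows "z \<in> A \<Longrightarrow> 0 \<le> h z - (INF z\<in>A. h z) \<and> h z - (INF z\<in>A. h z) \<le> osc A h"
    and "0 \<le> osc A h"
proof -
  obtain K where K: "\<And>z. z \<in> A \<Longrightarrow> \<bar>h z\<bar> \<le> K" using b by (auto simp: bounded_iff)
  have bdd: "bdd_above ((\<lambda>(z, z'). \<bar>h z - h z'\<bar>) ` (A \<times> A))"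
  proof (rule bdd_aboveI)
    fix x assume "x \<in> (\<lambda>(z, z'). \<bar>h z - h z'\<bar>) ` (A \<times> A)"
    then obtain z z' where "x = \<bar>h z - h z'\<bar>" "z \<in> A" "z' \<in> A" by auto
    then show "x \<le> 2 * K" using K[of z] K[of z'] by linarith
  qed
  have osc: "\<bar>h z - h z'\<bar> \<le> osc A h" if "z \<in> A" "z' \<in> A" for z z'
    unfolding osc_def using cSUP_upper[OF _ bdd, of "(z, z')"] that by simp
  have below: "bdd_below (h ` A)"
    by (rule bdd_belowI[of _ "- K"]) (use K in \<open>auto simp: abs_le_iff minus_le_iff\<close>)
  show "0 \<le> osc A h" using osc order_trans[OF abs_ge_zero] ne by blast
  assume z: "z \<in> A"
  have "h z - osc A h \<le> (INF z\<in>A. h z)"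
    by (rule cINF_greatest[OF ne]) (use osc[OF z] in \<open>simp add: abs_le_iff diff_le_eq add.commute\<close>)
  then show "0 \<le> h z - (INF z\<in>A. h z) \<and> h z - (INF z\<in>A. h z) \<le> osc A h"
    using cINF_lower[OF below z] by simp
qed

text \<open>Subtracting the infimum moves estimator and limit by the same constant: the normalized
  weights sum to 1 almost surely, and the limit is an integral against a probability.\<close>

lemma product_estimator_deviation:
  fixes h :: "'a \<times> 'a \<Rightarrow> real"
  assumes P: "prob_space P" and F: "subalgebra P F" and G: "subalgebra P G"
    and indep: "prob_space.indep_set P (sets F) (sets G)"
    and v: "\<And>l. l \<in> {1..N} \<Longrightarrow> v l \<in> borel_measurable F"
      "\<And>l w. l \<in> {1..N} \<Longrightarrow> w \<in> space P \<Longrightarrow> v l w < \<infinity>"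
      "AE w in P. 0 < (\<Sum>l\<in>{1..N}. v l w)"
    and xi: "\<And>l. l \<in> {1..N} \<Longrightarrow> xi l \<in> measurable F lam"
    and v': "\<And>l. l \<in> {1..N} \<Longrightarrow> v' l \<in> borel_measurable G"
      "\<And>l w. l \<in> {1..N} \<Longrightarrow> w \<in> space P \<Longrightarrow> v' l w < \<infinity>"
      "AE w in P. 0 < (\<Sum>l\<in>{1..N}. v' l w)"
    and xi': "\<And>l. l \<in> {1..N} \<Longrightarrow> xi' l \<in> measurable G lam"
    and \<mu>: "finite_measure \<mu>" "0 < measure \<mu> (space \<mu>)" "sets \<mu> = sets lam"
    and \<nu>: "finite_measure \<nu>" "0 < measure \<nu> (space \<nu>)" "sets \<nu> = sets lam"
    and c: "concentrates P lam N v xi \<mu> B C" and c': "concentrates P lam N v' xi' \<nu> B' C'"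
    and BB: "0 \<le> B" "0 \<le> B'"
    and h: "h \<in> borel_measurable (lam \<Otimes>\<^sub>M lam)" "bounded (h ` (space lam \<times> space lam))"
    and ne: "space lam \<noteq> {}" and \<epsilon>: "0 < \<epsilon>"
  shows "measure P {w \<in> space P.
      \<bar>(\<Sum>i\<in>{1..N}. \<Sum>j\<in>{1..N}. enn2real (v i w / (\<Sum>l\<in>{1..N}. v l w))
          * enn2real (v' j w / (\<Sum>l\<in>{1..N}. v' l w)) * h (xi i w, xi' j w))
        - (\<integral>z. h z \<partial>(prob_normalize \<mu> \<Otimes>\<^sub>M prob_normalize \<nu>))\<bar> > \<epsilon>}
    \<le> (if osc (space lam \<times> space lam) h = 0 then 0
        else (B + B') * exp (- (min C C' / 4 * real N * \<epsilon>\<^sup>2 / (osc (space lam \<times> space lam) h)\<^sup>2)))"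
    (is "measure P {w \<in> space P. \<bar>?est w - ?lim\<bar> > \<epsilon>} \<le> _")
proof -
  interpret P: prob_space P by (rule P)
  let ?X = "space lam"
  define M where "M = osc (?X \<times> ?X) h"
  define a where "a = (INF z\<in>?X \<times> ?X. h z)"
  define k where "k x y = h (x, y) - a" for x y
  have XX: "?X \<times> ?X \<noteq> {}" using ne by simp
  have M0: "0 \<le> M" unfolding M_def by (rule osc_shift(2)[OF XX h(2)])
  have kM: "0 \<le> k x y \<and> k x y \<le> M" if "x \<in> ?X" "y \<in> ?X" for x y
    unfolding k_def a_def M_def using osc_shift(1)[OF XX h(2), of "(x, y)"] that by simp
  have km: "(\<lambda>(x, y). k x y) \<in> borel_measurable (lam \<Otimes>\<^sub>M lam)"
    unfolding k_def using h(1) by (simp add: case_prod_eta[symmetric] split_beta')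
  have sp: "space \<mu> = ?X" "space \<nu> = ?X" using \<mu>(3) \<nu>(3) by (auto dest: sets_eq_imp_space_eq)
  interpret \<mu>: finite_measure \<mu> by (rule \<mu>)
  interpret \<nu>: finite_measure \<nu> by (rule \<nu>)
  have vP: "v l \<in> borel_measurable P" and xiP: "xi l \<in> measurable P lam"
    and vP': "v' l \<in> borel_measurable P" and xiP': "xi' l \<in> measurable P lam" if "l \<in> {1..N}" for l
    using that v(1) xi v'(1) xi' measurable_from_subalg[OF F] measurable_from_subalg[OF G] by blast+
  have xiX: "xi l w \<in> ?X" "xi' l w \<in> ?X" if "l \<in> {1..N}" "w \<in> space P" for l w
    using measurable_space[OF xiP[OF that(1)] that(2)] measurable_space[OF xiP'[OF that(1)] that(2)]
    by auto
  define R where "R w = weighted_mean N v xi (\<lambda>x. weighted_mean N v' xi' (k x) w) w" for w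
  define L where "L = normalized_mean \<mu> (\<lambda>x. normalized_mean \<nu> (k x))"
  have Rm: "R \<in> borel_measurable P"
  proof -
    have hij: "(\<lambda>w. k (xi i w) (xi' j w)) \<in> borel_measurable P" if "i \<in> {1..N}" "j \<in> {1..N}" for i j
      using measurable_compose[OF measurable_Pair[OF xiP[OF that(1)] xiP'[OF that(2)]] km] by simp
    note vP[measurable] vP'[measurable] hij[measurable]
    show ?thesis unfolding R_def[abs_def] weighted_mean_def by measurable
  qed
  \<comment> \<open>Positive weight sums are essential: with a zero sum all normalized weights would
    be 0 and the constant \<open>a\<close> would be lost.\<close>
  have est: "?est w = R w + a" if w: "w \<in> space P" and pos: "0 < (\<Sum>l\<in>{1..N}. v l w)" "0 < (\<Sum>l\<in>{1..N}. v' l w)" for w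
  proof -
    define s where "s = (\<Sum>l\<in>{1..N}. enn2real (v l w))"
    define s' where "s' = (\<Sum>l\<in>{1..N}. enn2real (v' l w))"
    have s: "enn2real (\<Sum>l\<in>{1..N}. v l w) = s" "enn2real (\<Sum>l\<in>{1..N}. v' l w) = s'"
      unfolding s_def s'_def by (subst enn2real_sum; use v(2) v'(2) w in auto)+
    have "(\<Sum>l\<in>{1..N}. v l w) < \<infinity>" "(\<Sum>l\<in>{1..N}. v' l w) < \<infinity>"
      using v(2) v'(2) w by auto
    then have s0: "0 < s" "0 < s'"
      unfolding s[symmetric] enn2real_positive_iff using pos by auto
    have "?est w = (\<Sum>i\<in>{1..N}. \<Sum>j\<in>{1..N}. enn2real (v i w) / s * (enn2real (v' j w) / s') * (k (xi i w) (xi' j w) + a))"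
      by (simp only: enn2real_divide s k_def diff_add_cancel)
    also have "\<dots> = (\<Sum>i\<in>{1..N}. \<Sum>j\<in>{1..N}. enn2real (v i w) / s * (enn2real (v' j w) / s') * k (xi i w) (xi' j w))
        + (\<Sum>i\<in>{1..N}. \<Sum>j\<in>{1..N}. enn2real (v i w) / s * (enn2real (v' j w) / s')) * a"
      by (simp only: distrib_left sum.distrib sum_distrib_right)
    also have "(\<Sum>i\<in>{1..N}. \<Sum>j\<in>{1..N}. enn2real (v i w) / s * (enn2real (v' j w) / s')) = 1"
    proof -
      have "(\<Sum>i\<in>{1..N}. \<Sum>j\<in>{1..N}. enn2real (v i w) / s * (enn2real (v' j w) / s'))
        = (s / s) * (s' / s')"
        unfolding sum_product[symmetric] sum_divide_distrib[symmetric] s_def s'_def ..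
      then show ?thesis using s0 by simp
    qed
    also have "(\<Sum>i\<in>{1..N}. \<Sum>j\<in>{1..N}. enn2real (v i w) / s * (enn2real (v' j w) / s') * k (xi i w) (xi' j w)) = R w"
      unfolding R_def weighted_mean_def s_def[symmetric] s'_def[symmetric]
      by (simp add: sum_distrib_left sum_divide_distrib mult_ac)
    finally show ?thesis by simp
  qed
  have pm: "prob_space (prob_normalize \<mu>)" "prob_space (prob_normalize \<nu>)"
    using \<mu>(2) \<nu>(2) \<mu>.emeasure_eq_measure \<nu>.emeasure_eq_measure
    by (auto intro!: prob_space_prob_normalize)
  have sets_pn: "sets (prob_normalize \<mu>) = sets lam" "sets (prob_normalize \<nu>) = sets lam"
    using \<mu>(3) \<nu>(3) by (simp_all add: prob_normalize_def)
  have sp_pn: "space (prob_normalize \<mu>) = ?X" "space (prob_normalize \<nu>) = ?X"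
    using sets_pn by (auto dest: sets_eq_imp_space_eq)
  have lim: "?lim = L + a"
  proof -
    interpret pm: prob_space "prob_normalize \<mu>" by (rule pm)
    interpret pn: prob_space "prob_normalize \<nu>" by (rule pm)
    interpret pp: pair_prob_space "prob_normalize \<mu>" "prob_normalize \<nu>" ..
    let ?Q = "prob_normalize \<mu> \<Otimes>\<^sub>M prob_normalize \<nu>"
    have kQ: "(\<lambda>(x, y). k x y) \<in> borel_measurable ?Q"
      using km measurable_cong_sets[OF sets_pair_measure_cong[OF sets_pn] refl] by blast
    have int: "integrable ?Q (\<lambda>(x, y). k x y)"
      by (rule pp.P.integrable_const_bound[where B = M, OF _ kQ])
         (use kM in \<open>auto simp: space_pair_measure sp_pn\<close>)
    have k\<nu>: "k x \<in> borel_measurable \<nu>" if "x \<in> ?X" for x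
      using measurable_Pair2[OF km that] \<nu>(3) by (simp cong: measurable_cong_sets)
    have nm: "(\<lambda>x. normalized_mean \<nu> (k x)) \<in> borel_measurable \<mu>"
    proof -
      have "(\<lambda>(x, y). k x y) \<in> borel_measurable (\<mu> \<Otimes>\<^sub>M \<nu>)"
        using km measurable_cong_sets[OF sets_pair_measure_cong[OF \<mu>(3) \<nu>(3)] refl] by blast
      from \<nu>.borel_measurable_lebesgue_integral[OF this] show ?thesis
        unfolding normalized_mean_def by simp
    qed
    have "?lim = (\<integral>z. (case z of (x, y) \<Rightarrow> k x y) + a \<partial>?Q)"
      by (simp add: k_def split_beta')
    also have "\<dots> = (\<integral>z. (case z of (x, y) \<Rightarrow> k x y) \<partial>?Q) + a"
      using int pp.P.prob_space by simp
    also have "(\<integral>z. (case z of (x, y) \<Rightarrow> k x y) \<partial>?Q)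
      = (\<integral>x. \<integral>y. k x y \<partial>prob_normalize \<nu> \<partial>prob_normalize \<mu>)"
      using pp.integral_fst'[OF int] by simp
    also have "\<dots> = (\<integral>x. normalized_mean \<nu> (k x) \<partial>prob_normalize \<mu>)"
      by (rule Bochner_Integration.integral_cong[OF refl])
         (simp add: sp_pn integral_prob_normalize[OF \<nu>(1,2) k\<nu>])
    also have "\<dots> = L" unfolding L_def by (rule integral_prob_normalize[OF \<mu>(1,2) nm])
    finally show ?thesis .
  qed
  let ?E = "{w \<in> space P. \<bar>R w - L\<bar> > \<epsilon>}"
  have E: "?E \<in> sets P" using Rm by measurable
  have "measure P {w \<in> space P. \<bar>?est w - ?lim\<bar> > \<epsilon>} \<le> measure P ?E"
  proof (rule P.finite_measure_mono_AE[OF _ E])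
    show "AE w in P. w \<in> {w \<in> space P. \<bar>?est w - ?lim\<bar> > \<epsilon>} \<longrightarrow> w \<in> ?E"
      using v(3) v'(3) AE_space
    proof eventually_elim
      case (elim w)
      show ?case unfolding lim using est[OF elim(3,1,2)] by simp
    qed
  qed
  also have "measure P ?E \<le> (if M = 0 then 0 else (B + B') * exp (- (min C C' / 4 * real N * \<epsilon>\<^sup>2 / M\<^sup>2)))"
  proof (cases "M = 0")
    \<comment> \<open>\<open>concentrates\<close> asks for a positive range, so zero oscillation is
      handled directly: the shifted function vanishes and the deviation event is empty.\<close>
    case True
    have k0: "k x y = 0" if "x \<in> ?X" "y \<in> ?X" for x y using kM[OF that] True by simp
    have "R w = 0" if "w \<in> space P" for w
      unfolding R_def weighted_mean_def using k0 xiX that by simp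
    moreover have "L = 0"
    proof -
      have "normalized_mean \<nu> (k x) = 0" if "x \<in> ?X" for x
      proof -
        have "(\<integral>y. k x y \<partial>\<nu>) = (\<integral>y. 0 \<partial>\<nu>)"
          by (rule Bochner_Integration.integral_cong[OF refl]) (use k0 that sp in simp)
        then show ?thesis by (simp add: normalized_mean_def)
      qed
      then have "(\<integral>x. normalized_mean \<nu> (k x) \<partial>\<mu>) = (\<integral>x. 0 \<partial>\<mu>)"
        by (intro Bochner_Integration.integral_cong[OF refl]) (use sp in simp)
      then show ?thesis unfolding L_def by (subst normalized_mean_def) simp
    qed
    ultimately have empty: "?E = {}" using \<epsilon> by auto
    show ?thesis unfolding empty using True by simp
  next
    case False
    then have M: "0 < M" using M0 by simp
    \<comment> \<open>Halving \<epsilon> costs a factor 4 in the exponent, the origin of the quarter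
      in the final rate.\<close>
    let ?r = "real N * \<epsilon>\<^sup>2 / (4 * M\<^sup>2)"
    have r: "0 \<le> ?r" by simp
    have e: "C * real N * (\<epsilon> / 2)\<^sup>2 / M\<^sup>2 = C * ?r" "C' * real N * (\<epsilon> / 2)\<^sup>2 / M\<^sup>2 = C' * ?r"
      "min C C' / 4 * real N * \<epsilon>\<^sup>2 / M\<^sup>2 = min C C' * ?r"
      by (simp_all add: power_divide)
    have "min C C' * ?r \<le> C * ?r" "min C C' * ?r \<le> C' * ?r"
      by (rule mult_right_mono[OF _ r]; simp)+
    then have m: "exp (- (C * ?r)) \<le> exp (- (min C C' * ?r))" "exp (- (C' * ?r)) \<le> exp (- (min C C' * ?r))"
      by simp_all
    have "measure P ?E \<le> B * exp (- (C * real N * (\<epsilon> / 2)\<^sup>2 / M\<^sup>2)) + B' * exp (- (C' * real N * (\<epsilon> / 2)\<^sup>2 / M\<^sup>2))"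
      unfolding R_def L_def
      by (rule concentrates_product[OF P F G indep v(1) xi v'(1) xi' \<nu> c c' km kM M \<epsilon>])
    also have "\<dots> \<le> (B + B') * exp (- (min C C' * ?r))"
      unfolding e distrib_right using m BB by (intro add_mono mult_left_mono)
    finally show ?thesis using False by (simp only: e if_False)
  qed
  finally show ?thesis unfolding M_def .
qed

theorem theorem1:
  fixes lam :: "'a measure" and T :: nat
    and q :: "'a \<Rightarrow> 'a \<Rightarrow> real" and g :: "nat \<Rightarrow> 'a \<Rightarrow> real" and chi :: "'a measure"
    and gam :: "nat \<Rightarrow> 'a \<Rightarrow> real"
    and rho0 :: "'a measure" and D :: "'a \<Rightarrow> ennreal"
    and th :: "nat \<Rightarrow> 'a \<Rightarrow> real" and p :: "nat \<Rightarrow> 'a \<Rightarrow> 'a \<Rightarrow> real"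
    and brho :: "'a \<Rightarrow> real"
    and bth :: "nat \<Rightarrow> 'a \<Rightarrow> real" and r :: "nat \<Rightarrow> 'a \<Rightarrow> 'a \<Rightarrow> real"
    and tth :: "nat \<Rightarrow> 'a \<Rightarrow> 'a \<Rightarrow> real" and tr :: "nat \<Rightarrow> 'a \<Rightarrow> 'a \<Rightarrow> 'a \<Rightarrow> real"
  defines "X \<equiv> space lam"
  assumes "countably_generated lam" and "sigma_finite_measure lam"
    and "transition_density lam q"
    and "\<forall>t\<le>T. g t \<in> borel_measurable lam \<and> (\<forall>x\<in>X. 0 < g t x)"
    and "prob_space chi" and "sets chi = sets lam"
    and "\<forall>t\<le>T. gam t \<in> borel_measurable lam \<and> (\<forall>x\<in>X. 0 < gam t x)"
    and "\<forall>t\<le>T. (\<integral>\<^sup>+x. ennreal (gam t x) * backward_likelihood lam q g T t x \<partial>lam) < \<infinity>"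
    and "prob_space rho0" and "sets rho0 = sets lam" and "absolutely_continuous rho0 chi"
    and "D \<in> borel_measurable lam" and "chi = density rho0 D"
    and "\<forall>t\<in>{1..T}. th t \<in> borel_measurable lam \<and> (\<forall>x\<in>X. 0 \<le> th t x)"
    and "\<forall>t\<in>{1..T}. transition_density lam (p t)"
    and "prob_density lam brho"
    and "\<forall>t<T. bth t \<in> borel_measurable lam \<and> (\<forall>x\<in>X. 0 \<le> bth t x)"
    and "\<forall>t<T. transition_density lam (r t)"
    and "\<forall>t\<in>{1..<T}. (\<lambda>(x, x'). tth t x x') \<in> borel_measurable (lam \<Otimes>\<^sub>M lam) \<and>
           (\<forall>x\<in>X. \<forall>x'\<in>X. 0 \<le> tth t x x')"
    and "\<forall>t\<in>{1..<T}. \<forall>x\<in>X. \<forall>x'\<in>X. prob_density lam (tr t x x')"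
    and "sup_norm (X \<times> X) (\<lambda>(x, x'). q x x') < \<infinity>"
    and "\<forall>t\<le>T. sup_norm X (g t) < \<infinity>"
    and "(SUP x\<in>X. omega0 D g x) < \<infinity>"
    and "\<forall>t\<in>{1..T}. (SUP (x, x')\<in>X \<times> X. omega q g th p t x x') < \<infinity>"
    and "\<forall>t\<in>{1..T}. sup_norm X (th t) < \<infinity>"
    and "\<forall>t\<in>{1..T}. sup_norm (X \<times> X) (\<lambda>(x, x'). p t x x') < \<infinity>"
    and "\<forall>t<T. sup_norm X (\<lambda>x. bth t x / gam (Suc t) x) < \<infinity>"
    and "\<forall>t<T. sup_norm (X \<times> X) (\<lambda>(x', x). r t x' x) < \<infinity>"
    and "(SUP x\<in>X. bomegaT g gam brho T x) < \<infinity>"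
    and "\<forall>t<T. (SUP (x, x')\<in>X \<times> X. bomega q g gam bth r t x x') < \<infinity>"
    and "\<forall>t\<in>{1..<T}. sup_norm (X \<times> X) (odot (tth t) (\<lambda>x. inverse (gam (Suc t) x))) < \<infinity>"
    and "\<forall>t\<in>{1..<T}. sup_norm (X \<times> X) (odot q (\<lambda>x. inverse (gam (Suc t) x))) < \<infinity>"
    and "\<forall>t\<in>{1..<T}. (SUP (x, x', x'')\<in>X \<times> X \<times> X. tomega q g tth tr t x x' x'') < \<infinity>"
    and "\<forall>t\<in>{1..<T}. sup_norm (X \<times> X \<times> X) (\<lambda>(x, x', x''). tr t x x' x'') < \<infinity>"
  shows "\<forall>s t. s < t \<and> t \<le> T \<longrightarrow>
    (\<exists>B>0. \<exists>C>0. \<forall>N\<ge>1.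
      \<forall>(P :: 'w measure) xi I bxi bI.
        prob_space P \<and>
        forward_system P lam T N q g rho0 D th p xi I \<and>
        backward_system P lam T N q g gam brho bth r bxi bI \<and>
        indep_systems P lam T N xi I bxi bI \<longrightarrow>
        (let \<omega> = forward_weight q g D th p xi I s;
             \<Omega> = (\<lambda>w. \<Sum>l\<in>{1..N}. \<omega> l w);
             b\<omega> = backward_weight T q g gam brho bth r bxi bI t;
             b\<Omega> = (\<lambda>w. \<Sum>l\<in>{1..N}. b\<omega> l w)
         in (AE w in P. 0 < \<Omega> w) \<and> (AE w in P. 0 < b\<Omega> w) \<longrightarrow>
        (\<forall>\<epsilon>>0. \<forall>h :: 'a \<times> 'a \<Rightarrow> real.
          h \<in> borel_measurable (lam \<Otimes>\<^sub>M lam) \<and> bounded (h ` (X \<times> X)) \<longrightarrow>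
          \<P>(w in P.
             \<bar>(\<Sum>i\<in>{1..N}. \<Sum>j\<in>{1..N}. enn2real (\<omega> i w / \<Omega> w) * enn2real (b\<omega> j w / b\<Omega> w) *
                   h (xi s i w, bxi t j w))
              - (\<integral>z. h z \<partial>(filter_dist lam q g chi s \<Otimes>\<^sub>M backward_info_filter lam q g gam T t))\<bar>
             > \<epsilon>)
          \<le> (if osc (X \<times> X) h = 0 then 0
              else B * exp (- (C * real N * \<epsilon>\<^sup>2 / (osc (X \<times> X) h)\<^sup>2))))))"
proof (intro allI impI, elim conjE)
  fix s t :: nat assume st: "s < t" and t: "t \<le> T"
  then have s: "s \<le> T" by simp
  note a = assms[unfolded X_def]
  interpret chain: hidden_chain lam q g T
  proof (rule hidden_chain.intro)
    show "sigma_finite_measure lam" "transition_density lam q" by (fact a)+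
    show "g t \<in> borel_measurable lam" "x \<in> space lam \<Longrightarrow> 0 < g t x"
      "sup_norm (space lam) (g t) < \<infinity>" if "t \<le> T" for t x
      using a(5,23) that by blast+
  qed
  interpret fwd: forward_filter lam q g T chi rho0 D th p
  proof (intro forward_filter.intro forward_filter_axioms.intro)
    show "hidden_chain lam q g T" by (fact chain.hidden_chain_axioms)
    show "prob_space chi" "sets chi = sets lam" "sets rho0 = sets lam"
      "D \<in> borel_measurable lam" "chi = density rho0 D"
      "(SUP x\<in>space lam. omega0 D g x) < \<infinity>" by (fact a)+
    show "th t \<in> borel_measurable lam" "x \<in> space lam \<Longrightarrow> 0 \<le> th t x" "transition_density lam (p t)"
      "(SUP (x, x')\<in>space lam \<times> space lam. omega q g th p t x x') < \<infinity>"
      "sup_norm (space lam) (th t) < \<infinity>" if "t \<in> {1..T}" for t x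
      using a(15,16,25,26) that by blast+
  qed
  interpret bwd: backward_filter lam q g T gam brho bth r
  proof (intro backward_filter.intro backward_filter_axioms.intro)
    show "hidden_chain lam q g T" by (fact chain.hidden_chain_axioms)
    show "prob_density lam brho" "(SUP x\<in>space lam. bomegaT g gam brho T x) < \<infinity>" by (fact a)+
    show "gam t \<in> borel_measurable lam" "x \<in> space lam \<Longrightarrow> 0 < gam t x"
      "(\<integral>\<^sup>+x. ennreal (gam t x) * backward_likelihood lam q g T t x \<partial>lam) < \<infinity>"
      if "t \<le> T" for t x
      using a(8,9) that by blast+
    show "bth t \<in> borel_measurable lam" "x \<in> space lam \<Longrightarrow> 0 \<le> bth t x" "transition_density lam (r t)"
      "(SUP (x, x')\<in>space lam \<times> space lam. bomega q g gam bth r t x x') < \<infinity>"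
      "sup_norm (space lam) (\<lambda>x. bth t x / gam (Suc t) x) < \<infinity>" if "t < T" for t x
      using a(18,19,28,31) that by blast+
  qed
  obtain B C where B: "0 < B" and C: "0 < C" and fc: "\<And>N (P :: 'w measure) xi I. 1 \<le> N \<Longrightarrow>
      prob_space P \<Longrightarrow> forward_system P lam T N q g rho0 D th p xi I \<Longrightarrow>
      concentrates P lam N (forward_weight q g D th p xi I s) (xi s) (forward_measure lam q g chi s) B C"
    using fwd.forward_concentrates[OF s] by blast
  obtain B' C' where B': "0 < B'" and C': "0 < C'" and bc: "\<And>N (P :: 'w measure) bxi bI. 1 \<le> N \<Longrightarrow>
      prob_space P \<Longrightarrow> backward_system P lam T N q g gam brho bth r bxi bI \<Longrightarrow>
      concentrates P lam N (backward_weight T q g gam brho bth r bxi bI t) (bxi t)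
        (backward_measure lam q g gam T t) B' C'"
    using bwd.backward_concentrates[OF t] by blast
  \<comment> \<open>Needed for \<open>osc\<close> and the infimum of \<open>h\<close> to be genuine
    extrema over a nonempty set.\<close>
  have ne: "space lam \<noteq> {}"
    using prob_space.not_empty[OF fwd.chi(1)] fwd.space_chi by simp
  let ?P = "\<lambda>B C. \<forall>N\<ge>1. \<forall>(P :: 'w measure) xi I bxi bI.
        prob_space P \<and>
        forward_system P lam T N q g rho0 D th p xi I \<and>
        backward_system P lam T N q g gam brho bth r bxi bI \<and>
        indep_systems P lam T N xi I bxi bI \<longrightarrow>
        (let \<omega> = forward_weight q g D th p xi I s;
             \<Omega> = (\<lambda>w. \<Sum>l\<in>{1..N}. \<omega> l w);
             b\<omega> = backward_weight T q g gam brho bth r bxi bI t;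
             b\<Omega> = (\<lambda>w. \<Sum>l\<in>{1..N}. b\<omega> l w)
         in (AE w in P. 0 < \<Omega> w) \<and> (AE w in P. 0 < b\<Omega> w) \<longrightarrow>
        (\<forall>\<epsilon>>0. \<forall>h :: 'a \<times> 'a \<Rightarrow> real.
          h \<in> borel_measurable (lam \<Otimes>\<^sub>M lam) \<and> bounded (h ` (X \<times> X)) \<longrightarrow>
          \<P>(w in P.
             \<bar>(\<Sum>i\<in>{1..N}. \<Sum>j\<in>{1..N}. enn2real (\<omega> i w / \<Omega> w) * enn2real (b\<omega> j w / b\<Omega> w) *
                   h (xi s i w, bxi t j w))
              - (\<integral>z. h z \<partial>(filter_dist lam q g chi s \<Otimes>\<^sub>M backward_info_filter lam q g gam T t))\<bar>
             > \<epsilon>)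
          \<le> (if osc (X \<times> X) h = 0 then 0
              else B * exp (- (C * real N * \<epsilon>\<^sup>2 / (osc (X \<times> X) h)\<^sup>2)))))"
  \<comment> \<open>The witnesses combine constants that were obtained before any particle system
    was fixed, so they are the same for every \<open>N\<close>, \<epsilon> and
    \<open>h\<close>.\<close>
  have "?P (B + B') (min C C' / 4)"
    unfolding Let_def
  proof (intro allI impI, elim conjE)
    fix N :: nat and P :: "'w measure" and xi I bxi bI and \<epsilon> :: real and h :: "'a \<times> 'a \<Rightarrow> real"
    assume N: "1 \<le> N" and P: "prob_space P"
      and fs: "forward_system P lam T N q g rho0 D th p xi I"
      and bs: "backward_system P lam T N q g gam brho bth r bxi bI"
      and ind: "indep_systems P lam T N xi I bxi bI"
      and pos: "AE w in P. 0 < (\<Sum>l\<in>{1..N}. forward_weight q g D th p xi I s l w)"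
        "AE w in P. 0 < (\<Sum>l\<in>{1..N}. backward_weight T q g gam brho bth r bxi bI t l w)"
      and \<epsilon>: "0 < \<epsilon>" and h: "h \<in> borel_measurable (lam \<Otimes>\<^sub>M lam)" "bounded (h ` (X \<times> X))"
    \<comment> \<open>Full histories, for which independence is given. The weights at
      \<open>s\<close> and \<open>t\<close> are measurable with respect to them because ancestors
      are looked up inside the history.\<close>
    let ?F = "particle_algebra P lam N {..T} {1..T} xi I"
    let ?G = "particle_algebra P lam N {..T} {..<T} bxi bI"
    note fm = fwd.forward_particles_measurable[OF fs P]
    note bm = bwd.backward_particles_measurable[OF bs P]
    have F: "subalgebra P ?F"
      by (rule subalgebra_particle_algebra[where S = "{1..N}"]) (use fm in auto)
    have G: "subalgebra P ?G"
      by (rule subalgebra_particle_algebra[where S = "{1..N}"]) (use bm in auto)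
    have xiF: "xi u l \<in> measurable ?F lam" if "u \<le> T" "l \<in> {1..N}" for u l
      by (rule particle_measurable) (use that measurable_space[OF fm(1)] in auto)
    have IF: "I u l \<in> measurable ?F (count_space {1..N})" if "u \<in> {1..T}" "l \<in> {1..N}" for u l
      by (rule index_measurable) (use that measurable_space[OF fm(2)] in auto)
    have xiG: "bxi u l \<in> measurable ?G lam" if "u \<le> T" "l \<in> {1..N}" for u l
      by (rule particle_measurable) (use that measurable_space[OF bm(1)] in auto)
    have IG: "bI u l \<in> measurable ?G (count_space {1..N})" if "u < T" "l \<in> {1..N}" for u l
      by (rule index_measurable) (use that measurable_space[OF bm(2)] in auto)
    have vF: "forward_weight q g D th p xi I s l \<in> borel_measurable ?F" if "l \<in> {1..N}" for l
      by (rule fwd.forward_weight_measurable[OF s that]) (use xiF IF s in auto)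
    have vG: "backward_weight T q g gam brho bth r bxi bI t l \<in> borel_measurable ?G"
      if "l \<in> {1..N}" for l
      by (rule bwd.backward_weight_measurable[OF t that]) (use xiG IG in auto)
    show "\<P>(w in P.
        \<bar>(\<Sum>i\<in>{1..N}. \<Sum>j\<in>{1..N}.
            enn2real (forward_weight q g D th p xi I s i w
              / (\<Sum>l\<in>{1..N}. forward_weight q g D th p xi I s l w))
            * enn2real (backward_weight T q g gam brho bth r bxi bI t j w
              / (\<Sum>l\<in>{1..N}. backward_weight T q g gam brho bth r bxi bI t l w))
            * h (xi s i w, bxi t j w))
          - (\<integral>z. h z \<partial>(filter_dist lam q g chi s \<Otimes>\<^sub>M backward_info_filter lam q g gam T t))\<bar> > \<epsilon>)
      \<le> (if osc (X \<times> X) h = 0 then 0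
          else (B + B') * exp (- (min C C' / 4 * real N * \<epsilon>\<^sup>2 / (osc (X \<times> X) h)\<^sup>2)))"
      unfolding filter_dist_def backward_info_filter_def X_def
      by (rule product_estimator_deviation[OF P F G ind[unfolded indep_systems_def]
            vF fwd.forward_weight_finite[OF s _ _ fs P] pos(1) xiF[OF s]
            vG bwd.backward_weight_finite[OF t _ _ bs P] pos(2) xiG[OF t]
            fwd.finite_forward_measure[OF s] fwd.sets_forward_measure
            bwd.finite_backward_measure[OF t] bwd.sets_backward_measure
            fc[OF N P fs] bc[OF N P bs] less_imp_le[OF B] less_imp_le[OF B']
            h[unfolded X_def] ne \<epsilon>])
  qed
  moreover have "0 < B + B'" "0 < min C C' / 4" using B B' C C' by simp_all
  ultimately show "\<exists>B>0. \<exists>C>0. ?P B C" by blast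
qed

end
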